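(* Let $n\ge1$ and let $\tau:C^*(\mathbb R^{2n})\to\mathcal F_n$ be an almost homomorphism such that $\tau(f)(0)=f$ for every $f\in C^*(\mathbb R^{2n})$. Let $D_\tau(H_n)$ be the set of all $F=(F(\lambda))_{\lambda\in\mathbb R}\in\mathcal F_n$ such that $\lim_{\lambda\to0}\|F(\lambda)-\tau_\lambda(F(0))\|_{\rm op}=0$. Then the subspace $D_\tau(H_n)$ of the $C^*$-algebra $\mathcal F_n$ is itself a $C^*$-algebra. Moreover $D_\tau(H_n)$ is an extension of $C_0(\mathbb R^*,\mathcal K)$ by $C^*(\mathbb R^{2n})$, i.e. $C_0(\mathbb R^*,\mathcal K)$ is a closed $*$-ideal in $D_\tau(H_n)$ such that $D_\tau(H_n)/C_0(\mathbb R^*,\mathcal K)$ is isomorphic to $C^*(\mathbb R^{2n})$.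
   Context: $\mathbb R^*=\mathbb R\setminus\{0\}$; $\mathcal K$ is the algebra of compact operators on $L^2(\mathbb R^n)$; $C^*(\mathbb R^{2n})$ is the group $C^*$-algebra of $\mathbb R^{2n}$. $\mathcal F_n$ is the $C^*$-algebra (with pointwise operations) of all operator fields $F=(F(\lambda))_{\lambda\in\mathbb R}$ such that: $F(\lambda)\in\mathcal K$ for every $\lambda\in\mathbb R^*$; $F(0)\in C^*(\mathbb R^{2n})$; $\lambda\mapsto F(\lambda)$ is norm continuous on $\mathbb R^*$; $\lim_{|\lambda|\to\infty}\|F(\lambda)\|_{\rm op}=0$; and $\|F\|:=\max\{\sup_{\lambda\in\mathbb R^*}\|F(\lambda)\|_{\rm op},\|F(0)\|_{C^*(\mathbb R^{2n})}\}<\infty$. The algebra $C_0(\mathbb R^*,\mathcal K)$ of continuous functions $\mathbb R^*\to\mathcal K$ vanishing at infinity on $\mathbb R^*$ (i.e. as $\lambda\to0$ and as $|\lambda|\to\infty$) is regarded as a subset of $\mathcal F_n$ by setting the value at $\lambda=0$ equal to $0$. A bounded (not necessarily linear) mapping $\tau:C^*(\mathbb R^{2n})\to\mathcal F_n$, i.e. one with $\|\tau(h)\|\le K\|h\|$ for some constant $K$ and all $h$, is called an almost homomorphism if, writing $\tau_\lambda(h)=\tau(h)(\lambda)$, for all $\alpha,\beta\in\mathbb C$ and $f,h,h'\in C^*(\mathbb R^{2n})$: $\lim_{\lambda\to0}\|\tau_\lambda(\alpha h+\beta f)-\alpha\tau_\lambda(h)-\beta\tau_\lambda(f)\|_{\rm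 op}=0$, $\lim_{\lambda\to0}\|\tau_\lambda(h\cdot h')-\tau_\lambda(h)\circ\tau_\lambda(h')\|_{\rm op}=0$, and $\lim_{\lambda\to0}\|\tau_\lambda(h^* )-\tau_\lambda(h)^*\|_{\rm op}=0$. *)

theory Defs
  imports "HOL-Analysis.Analysis"
begin

section \<open>Normed complex *-algebras on carrier sets\<close>

record 'a star_alg =
  car :: "'a set"
  zer :: 'a
  add :: "'a \<Rightarrow> 'a \<Rightarrow> 'a"
  smul :: "complex \<Rightarrow> 'a \<Rightarrow> 'a"
  mul :: "'a \<Rightarrow> 'a \<Rightarrow> 'a"
  star :: "'a \<Rightarrow> 'a"
  nrm :: "'a \<Rightarrow> real"

definition dif :: "'a star_alg \<Rightarrow> 'a \<Rightarrow> 'a \<Rightarrow> 'a" where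
  "dif A x y = add A x (smul A (-1) y)"

definition cauchy_seqs :: "'a star_alg \<Rightarrow> (nat \<Rightarrow> 'a) set" where
  "cauchy_seqs A = {X. (\<forall>k. X k \<in> car A) \<and>
     (\<forall>e>0. \<exists>N. \<forall>j\<ge>N. \<forall>k\<ge>N. nrm A (dif A (X j) (X k)) < e)}"

locale cstar_algebra =
  fixes A :: "'a star_alg"
  assumes zer_closed: "zer A \<in> car A"
    and add_closed: "\<lbrakk>x \<in> car A; y \<in> car A\<rbrakk> \<Longrightarrow> add A x y \<in> car A"
    and smul_closed: "x \<in> car A \<Longrightarrow> smul A a x \<in> car A"
    and mul_closed: "\<lbrakk>x \<in> car A; y \<in> car A\<rbrakk> \<Longrightarrow> mul A x y \<in> car A"
    and star_closed: "x \<in> car A \<Longrightarrow> star A x \<in> car A"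
    and add_assoc: "\<lbrakk>x \<in> car A; y \<in> car A; z \<in> car A\<rbrakk>
          \<Longrightarrow> add A (add A x y) z = add A x (add A y z)"
    and add_commute: "\<lbrakk>x \<in> car A; y \<in> car A\<rbrakk> \<Longrightarrow> add A x y = add A y x"
    and add_zer: "x \<in> car A \<Longrightarrow> add A x (zer A) = x"
    and dif_self: "x \<in> car A \<Longrightarrow> dif A x x = zer A"
    and smul_one: "x \<in> car A \<Longrightarrow> smul A 1 x = x"
    and smul_smul: "x \<in> car A \<Longrightarrow> smul A a (smul A b x) = smul A (a * b) x"
    and smul_add_left: "x \<in> car A \<Longrightarrow> smul A (a + b) x = add A (smul A a x) (smul A b x)"
    and smul_add_right: "\<lbrakk>x \<in> car A; y \<in> car A\<rbrakk>
          \<Longrightarrow> smul A a (add A x y) = add A (smul A a x) (smul A a y)"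
    and mul_assoc: "\<lbrakk>x \<in> car A; y \<in> car A; z \<in> car A\<rbrakk>
          \<Longrightarrow> mul A (mul A x y) z = mul A x (mul A y z)"
    and mul_add_left: "\<lbrakk>x \<in> car A; y \<in> car A; z \<in> car A\<rbrakk>
          \<Longrightarrow> mul A (add A x y) z = add A (mul A x z) (mul A y z)"
    and mul_add_right: "\<lbrakk>x \<in> car A; y \<in> car A; z \<in> car A\<rbrakk>
          \<Longrightarrow> mul A x (add A y z) = add A (mul A x y) (mul A x z)"
    and mul_smul_left: "\<lbrakk>x \<in> car A; y \<in> car A\<rbrakk> \<Longrightarrow> mul A (smul A a x) y = smul A a (mul A x y)"
    and mul_smul_right: "\<lbrakk>x \<in> car A; y \<in> car A\<rbrakk> \<Longrightarrow> mul A x (smul A a y) = smul A a (mul A x y)"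
    and star_star: "x \<in> car A \<Longrightarrow> star A (star A x) = x"
    and star_add: "\<lbrakk>x \<in> car A; y \<in> car A\<rbrakk> \<Longrightarrow> star A (add A x y) = add A (star A x) (star A y)"
    and star_smul: "x \<in> car A \<Longrightarrow> star A (smul A a x) = smul A (cnj a) (star A x)"
    and star_mul: "\<lbrakk>x \<in> car A; y \<in> car A\<rbrakk> \<Longrightarrow> star A (mul A x y) = mul A (star A y) (star A x)"
    and nrm_nonneg: "x \<in> car A \<Longrightarrow> 0 \<le> nrm A x"
    and nrm_eq_0: "x \<in> car A \<Longrightarrow> nrm A x = 0 \<longleftrightarrow> x = zer A"
    and nrm_add: "\<lbrakk>x \<in> car A; y \<in> car A\<rbrakk> \<Longrightarrow> nrm A (add A x y) \<le> nrm A x + nrm A y"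
    and nrm_smul: "x \<in> car A \<Longrightarrow> nrm A (smul A a x) = cmod a * nrm A x"
    and nrm_mul: "\<lbrakk>x \<in> car A; y \<in> car A\<rbrakk> \<Longrightarrow> nrm A (mul A x y) \<le> nrm A x * nrm A y"
    and cstar_identity: "x \<in> car A \<Longrightarrow> nrm A (mul A (star A x) x) = (nrm A x)\<^sup>2"
    and complete: "X \<in> cauchy_seqs A
          \<Longrightarrow> \<exists>x \<in> car A. (\<lambda>k. nrm A (dif A (X k) x)) \<longlonglongrightarrow> 0"

definition closed_star_ideal :: "'a star_alg \<Rightarrow> 'a set \<Rightarrow> bool" where
  "closed_star_ideal A I \<longleftrightarrow>
     I \<subseteq> car A \<and> zer A \<in> I \<and>
     (\<forall>x\<in>I. \<forall>y\<in>I. add A x y \<in> I) \<and>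
     (\<forall>a. \<forall>x\<in>I. smul A a x \<in> I) \<and>
     (\<forall>x\<in>I. star A x \<in> I) \<and>
     (\<forall>x\<in>I. \<forall>y\<in>car A. mul A x y \<in> I \<and> mul A y x \<in> I) \<and>
     (\<forall>X x. (\<forall>k. X k \<in> I) \<and> x \<in> car A \<and> (\<lambda>k. nrm A (dif A (X k) x)) \<longlonglongrightarrow> 0 \<longrightarrow> x \<in> I)"

definition coset :: "'a star_alg \<Rightarrow> 'a set \<Rightarrow> 'a \<Rightarrow> 'a set" where
  "coset A I x = {add A x i | i. i \<in> I}"

text \<open>The quotient algebra, with operations induced by representatives and the quotient norm.\<close>

definition quotient_alg :: "'a star_alg \<Rightarrow> 'a set \<Rightarrow> 'a set star_alg" where
  "quotient_alg A I = \<lparr>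
     car = coset A I ` car A,
     zer = coset A I (zer A),
     add = (\<lambda>U V. \<Union>x\<in>U. \<Union>y\<in>V. coset A I (add A x y)),
     smul = (\<lambda>a U. \<Union>x\<in>U. coset A I (smul A a x)),
     mul = (\<lambda>U V. \<Union>x\<in>U. \<Union>y\<in>V. coset A I (mul A x y)),
     star = (\<lambda>U. \<Union>x\<in>U. coset A I (star A x)),
     nrm = (\<lambda>U. INF x\<in>U. nrm A x) \<rparr>"

text \<open>The last clause is automatic for *-isomorphisms between C*-algebras.\<close>

definition cstar_isomorphic :: "'a star_alg \<Rightarrow> 'b star_alg \<Rightarrow> bool" where
  "cstar_isomorphic A B \<longleftrightarrow> (\<exists>\<phi>. bij_betw \<phi> (car A) (car B) \<and>
     (\<forall>x\<in>car A. \<forall>y\<in>car A. \<phi> (add A x y) = add B (\<phi> x) (\<phi> y)) \<and>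
     (\<forall>a. \<forall>x\<in>car A. \<phi> (smul A a x) = smul B a (\<phi> x)) \<and>
     (\<forall>x\<in>car A. \<forall>y\<in>car A. \<phi> (mul A x y) = mul B (\<phi> x) (\<phi> y)) \<and>
     (\<forall>x\<in>car A. \<phi> (star A x) = star B (\<phi> x)) \<and>
     (\<forall>x\<in>car A. nrm B (\<phi> x) = nrm A x))"


section \<open>Enveloping C*-algebras\<close>

text \<open>The Hausdorff completion of a *-algebra with respect to a (semi)norm: Cauchy sequences
  modulo sequences at distance tending to zero.\<close>

definition null_rel :: "'a star_alg \<Rightarrow> ((nat \<Rightarrow> 'a) \<times> (nat \<Rightarrow> 'a)) set" where
  "null_rel A = {(X, Y). X \<in> cauchy_seqs A \<and> Y \<in> cauchy_seqs A \<and>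
     (\<lambda>k. nrm A (dif A (X k) (Y k))) \<longlonglongrightarrow> 0}"

definition completion :: "'a star_alg \<Rightarrow> (nat \<Rightarrow> 'a) set star_alg" where
  "completion A = \<lparr>
     car = cauchy_seqs A // null_rel A,
     zer = null_rel A `` {\<lambda>k. zer A},
     add = (\<lambda>U V. \<Union>X\<in>U. \<Union>Y\<in>V. null_rel A `` {\<lambda>k. add A (X k) (Y k)}),
     smul = (\<lambda>a U. \<Union>X\<in>U. null_rel A `` {\<lambda>k. smul A a (X k)}),
     mul = (\<lambda>U V. \<Union>X\<in>U. \<Union>Y\<in>V. null_rel A `` {\<lambda>k. mul A (X k) (Y k)}),
     star = (\<lambda>U. \<Union>X\<in>U. null_rel A `` {\<lambda>k. star A (X k)}),
     nrm = (\<lambda>U. the_elem ((\<lambda>X. lim (\<lambda>k. nrm A (X k))) ` U)) \<rparr>"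

text \<open>C*-seminorms are the functions \<open>x \<mapsto> \<parallel>\<pi>(x)\<parallel>\<close> for *-representations \<open>\<pi>\<close> on Hilbert spaces.
  On a Banach *-algebra with isometric involution they are automatically bounded by the given
  norm, so that clause excludes nothing there.\<close>

definition cstar_seminorm :: "'a star_alg \<Rightarrow> ('a \<Rightarrow> real) \<Rightarrow> bool" where
  "cstar_seminorm A p \<longleftrightarrow>
     (\<forall>x\<in>car A. 0 \<le> p x \<and> p x \<le> nrm A x) \<and>
     (\<forall>x\<in>car A. \<forall>y\<in>car A. p (add A x y) \<le> p x + p y) \<and>
     (\<forall>a. \<forall>x\<in>car A. p (smul A a x) = cmod a * p x) \<and>
     (\<forall>x\<in>car A. \<forall>y\<in>car A. p (mul A x y) \<le> p x * p y) \<and>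
     (\<forall>x\<in>car A. p (mul A (star A x) x) = (p x)\<^sup>2)"

definition enveloping_cstar :: "'a star_alg \<Rightarrow> (nat \<Rightarrow> 'a) set star_alg" where
  "enveloping_cstar A = completion (A\<lparr>nrm := (\<lambda>x. SUP p\<in>{p. cstar_seminorm A p}. p x)\<rparr>)"


section \<open>The group C*-algebra of a finite-dimensional real vector space\<close>

text \<open>The group is the additive group of a Euclidean space, with Lebesgue measure as Haar measure.
  Elements of \<open>L\<^sup>1\<close> are integrable functions modulo equality almost everywhere.\<close>

quotient_type (overloaded) 'a L1 = "'a::euclidean_space \<Rightarrow> complex" /
  partial: "\<lambda>f g. integrable lborel f \<and> integrable lborel g \<and> (AE x in lborel. f x = g x)"
proof (rule part_equivpI)
  show "\<exists>f::'a \<Rightarrow> complex. integrable lborel f \<and> integrable lborel f \<and> (AE x in lborel. f x = f x)"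
    by (rule exI[of _ "\<lambda>_. 0"]) simp
qed (auto intro!: sympI transpI)

lemma lborel_distr_reflect:
  "distr lborel borel (\<lambda>y::'a::euclidean_space. x - y) = lborel"
proof -
  have "(lborel :: 'a measure) = density (distr lborel borel (\<lambda>y. x + (- 1) *\<^sub>R y)) (\<lambda>_. 1)"
    using lborel_affine[of "-1" x] by simp
  then show ?thesis by (simp add: density_1)
qed

lemma AE_lborel_reflect:
  fixes x :: "'a::euclidean_space"
  assumes "AE y in lborel. P y" shows "AE y in lborel. P (x - y)"
proof -
  have "AE y in distr lborel borel (\<lambda>y. x - y). P y"
    using assms by (subst lborel_distr_reflect)
  then show ?thesis by (rule AE_distrD[rotated]) simp
qed

lemma integrable_lborel_reflect:
  fixes x :: "'a::euclidean_space" and f :: "'a \<Rightarrow> complex"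
  assumes "integrable lborel f" shows "integrable lborel (\<lambda>y. f (x - y))"
proof (rule integrable_distr[where f = f and T = "\<lambda>y. x - y" and M = lborel and M' = borel])
    show "integrable (distr lborel borel (\<lambda>y. x - y)) f"
      using assms by (subst lborel_distr_reflect)
qed simp

lemma lborel_distr_translate:
  "distr lborel borel (\<lambda>y::'a::euclidean_space. y - x) = lborel"
proof -
  have "(lborel :: 'a measure) = density (distr lborel borel (\<lambda>y. (- x) + 1 *\<^sub>R y)) (\<lambda>_. 1)"
    using lborel_affine[of 1 "-x"] by (simp del: scaleR_one)
  then show ?thesis by (simp add: density_1)
qed

lemma integrable_lborel_translate:
  fixes x :: "'a::euclidean_space" and f :: "'a \<Rightarrow> complex"
  assumes "integrable lborel f" shows "integrable lborel (\<lambda>y. f (y - x))"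
proof (rule integrable_distr[where f = f and T = "\<lambda>y. y - x" and M = lborel and M' = borel])
    show "integrable (distr lborel borel (\<lambda>y. y - x)) f"
      using assms by (subst lborel_distr_translate)
qed simp

lemma integral_norm_translate:
  fixes x :: "'a::euclidean_space" and f :: "'a \<Rightarrow> complex"
  assumes "integrable lborel f"
  shows "(\<integral>y. norm (f (y - x)) \<partial>lborel) = (\<integral>y. norm (f y) \<partial>lborel)"
proof -
  have "(\<integral>y. norm (f y) \<partial>distr lborel borel (\<lambda>y. y - x)) = (\<integral>y. norm (f (y - x)) \<partial>lborel)"
    using assms by (intro integral_distr) auto
  then show ?thesis by (simp add: lborel_distr_translate)
qed

lemma integrable_convolution:
  fixes f g :: "'a::euclidean_space \<Rightarrow> complex"
  assumes f: "integrable lborel f" and g: "integrable lborel g"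
  shows "integrable lborel (\<lambda>x. \<integral>y. f y * g (x - y) \<partial>lborel)"
proof -
  have [measurable]: "f \<in> borel_measurable borel" "g \<in> borel_measurable borel"
    using f g by auto
  have "integrable (lborel \<Otimes>\<^sub>M lborel) (\<lambda>(y, x). f y * g (x - y))"
  proof (rule lborel_pair.Fubini_integrable)
    show "(\<lambda>(y, x). f y * g (x - y)) \<in> borel_measurable (lborel \<Otimes>\<^sub>M lborel)"
      by measurable
    show "integrable lborel (\<lambda>y. \<integral>x. norm (case (y, x) of (y, x) \<Rightarrow> f y * g (x - y)) \<partial>lborel)"
      using f by (simp add: norm_mult integral_norm_translate[OF g])
    show "AE y in lborel. integrable lborel (\<lambda>x. case (y, x) of (y, x) \<Rightarrow> f y * g (x - y))"
      using g by (simp add: integrable_lborel_translate)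
  qed
  then show ?thesis
    by (rule lborel_pair.integrable_snd)
qed

lift_definition L1_zero :: "'a::euclidean_space L1" is "\<lambda>_. 0" by simp

lift_definition L1_add :: "'a::euclidean_space L1 \<Rightarrow> 'a L1 \<Rightarrow> 'a L1" is
  "\<lambda>f g x. f x + g x" by auto

lift_definition L1_smul :: "complex \<Rightarrow> 'a::euclidean_space L1 \<Rightarrow> 'a L1" is
  "\<lambda>a f x. a * f x" by auto

text \<open>The convolution integral converges for almost every \<open>x\<close>; elsewhere \<open>integral\<^sup>L\<close> is 0.\<close>

lift_definition L1_conv :: "'a::euclidean_space L1 \<Rightarrow> 'a L1 \<Rightarrow> 'a L1" is
  "\<lambda>f g x. \<integral>y. f y * g (x - y) \<partial>lborel"
proof -
  fix f f' g g' :: "'a \<Rightarrow> complex"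
  assume f: "integrable lborel f \<and> integrable lborel f' \<and> (AE x in lborel. f x = f' x)"
    and g: "integrable lborel g \<and> integrable lborel g' \<and> (AE x in lborel. g x = g' x)"
  have m: "f \<in> borel_measurable borel" "f' \<in> borel_measurable borel"
    "g \<in> borel_measurable borel" "g' \<in> borel_measurable borel"
    using f g by auto
  have "(\<integral>y. f y * g (x - y) \<partial>lborel) = (\<integral>y. f' y * g' (x - y) \<partial>lborel)" for x
  proof (rule integral_cong_AE)
    show "AE y in lborel. f y * g (x - y) = f' y * g' (x - y)"
      using f AE_lborel_reflect[of "\<lambda>y. g y = g' y" x] g by auto
  qed (use m in measurable)
  then show "integrable lborel (\<lambda>x. \<integral>y. f y * g (x - y) \<partial>lborel) \<and>
    integrable lborel (\<lambda>x. \<integral>y. f' y * g' (x - y) \<partial>lborel) \<and>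
    (AE x in lborel. (\<integral>y. f y * g (x - y) \<partial>lborel) = (\<integral>y. f' y * g' (x - y) \<partial>lborel))"
    using f g by (simp add: integrable_convolution)
qed

lift_definition L1_star :: "'a::euclidean_space L1 \<Rightarrow> 'a L1" is
  "\<lambda>f x. cnj (f (- x))"
proof -
  fix f g :: "'a \<Rightarrow> complex"
  assume "integrable lborel f \<and> integrable lborel g \<and> (AE x in lborel. f x = g x)"
  then show "integrable lborel (\<lambda>x. cnj (f (- x))) \<and> integrable lborel (\<lambda>x. cnj (g (- x))) \<and>
      (AE x in lborel. cnj (f (- x)) = cnj (g (- x)))"
    using integrable_lborel_reflect[of f 0] integrable_lborel_reflect[of g 0]
      AE_lborel_reflect[of "\<lambda>x. f x = g x" 0] by simp
qed

lift_definition L1_norm :: "'a::euclidean_space L1 \<Rightarrow> real" is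
  "\<lambda>f. \<integral>x. cmod (f x) \<partial>lborel"
  by (auto intro!: integral_cong_AE)

definition L1_alg :: "'a::euclidean_space L1 star_alg" where
  "L1_alg = \<lparr> car = UNIV, zer = L1_zero, add = L1_add, smul = L1_smul,
     mul = L1_conv, star = L1_star, nrm = L1_norm \<rparr>"

definition group_cstar :: "(nat \<Rightarrow> 'a::euclidean_space L1) set star_alg" where
  "group_cstar = enveloping_cstar L1_alg"


section \<open>The Hilbert space of square-integrable functions\<close>

definition square_integrable :: "('a::euclidean_space \<Rightarrow> complex) \<Rightarrow> bool" where
  "square_integrable f \<longleftrightarrow> f \<in> borel_measurable lborel \<and> integrable lborel (\<lambda>x. (cmod (f x))\<^sup>2)"

lemma square_integrable_mult:
  assumes "square_integrable f" "square_integrable g"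
  shows "integrable lborel (\<lambda>x. f x * cnj (g x))"
proof (rule Bochner_Integration.integrable_bound)
  show "integrable lborel (\<lambda>x. (cmod (f x))\<^sup>2 + (cmod (g x))\<^sup>2)"
    using assms by (simp add: square_integrable_def)
  have [measurable]: "f \<in> borel_measurable borel" "g \<in> borel_measurable borel"
    using assms by (simp_all add: square_integrable_def)
  have "(\<lambda>x. cnj (g x)) \<in> borel_measurable borel"
    by (rule measurable_compose[of g _ borel cnj])
       (auto intro!: borel_measurable_continuous_onI continuous_intros)
  then show "(\<lambda>x. f x * cnj (g x)) \<in> borel_measurable lborel"
    by simp
  have "cmod a * cmod b \<le> (cmod a)\<^sup>2 + (cmod b)\<^sup>2" for a b :: complex
    using sum_squares_bound[of "cmod a" "cmod b"] mult_nonneg_nonneg[OF norm_ge_zero norm_ge_zero, of a b]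
    by (simp only: mult.assoc)
  then show "AE x in lborel. norm (f x * cnj (g x)) \<le> norm ((cmod (f x))\<^sup>2 + (cmod (g x))\<^sup>2)"
    by (simp add: norm_mult)
qed

lemma square_integrable_zero: "square_integrable (\<lambda>_. 0)"
  by (simp add: square_integrable_def)

lemma square_integrable_add:
  assumes "square_integrable f" "square_integrable g"
  shows "square_integrable (\<lambda>x. f x + g x)"
  unfolding square_integrable_def
proof
  show "(\<lambda>x. f x + g x) \<in> borel_measurable lborel"
    using assms by (auto simp: square_integrable_def intro!: borel_measurable_add)
  then have m: "(\<lambda>x. (cmod (f x + g x))\<^sup>2) \<in> borel_measurable lborel" by measurable
  have i: "integrable lborel (\<lambda>x. 2 * (cmod (f x))\<^sup>2 + 2 * (cmod (g x))\<^sup>2)"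
    using assms by (simp add: square_integrable_def)
  have "(cmod (a + b))\<^sup>2 \<le> 2 * (cmod a)\<^sup>2 + 2 * (cmod b)\<^sup>2" for a b :: complex
  proof -
    have "(cmod (a + b))\<^sup>2 \<le> (cmod a + cmod b)\<^sup>2"
      by (intro power_mono norm_triangle_ineq norm_ge_zero)
    also have "\<dots> \<le> 2 * (cmod a)\<^sup>2 + 2 * (cmod b)\<^sup>2"
      using sum_squares_bound[of "cmod a" "cmod b"] by (simp add: power2_sum)
    finally show ?thesis .
  qed
  then show "integrable lborel (\<lambda>x. (cmod (f x + g x))\<^sup>2)"
    by (intro Bochner_Integration.integrable_bound[OF i m]) simp
qed

lemma square_integrable_smul:
  assumes "square_integrable f"
  shows "square_integrable (\<lambda>x. a * f x)"
  using assms unfolding square_integrable_def by (auto simp: norm_mult power_mult_distrib)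

quotient_type (overloaded) 'a L2 = "'a::euclidean_space \<Rightarrow> complex" /
  partial: "\<lambda>f g. square_integrable f \<and> square_integrable g \<and> (AE x in lborel. f x = g x)"
proof (rule part_equivpI)
  show "\<exists>f::'a \<Rightarrow> complex. square_integrable f \<and> square_integrable f \<and> (AE x in lborel. f x = f x)"
    by (rule exI[of _ "\<lambda>_. 0"]) (simp add: square_integrable_zero)
qed (auto intro!: sympI transpI)

text \<open>The inner product is linear in the first argument.\<close>

lift_definition cinner :: "'a::euclidean_space L2 \<Rightarrow> 'a L2 \<Rightarrow> complex" is
  "\<lambda>f g. \<integral>x. f x * cnj (g x) \<partial>lborel"
proof -
  fix f f' g g' :: "'a \<Rightarrow> complex"
  assume f: "square_integrable f \<and> square_integrable f' \<and> (AE x in lborel. f x = f' x)"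
    and g: "square_integrable g \<and> square_integrable g' \<and> (AE x in lborel. g x = g' x)"
  show "(\<integral>x. f x * cnj (g x) \<partial>lborel) = (\<integral>x. f' x * cnj (g' x) \<partial>lborel)"
  proof (rule integral_cong_AE)
    show "AE x in lborel. f x * cnj (g x) = f' x * cnj (g' x)"
      using f g by auto
  qed (use f g in \<open>simp_all only: borel_measurable_integrable square_integrable_mult\<close>)
qed

lift_definition cscale :: "complex \<Rightarrow> 'a::euclidean_space L2 \<Rightarrow> 'a L2" is
  "\<lambda>a f x. a * f x"
  by (auto simp: square_integrable_smul)

instantiation L2 :: (euclidean_space) real_inner
begin

lift_definition zero_L2 :: "'a L2" is "\<lambda>_. 0"
  by (simp add: square_integrable_zero)

lift_definition plus_L2 :: "'a L2 \<Rightarrow> 'a L2 \<Rightarrow> 'a L2" is "\<lambda>f g x. f x + g x"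
  by (auto simp: square_integrable_add)

definition uminus_L2 :: "'a L2 \<Rightarrow> 'a L2" where "uminus_L2 f = cscale (- 1) f"

definition minus_L2 :: "'a L2 \<Rightarrow> 'a L2 \<Rightarrow> 'a L2" where "minus_L2 f g = f + (- g)"

definition scaleR_L2 :: "real \<Rightarrow> 'a L2 \<Rightarrow> 'a L2" where
  "scaleR_L2 r f = cscale (complex_of_real r) f"

definition inner_L2 :: "'a L2 \<Rightarrow> 'a L2 \<Rightarrow> real" where "inner_L2 f g = Re (cinner f g)"

definition norm_L2 :: "'a L2 \<Rightarrow> real" where "norm_L2 f = sqrt (f \<bullet> f)"

definition dist_L2 :: "'a L2 \<Rightarrow> 'a L2 \<Rightarrow> real" where "dist_L2 f g = norm (f - g)"

definition sgn_L2 :: "'a L2 \<Rightarrow> 'a L2" where "sgn_L2 f = inverse (norm f) *\<^sub>R f"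

definition uniformity_L2 :: "('a L2 \<times> 'a L2) filter" where
  "uniformity_L2 = (INF e\<in>{0<..}. principal {(x, y). dist x y < e})"

definition open_L2 :: "'a L2 set \<Rightarrow> bool" where
  "open_L2 U = (\<forall>x\<in>U. \<forall>\<^sub>F (x', y) in uniformity. x' = x \<longrightarrow> y \<in> U)"

instance
proof
  fix f g h :: "'a L2" and r s :: real and U :: "'a L2 set"
  show "f + g + h = f + (g + h)"
    by transfer (auto simp: square_integrable_add add.assoc)
  show "f + g = g + f"
    by transfer (auto simp: square_integrable_add add.commute)
  show "0 + f = f"
    by transfer auto
  show "- f + f = 0"
    unfolding uminus_L2_def by transfer (auto simp: square_integrable_zero)
  show "f - g = f + - g" by (rule minus_L2_def)
  show "r *\<^sub>R (f + g) = r *\<^sub>R f + r *\<^sub>R g"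
    unfolding scaleR_L2_def
    by transfer (auto intro!: square_integrable_add square_integrable_smul simp: distrib_left distrib_right)
  show "(r + s) *\<^sub>R f = r *\<^sub>R f + s *\<^sub>R f"
    unfolding scaleR_L2_def
    by transfer (auto intro!: square_integrable_add square_integrable_smul simp: distrib_left distrib_right)
  show "r *\<^sub>R s *\<^sub>R f = (r * s) *\<^sub>R f"
    unfolding scaleR_L2_def
    by transfer (auto intro!: square_integrable_smul simp: mult.assoc)
  show "1 *\<^sub>R f = f"
    unfolding scaleR_L2_def by transfer auto
  show "dist f g = norm (f - g)" by (rule dist_L2_def)
  show "sgn f = inverse (norm f) *\<^sub>R f" by (rule sgn_L2_def)
  show "(uniformity :: ('a L2 \<times> 'a L2) filter) = (INF e\<in>{0<..}. principal {(x, y). dist x y < e})"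
    by (rule uniformity_L2_def)
  show "open U = (\<forall>x\<in>U. \<forall>\<^sub>F (x', y) in uniformity. x' = x \<longrightarrow> y \<in> U)" by (rule open_L2_def)
  have c: "cinner g f = cnj (cinner f g)" for f g :: "'a L2"
    by transfer (subst Bochner_Integration.integral_cnj[symmetric], simp add: mult.commute)
  show "f \<bullet> g = g \<bullet> f"
    unfolding inner_L2_def by (subst c) simp
  show "(f + g) \<bullet> h = f \<bullet> h + g \<bullet> h"
    unfolding inner_L2_def
    by transfer (simp add: square_integrable_mult distrib_right)
  show "r *\<^sub>R f \<bullet> g = r * (f \<bullet> g)"
    unfolding inner_L2_def scaleR_L2_def
    by transfer (simp add: mult.assoc)
  have n: "f \<bullet> f = (\<integral>x. (cmod (rep_L2 f x))\<^sup>2 \<partial>lborel)" for f :: "'a L2"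
  proof -
    have "cinner f f = (\<integral>x. rep_L2 f x * cnj (rep_L2 f x) \<partial>lborel)"
      by (simp add: cinner_def)
    also have "\<dots> = (\<integral>x. complex_of_real ((cmod (rep_L2 f x))\<^sup>2) \<partial>lborel)"
      by (simp only: complex_norm_square)
    also have "\<dots> = complex_of_real (\<integral>x. (cmod (rep_L2 f x))\<^sup>2 \<partial>lborel)"
      by (rule integral_complex_of_real)
    finally show ?thesis by (simp add: inner_L2_def)
  qed
  show "0 \<le> f \<bullet> f" by (simp add: n)
  show "f \<bullet> f = 0 \<longleftrightarrow> f = 0"
  proof
    assume "f \<bullet> f = 0"
    then have i: "(\<integral>x. (cmod (rep_L2 f x))\<^sup>2 \<partial>lborel) = 0" by (simp add: n)
    have r: "square_integrable (rep_L2 f)"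
      using Quotient_rep_reflp[OF Quotient_L2, of f] by simp
    then have "AE x in lborel. (cmod (rep_L2 f x))\<^sup>2 = 0"
      using i integral_nonneg_eq_0_iff_AE[of lborel "\<lambda>x. (cmod (rep_L2 f x))\<^sup>2"]
      by (simp add: square_integrable_def)
    then have "AE x in lborel. rep_L2 f x = 0" by simp
    then have "abs_L2 (rep_L2 f) = abs_L2 (\<lambda>_. 0)"
      using r square_integrable_zero by (intro Quotient_rel_abs[OF Quotient_L2]) auto
    then show "f = 0"
      using Quotient_abs_rep[OF Quotient_L2, of f] by (simp add: zero_L2_def)
  next
    assume "f = 0"
    then show "f \<bullet> f = 0" unfolding inner_L2_def by (simp, transfer) simp
  qed
  show "norm f = sqrt (f \<bullet> f)" by (rule norm_L2_def)
qed

end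


section \<open>Compact operators\<close>

type_synonym 'n op = "(real ^ 'n) L2 \<Rightarrow>\<^sub>L (real ^ 'n) L2"

definition compact_ops :: "'n::finite op set" where
  "compact_ops = {T. (\<forall>a x. blinfun_apply T (cscale a x) = cscale a (blinfun_apply T x)) \<and>
     compact (closure (blinfun_apply T ` cball 0 1))}"

text \<open>The underlying vectors of \<open>'n op\<close> are only real-linear, so complex scalars act by
  post-composition with \<open>cscale\<close>.\<close>

definition op_smul :: "complex \<Rightarrow> 'n::finite op \<Rightarrow> 'n op" where
  "op_smul a T = Blinfun (\<lambda>x. cscale a (T x))"

definition op_adj :: "'n::finite op \<Rightarrow> 'n op" where
  "op_adj T = (THE S. \<forall>x y. cinner (blinfun_apply T x) y = cinner x (blinfun_apply S y))"


section \<open>The algebra of operator fields\<close>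

text \<open>A field \<open>(F(\<lambda>))\<^sub>\<lambda>\<close> is encoded as the pair of its restriction to the nonzero reals
  and its value \<open>F(0)\<close>; the first component is given the dummy value \<open>0\<close> at \<open>\<lambda> = 0\<close>.
  The group \<open>\<real>\<^sup>2\<^sup>n\<close> is rendered as \<open>real ^ ('n + 'n)\<close>, with \<open>n = CARD('n) \<ge> 1\<close>.\<close>

type_synonym 'n gcs = "(nat \<Rightarrow> (real ^ ('n + 'n)) L1) set"
type_synonym 'n op_field = "(real \<Rightarrow> 'n op) \<times> 'n gcs"

abbreviation off_zero :: "'n::finite op_field \<Rightarrow> real \<Rightarrow> 'n op" where "off_zero \<equiv> fst"
abbreviation at_zero :: "'n::finite op_field \<Rightarrow> 'n gcs" where "at_zero \<equiv> snd"

definition field_alg :: "'n::finite op_field star_alg" where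
  "field_alg = \<lparr>
     car = {F. off_zero F 0 = 0 \<and>
       (\<forall>l\<in>-{0}. off_zero F l \<in> compact_ops) \<and>
       at_zero F \<in> car group_cstar \<and>
       continuous_on (-{0}) (off_zero F) \<and>
       ((\<lambda>l. norm (off_zero F l)) \<longlongrightarrow> 0) at_infinity \<and>
       bdd_above ((\<lambda>l. norm (off_zero F l)) ` (-{0}))},
     zer = ((\<lambda>l. 0), zer group_cstar),
     add = (\<lambda>F G. ((\<lambda>l. off_zero F l + off_zero G l), add group_cstar (at_zero F) (at_zero G))),
     smul = (\<lambda>a F. ((\<lambda>l. op_smul a (off_zero F l)), smul group_cstar a (at_zero F))),
     mul = (\<lambda>F G. ((\<lambda>l. off_zero F l o\<^sub>L off_zero G l), mul group_cstar (at_zero F) (at_zero G))),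
     star = (\<lambda>F. ((\<lambda>l. op_adj (off_zero F l)), star group_cstar (at_zero F))),
     nrm = (\<lambda>F. max (SUP l\<in>-{0}. norm (off_zero F l)) (nrm group_cstar (at_zero F))) \<rparr>"

definition C0_compact :: "'n::finite op_field set" where
  "C0_compact = {F. off_zero F 0 = 0 \<and>
     (\<forall>l\<in>-{0}. off_zero F l \<in> compact_ops) \<and>
     at_zero F = zer group_cstar \<and>
     continuous_on (-{0}) (off_zero F) \<and>
     ((\<lambda>l. norm (off_zero F l)) \<longlongrightarrow> 0) (at 0) \<and>
     ((\<lambda>l. norm (off_zero F l)) \<longlongrightarrow> 0) at_infinity}"

definition almost_homomorphism :: "('n::finite gcs \<Rightarrow> 'n op_field) \<Rightarrow> bool" where
  "almost_homomorphism \<tau> \<longleftrightarrow>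
     (\<forall>h\<in>car group_cstar. \<tau> h \<in> car field_alg) \<and>
     (\<exists>K. \<forall>h\<in>car group_cstar. nrm field_alg (\<tau> h) \<le> K * nrm group_cstar h) \<and>
     (\<forall>\<alpha> \<beta>. \<forall>h\<in>car group_cstar. \<forall>f\<in>car group_cstar.
        ((\<lambda>l. norm (off_zero (\<tau> (add group_cstar (smul group_cstar \<alpha> h) (smul group_cstar \<beta> f))) l
           - op_smul \<alpha> (off_zero (\<tau> h) l) - op_smul \<beta> (off_zero (\<tau> f) l))) \<longlongrightarrow> 0) (at 0)) \<and>
     (\<forall>h\<in>car group_cstar. \<forall>h'\<in>car group_cstar.
        ((\<lambda>l. norm (off_zero (\<tau> (mul group_cstar h h')) l
           - (off_zero (\<tau> h) l o\<^sub>L off_zero (\<tau> h') l))) \<longlongrightarrow> 0) (at 0)) \<and>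
     (\<forall>h\<in>car group_cstar.
        ((\<lambda>l. norm (off_zero (\<tau> (star group_cstar h)) l - op_adj (off_zero (\<tau> h) l))) \<longlongrightarrow> 0) (at 0))"

definition D_alg :: "('n::finite gcs \<Rightarrow> 'n op_field) \<Rightarrow> 'n op_field star_alg" where
  "D_alg \<tau> = field_alg\<lparr>car := {F \<in> car field_alg.
     ((\<lambda>l. norm (off_zero F l - off_zero (\<tau> (at_zero F)) l)) \<longlongrightarrow> 0) (at 0)}\<rparr>"

end

theory Submission
  imports Defs
begin

text \<open>
  Evaluation at \<open>\<lambda> = 0\<close> is a *-homomorphism from \<open>D\<^sub>\<tau>\<close> to the group algebra. It is onto, because
  \<open>\<tau>(f)\<close> lies in \<open>D\<^sub>\<tau>\<close> and has value \<open>f\<close> at \<open>0\<close>; and since \<open>\<tau>(0) = 0\<close>, its kernel consists of the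
  fields whose value at \<open>0\<close> vanishes and whose norms tend to \<open>0\<close> there, which is
  \<open>C\<^sub>0(\<real>\<^sup>*, \<K>)\<close>. The extension is therefore an instance of the first isomorphism theorem
  (\<open>closed_star_ideal_kernel\<close>, \<open>quotient_kernel_isomorphic\<close>), once \<open>D\<^sub>\<tau>\<close> is known to be a C*-algebra
  and the quotient norm of \<open>F\<close> is known to be \<open>\<parallel>F(0)\<parallel>\<close>.

  That \<open>D\<^sub>\<tau>\<close> is closed under the operations is exactly the content of the asymptotic identities of an
  almost homomorphism. That it is norm closed uses boundedness: if \<open>F\<^sub>k \<rightarrow> F\<close>, then
  \<open>\<tau>\<^sub>\<lambda>(F\<^sub>k(0)) - \<tau>\<^sub>\<lambda>(F(0))\<close> differs from \<open>\<tau>\<^sub>\<lambda>(F\<^sub>k(0) - F(0))\<close> by something that tends to \<open>0\<close>, and the norm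
  of the latter is at most \<open>K \<parallel>F\<^sub>k - F\<parallel>\<close> for all \<open>\<lambda>\<close> (\<open>D_limit_closed\<close>).

  For the quotient norm, the point is that \<open>N(h) = limsup \<parallel>\<tau>\<^sub>\<lambda>(h)\<parallel>\<close> as \<open>\<lambda> \<rightarrow> 0\<close> is at most \<open>\<parallel>h\<parallel>\<close>,
  although \<open>\<tau>\<close> is only bounded by \<open>K\<close>. The asymptotic identities give \<open>N(h)\<^sup>2 \<le> N(h\<^sup>* h)\<close>, and iterating this
  inequality removes the constant (\<open>bounded_imp_contractive\<close>, \<open>limsup_T_le\<close>). A field in \<open>D\<^sub>\<tau>\<close> is then
  at most \<open>\<parallel>F(0)\<parallel> + \<epsilon>\<close> in norm near \<open>0\<close>, and multiplying it by a cutoff function changes it by an element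
  of the ideal and makes its norm that small everywhere (\<open>D_lift\<close>).

  The surrounding algebras have to be shown to be C*-algebras. The group algebra is the completion of the
  convolution algebra for a supremum of C*-seminorms (\<open>cstar_algebra_enveloping\<close>). For the algebra of
  fields, the compact operators must be closed under adjoints and norm limits; this rests on the
  completeness of \<open>L\<^sup>2\<close> (\<open>Riesz_Fischer\<close>), the representation of bounded functionals
  (\<open>Riesz_representation\<close>) and Schauder's theorem (\<open>compact_blinfun_adjoint\<close>).
\<close>


section \<open>*-algebras and their C*-seminorms\<close>

locale star_algebra =
  fixes A :: "'a star_alg"
  assumes zer_closed [simp, intro]: "zer A \<in> car A"
    and add_closed [simp, intro]: "\<lbrakk>x \<in> car A; y \<in> car A\<rbrakk> \<Longrightarrow> add A x y \<in> car A"
    and smul_closed [simp, intro]: "x \<in> car A \<Longrightarrow> smul A a x \<in> car A"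
    and mul_closed [simp, intro]: "\<lbrakk>x \<in> car A; y \<in> car A\<rbrakk> \<Longrightarrow> mul A x y \<in> car A"
    and star_closed [simp, intro]: "x \<in> car A \<Longrightarrow> star A x \<in> car A"
    and add_assoc: "\<lbrakk>x \<in> car A; y \<in> car A; z \<in> car A\<rbrakk>
          \<Longrightarrow> add A (add A x y) z = add A x (add A y z)"
    and add_commute: "\<lbrakk>x \<in> car A; y \<in> car A\<rbrakk> \<Longrightarrow> add A x y = add A y x"
    and add_zer: "x \<in> car A \<Longrightarrow> add A x (zer A) = x"
    and dif_self: "x \<in> car A \<Longrightarrow> dif A x x = zer A"
    and smul_one: "x \<in> car A \<Longrightarrow> smul A 1 x = x"
    and smul_smul: "x \<in> car A \<Longrightarrow> smul A a (smul A b x) = smul A (a * b) x"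
    and smul_add_left: "x \<in> car A \<Longrightarrow> smul A (a + b) x = add A (smul A a x) (smul A b x)"
    and smul_add_right: "\<lbrakk>x \<in> car A; y \<in> car A\<rbrakk>
          \<Longrightarrow> smul A a (add A x y) = add A (smul A a x) (smul A a y)"
    and mul_assoc: "\<lbrakk>x \<in> car A; y \<in> car A; z \<in> car A\<rbrakk>
          \<Longrightarrow> mul A (mul A x y) z = mul A x (mul A y z)"
    and mul_add_left: "\<lbrakk>x \<in> car A; y \<in> car A; z \<in> car A\<rbrakk>
          \<Longrightarrow> mul A (add A x y) z = add A (mul A x z) (mul A y z)"
    and mul_add_right: "\<lbrakk>x \<in> car A; y \<in> car A; z \<in> car A\<rbrakk>
          \<Longrightarrow> mul A x (add A y z) = add A (mul A x y) (mul A x z)"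
    and mul_smul_left: "\<lbrakk>x \<in> car A; y \<in> car A\<rbrakk> \<Longrightarrow> mul A (smul A a x) y = smul A a (mul A x y)"
    and mul_smul_right: "\<lbrakk>x \<in> car A; y \<in> car A\<rbrakk> \<Longrightarrow> mul A x (smul A a y) = smul A a (mul A x y)"
    and star_star: "x \<in> car A \<Longrightarrow> star A (star A x) = x"
    and star_add: "\<lbrakk>x \<in> car A; y \<in> car A\<rbrakk> \<Longrightarrow> star A (add A x y) = add A (star A x) (star A y)"
    and star_smul: "x \<in> car A \<Longrightarrow> star A (smul A a x) = smul A (cnj a) (star A x)"
    and star_mul: "\<lbrakk>x \<in> car A; y \<in> car A\<rbrakk> \<Longrightarrow> star A (mul A x y) = mul A (star A y) (star A x)"
begin

lemma dif_closed [simp, intro]: "\<lbrakk>x \<in> car A; y \<in> car A\<rbrakk> \<Longrightarrow> dif A x y \<in> car A"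
  by (simp add: dif_def)

lemma add_left_commute:
  "\<lbrakk>x \<in> car A; y \<in> car A; z \<in> car A\<rbrakk> \<Longrightarrow> add A x (add A y z) = add A y (add A x z)"
  by (metis add_assoc add_commute)

lemma zer_add: "x \<in> car A \<Longrightarrow> add A (zer A) x = x"
  using add_commute[of x "zer A"] by (simp add: add_zer)

lemma smul_zero_left: "x \<in> car A \<Longrightarrow> smul A 0 x = zer A"
  using smul_add_left[of x 1 "-1"] by (simp add: smul_one dif_self[unfolded dif_def])

lemma smul_zer: "smul A a (zer A) = zer A"
  using smul_smul[of "zer A" a 0] smul_zero_left[of "zer A"] by simp

lemma dif_zer: "x \<in> car A \<Longrightarrow> dif A x (zer A) = x"
  by (simp add: dif_def smul_zer add_zer)

lemma add_dif_cancel: "\<lbrakk>x \<in> car A; y \<in> car A\<rbrakk> \<Longrightarrow> add A y (dif A x y) = x"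
  by (metis add_left_commute add_zer dif_def dif_self smul_closed)

lemma dif_triangle:
  "\<lbrakk>x \<in> car A; y \<in> car A; z \<in> car A\<rbrakk> \<Longrightarrow> dif A x z = add A (dif A x y) (dif A y z)"
  by (metis add_assoc add_commute add_dif_cancel dif_def smul_closed dif_closed)

lemma dif_swap: "\<lbrakk>x \<in> car A; y \<in> car A\<rbrakk> \<Longrightarrow> dif A y x = smul A (-1) (dif A x y)"
  by (simp add: dif_def smul_add_right smul_smul smul_one add_commute)

lemma dif_add: "\<lbrakk>x \<in> car A; y \<in> car A; x' \<in> car A; y' \<in> car A\<rbrakk>
    \<Longrightarrow> dif A (add A x y) (add A x' y') = add A (dif A x x') (dif A y y')"
  by (simp add: dif_def smul_add_right add_assoc add_left_commute)

lemma dif_smul: "\<lbrakk>x \<in> car A; y \<in> car A\<rbrakk> \<Longrightarrow> dif A (smul A a x) (smul A a y) = smul A a (dif A x y)"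
  by (simp add: dif_def smul_add_right smul_smul mult.commute)

lemma dif_star: "\<lbrakk>x \<in> car A; y \<in> car A\<rbrakk> \<Longrightarrow> dif A (star A x) (star A y) = star A (dif A x y)"
  by (simp add: dif_def star_add star_smul)

lemma mul_dif_left:
  "\<lbrakk>x \<in> car A; y \<in> car A; z \<in> car A\<rbrakk> \<Longrightarrow> mul A (dif A x y) z = dif A (mul A x z) (mul A y z)"
  by (simp add: dif_def mul_add_left mul_smul_left)

lemma mul_dif_right:
  "\<lbrakk>x \<in> car A; y \<in> car A; z \<in> car A\<rbrakk> \<Longrightarrow> mul A x (dif A y z) = dif A (mul A x y) (mul A x z)"
  by (simp add: dif_def mul_add_right mul_smul_right)

lemma dif_mul: "\<lbrakk>x \<in> car A; y \<in> car A; x' \<in> car A; y' \<in> car A\<rbrakk>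
    \<Longrightarrow> dif A (mul A x y) (mul A x' y') = add A (mul A (dif A x x') y) (mul A x' (dif A y y'))"
  by (simp add: mul_dif_left mul_dif_right dif_triangle[symmetric])

lemma mul_zer_right: "x \<in> car A \<Longrightarrow> mul A x (zer A) = zer A"
  using mul_smul_right[of x "zer A" 0] by (simp add: smul_zero_left)

lemma mul_zer_left: "x \<in> car A \<Longrightarrow> mul A (zer A) x = zer A"
  using mul_smul_left[of "zer A" x 0] by (simp add: smul_zero_left)

lemma star_zer: "star A (zer A) = zer A"
  using star_smul[of "zer A" 0] by (simp add: smul_zero_left)

text \<open>Applied with the inverse scalar, the estimate bounds \<open>N x\<close> in terms of \<open>N (a x)\<close>.\<close>

lemma homogeneousI:
  assumes nn: "\<And>x. x \<in> car A \<Longrightarrow> 0 \<le> N x"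
    and le: "\<And>a x. x \<in> car A \<Longrightarrow> N (smul A a x) \<le> cmod a * N x"
    and x: "x \<in> car A"
  shows "N (smul A a x) = cmod a * N x"
proof (cases "a = 0")
  case True
  with le[OF x, of 0] nn[of "smul A 0 x"] x show ?thesis by simp
next
  case False
  with le[of "smul A a x" "inverse a"] x
  have "N x \<le> inverse (cmod a) * N (smul A a x)"
    by (simp add: smul_smul smul_one norm_inverse)
  with False have "cmod a * N x \<le> N (smul A a x)" by (simp add: field_simps)
  with le[OF x, of a] show ?thesis by simp
qed

end

locale cstar_seminormed = star_algebra +
  assumes nrm_nonneg: "x \<in> car A \<Longrightarrow> 0 \<le> nrm A x"
    and nrm_add: "\<lbrakk>x \<in> car A; y \<in> car A\<rbrakk> \<Longrightarrow> nrm A (add A x y) \<le> nrm A x + nrm A y"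
    and nrm_smul: "x \<in> car A \<Longrightarrow> nrm A (smul A a x) = cmod a * nrm A x"
    and nrm_mul: "\<lbrakk>x \<in> car A; y \<in> car A\<rbrakk> \<Longrightarrow> nrm A (mul A x y) \<le> nrm A x * nrm A y"
    and cstar_identity: "x \<in> car A \<Longrightarrow> nrm A (mul A (star A x) x) = (nrm A x)\<^sup>2"
begin

lemma nrm_zer [simp]: "nrm A (zer A) = 0"
  using nrm_smul[of "zer A" 0] by (simp add: smul_zer)

text \<open>The C*-identity and submultiplicativity give \<open>\<parallel>x\<parallel>\<^sup>2 \<le> \<parallel>x\<^sup>*\<parallel> \<parallel>x\<parallel>\<close>; the same estimate for \<open>x\<^sup>*\<close> gives the
  converse.\<close>

lemma nrm_star:
  assumes "x \<in> car A" shows "nrm A (star A x) = nrm A x"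
proof -
  have le: "nrm A x \<le> nrm A (star A x)" if "x \<in> car A" for x
  proof (cases "nrm A x = 0")
    case False
    with nrm_nonneg[OF that] have "0 < nrm A x" by simp
    moreover have "nrm A x * nrm A x \<le> nrm A (star A x) * nrm A x"
      using nrm_mul[of "star A x" x] that by (simp add: cstar_identity power2_eq_square)
    ultimately show ?thesis by simp
  qed (simp add: nrm_nonneg that)
  from le[of x] le[of "star A x"] assms show ?thesis by (simp add: star_star)
qed

lemma nrm_dif_swap: "\<lbrakk>x \<in> car A; y \<in> car A\<rbrakk> \<Longrightarrow> nrm A (dif A y x) = nrm A (dif A x y)"
  by (subst dif_swap) (simp_all add: nrm_smul)

lemma nrm_dif_triangle:
  "\<lbrakk>x \<in> car A; y \<in> car A; z \<in> car A\<rbrakk> \<Longrightarrow> nrm A (dif A x z) \<le> nrm A (dif A x y) + nrm A (dif A y z)"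
  by (subst dif_triangle[of x y z]) (simp_all add: nrm_add)

lemma nrm_diff_le:
  assumes "x \<in> car A" "y \<in> car A" shows "\<bar>nrm A x - nrm A y\<bar> \<le> nrm A (dif A x y)"
proof -
  have "nrm A x \<le> nrm A y + nrm A (dif A x y)" if "x \<in> car A" "y \<in> car A" for x y
    using nrm_add[of y "dif A x y"] that by (simp add: add_dif_cancel)
  from this[OF assms] this[OF assms(2,1)] show ?thesis
    using nrm_dif_swap[OF assms] by linarith
qed

lemma nrm_dif_add: "\<lbrakk>x \<in> car A; y \<in> car A; x' \<in> car A; y' \<in> car A\<rbrakk>
    \<Longrightarrow> nrm A (dif A (add A x y) (add A x' y')) \<le> nrm A (dif A x x') + nrm A (dif A y y')"
  by (simp add: dif_add nrm_add)

lemma nrm_dif_mul: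
  assumes "x \<in> car A" "y \<in> car A" "x' \<in> car A" "y' \<in> car A"
  shows "nrm A (dif A (mul A x y) (mul A x' y'))
    \<le> nrm A (dif A x x') * nrm A y + nrm A x' * nrm A (dif A y y')"
  using assms nrm_add[of "mul A (dif A x x') y" "mul A x' (dif A y y')"]
    nrm_mul[of "dif A x x'" y] nrm_mul[of x' "dif A y y'"]
  by (simp add: dif_mul)

end

lemma (in cstar_seminormed) cstar_algebraI:
  assumes "\<And>x. x \<in> car A \<Longrightarrow> nrm A x = 0 \<Longrightarrow> x = zer A"
    and "\<And>X. X \<in> cauchy_seqs A \<Longrightarrow> \<exists>x \<in> car A. (\<lambda>k. nrm A (dif A (X k) x)) \<longlonglongrightarrow> 0"
  shows "cstar_algebra A"
  by unfold_locales
    (simp_all add: add_assoc add_left_commute add_zer dif_self smul_one smul_smul smul_add_left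
      smul_add_right mul_assoc mul_add_left mul_add_right mul_smul_left mul_smul_right star_star
      star_add star_smul star_mul nrm_nonneg nrm_add nrm_smul nrm_mul cstar_identity add_commute,
     use assms(1) nrm_zer in blast, use assms(2) in blast)

lemma (in cstar_algebra) cstar_seminormed: "cstar_seminormed A"
  by (unfold_locales; rule zer_closed add_closed smul_closed mul_closed star_closed add_assoc
      add_commute add_zer dif_self smul_one smul_smul smul_add_left smul_add_right mul_assoc
      mul_add_left mul_add_right mul_smul_left mul_smul_right star_star star_add star_smul star_mul
      nrm_nonneg nrm_add nrm_smul nrm_mul cstar_identity; assumption)

lemma (in star_algebra) with_norm: "star_algebra (A\<lparr>nrm := p\<rparr>)"
  by unfold_locales
    (simp_all add: dif_def add_assoc add_commute add_left_commute add_zer dif_self[unfolded dif_def]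
      smul_one smul_smul smul_add_left
      smul_add_right mul_assoc mul_add_left mul_add_right mul_smul_left mul_smul_right star_star
      star_add star_smul star_mul)


section \<open>Completion of a seminormed *-algebra\<close>

context cstar_seminormed
begin

text \<open>With the Cauchy condition as a limit along the product filter, closure under the operations
  follows from the sandwich rule.\<close>

lemma cauchy_seqs_iff:
  "X \<in> cauchy_seqs A \<longleftrightarrow> (\<forall>k. X k \<in> car A) \<and>
     ((\<lambda>(j, k). nrm A (dif A (X j) (X k))) \<longlongrightarrow> 0) (sequentially \<times>\<^sub>F sequentially)"
proof (cases "\<forall>k. X k \<in> car A")
  case True
  then have "\<bar>nrm A (dif A (X j) (X k))\<bar> = nrm A (dif A (X j) (X k))" for j k
    by (simp add: nrm_nonneg)
  then have "((\<lambda>(j, k). nrm A (dif A (X j) (X k))) \<longlongrightarrow> 0) (sequentially \<times>\<^sub>F sequentially) \<longleftrightarrow>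
      (\<forall>e>0. \<exists>N. \<forall>j\<ge>N. \<forall>k\<ge>N. nrm A (dif A (X k) (X j)) < e)"
    by (simp add: tendsto_iff case_prod_unfold dist_real_def eventually_prod_sequentially)
  also have "\<dots> \<longleftrightarrow> (\<forall>e>0. \<exists>N. \<forall>j\<ge>N. \<forall>k\<ge>N. nrm A (dif A (X j) (X k)) < e)"
  proof -
    have "(\<forall>j\<ge>N. \<forall>k\<ge>N. nrm A (dif A (X k) (X j)) < e)
        \<longleftrightarrow> (\<forall>j\<ge>N. \<forall>k\<ge>N. nrm A (dif A (X j) (X k)) < e)" for N e by blast
    then show ?thesis by (simp only:)
  qed
  finally show ?thesis using True by (simp add: cauchy_seqs_def)
qed (auto simp: cauchy_seqs_def)

lemma cauchy_seqs_car: "X \<in> cauchy_seqs A \<Longrightarrow> X k \<in> car A"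
  by (simp add: cauchy_seqs_def)

lemma cauchy_seqsD:
  "\<lbrakk>X \<in> cauchy_seqs A; 0 < e\<rbrakk> \<Longrightarrow> \<exists>N. \<forall>j\<ge>N. \<forall>k\<ge>N. nrm A (dif A (X j) (X k)) < e"
  by (simp add: cauchy_seqs_def)

lemma cauchy_seqs_const: "x \<in> car A \<Longrightarrow> (\<lambda>_. x) \<in> cauchy_seqs A"
  by (simp add: cauchy_seqs_def dif_self)

lemma cauchy_seqs_nrm_convergent:
  assumes X: "X \<in> cauchy_seqs A" shows "convergent (\<lambda>k. nrm A (X k))"
proof -
  have "Cauchy (\<lambda>k. nrm A (X k))"
  proof (rule metric_CauchyI)
    fix e :: real assume "0 < e"
    from cauchy_seqsD[OF X this] obtain N where "\<forall>j\<ge>N. \<forall>k\<ge>N. nrm A (dif A (X j) (X k)) < e"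
      by auto
    then show "\<exists>M. \<forall>m\<ge>M. \<forall>n\<ge>M. dist (nrm A (X m)) (nrm A (X n)) < e"
      unfolding dist_real_def
      by (meson le_less_trans nrm_diff_le cauchy_seqs_car[OF X])
  qed
  then show ?thesis by (simp add: Cauchy_convergent)
qed

lemma cauchy_seqs_bounded:
  assumes "X \<in> cauchy_seqs A" shows "\<exists>B. \<forall>k. nrm A (X k) \<le> B"
proof -
  have "Bseq (\<lambda>k. nrm A (X k))"
    using cauchy_seqs_nrm_convergent[OF assms] by (rule convergent_imp_Bseq)
  then show ?thesis unfolding Bseq_def by (metis abs_le_D1 real_norm_def)
qed

lemma cauchy_seqs_add:
  assumes "X \<in> cauchy_seqs A" "Y \<in> cauchy_seqs A"
  shows "(\<lambda>k. add A (X k) (Y k)) \<in> cauchy_seqs A"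
proof -
  have "((\<lambda>p. nrm A (dif A (add A (X (fst p)) (Y (fst p))) (add A (X (snd p)) (Y (snd p))))) \<longlongrightarrow> 0)
      (sequentially \<times>\<^sub>F sequentially)"
  proof (rule tendsto_sandwich[OF _ _ tendsto_const])
    show "((\<lambda>p. nrm A (dif A (X (fst p)) (X (snd p))) + nrm A (dif A (Y (fst p)) (Y (snd p)))) \<longlongrightarrow> 0)
      (sequentially \<times>\<^sub>F sequentially)"
      using assms tendsto_add_zero by (fastforce simp: cauchy_seqs_iff case_prod_unfold)
  qed (use assms in \<open>simp_all add: cauchy_seqs_car nrm_nonneg nrm_dif_add\<close>)
  with assms show ?thesis by (simp add: cauchy_seqs_iff case_prod_unfold)
qed

lemma cauchy_seqs_smul:
  assumes "X \<in> cauchy_seqs A" shows "(\<lambda>k. smul A a (X k)) \<in> cauchy_seqs A"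
proof -
  have "((\<lambda>p. cmod a * nrm A (dif A (X (fst p)) (X (snd p)))) \<longlongrightarrow> 0)
      (sequentially \<times>\<^sub>F sequentially)"
    using assms by (intro tendsto_mult_right_zero) (simp add: cauchy_seqs_iff case_prod_unfold)
  with assms show ?thesis by (simp add: cauchy_seqs_iff case_prod_unfold dif_smul nrm_smul)
qed

lemma cauchy_seqs_star:
  assumes "X \<in> cauchy_seqs A" shows "(\<lambda>k. star A (X k)) \<in> cauchy_seqs A"
  using assms by (simp add: cauchy_seqs_def dif_star nrm_star)

lemma cauchy_seqs_mul:
  assumes X: "X \<in> cauchy_seqs A" and Y: "Y \<in> cauchy_seqs A"
  shows "(\<lambda>k. mul A (X k) (Y k)) \<in> cauchy_seqs A"
proof -
  obtain B where B: "\<And>k. nrm A (X k) \<le> B"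
    using cauchy_seqs_bounded[OF X] by auto
  obtain C where C: "\<And>k. nrm A (Y k) \<le> C"
    using cauchy_seqs_bounded[OF Y] by auto
  let ?dX = "\<lambda>p. nrm A (dif A (X (fst p)) (X (snd p)))"
  let ?dY = "\<lambda>p. nrm A (dif A (Y (fst p)) (Y (snd p)))"
  have "((\<lambda>p. nrm A (dif A (mul A (X (fst p)) (Y (fst p))) (mul A (X (snd p)) (Y (snd p))))) \<longlongrightarrow> 0)
      (sequentially \<times>\<^sub>F sequentially)"
  proof (rule tendsto_sandwich[OF _ _ tendsto_const])
    show "((\<lambda>p. ?dX p * C + B * ?dY p) \<longlongrightarrow> 0) (sequentially \<times>\<^sub>F sequentially)"
      using X Y by (intro tendsto_add_zero tendsto_mult_left_zero tendsto_mult_right_zero)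
        (simp_all add: cauchy_seqs_iff case_prod_unfold)
    have "nrm A (dif A (mul A (X i) (Y i)) (mul A (X j) (Y j)))
      \<le> nrm A (dif A (X i) (X j)) * C + B * nrm A (dif A (Y i) (Y j))" for i j
      using X Y B C
      by (intro order_trans[OF nrm_dif_mul] add_mono mult_left_mono mult_right_mono)
         (simp_all add: cauchy_seqs_car nrm_nonneg)
    then show "\<forall>\<^sub>F p in sequentially \<times>\<^sub>F sequentially. nrm A (dif A (mul A (X (fst p)) (Y (fst p)))
        (mul A (X (snd p)) (Y (snd p)))) \<le> ?dX p * C + B * ?dY p" by simp
  qed (use X Y in \<open>simp_all add: cauchy_seqs_car nrm_nonneg\<close>)
  with X Y show ?thesis by (simp add: cauchy_seqs_iff case_prod_unfold cauchy_seqs_car)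
qed

lemma equiv_null_rel: "equiv (cauchy_seqs A) (null_rel A)"
proof (rule equivI)
  show "null_rel A \<subseteq> cauchy_seqs A \<times> cauchy_seqs A" by (auto simp: null_rel_def)
  show "refl_on (cauchy_seqs A) (null_rel A)"
    by (auto simp: refl_on_def null_rel_def cauchy_seqs_car dif_self)
  show "sym (null_rel A)"
    by (auto simp: sym_def null_rel_def cauchy_seqs_car nrm_dif_swap)
  show "trans (null_rel A)"
  proof (rule transI)
    fix X Y Z assume a: "(X, Y) \<in> null_rel A" "(Y, Z) \<in> null_rel A"
    have "(\<lambda>k. nrm A (dif A (X k) (Z k))) \<longlonglongrightarrow> 0"
    proof (rule tendsto_sandwich[OF _ _ tendsto_const])
      show "(\<lambda>k. nrm A (dif A (X k) (Y k)) + nrm A (dif A (Y k) (Z k))) \<longlonglongrightarrow> 0"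
        using a by (intro tendsto_add_zero) (simp_all add: null_rel_def)
    qed (use a in \<open>simp_all add: null_rel_def cauchy_seqs_car nrm_nonneg nrm_dif_triangle\<close>)
    with a show "(X, Z) \<in> null_rel A" by (simp add: null_rel_def)
  qed
qed

definition cls :: "(nat \<Rightarrow> 'a) \<Rightarrow> (nat \<Rightarrow> 'a) set" where
  "cls X = null_rel A `` {X}"

lemma car_completion: "car (completion A) = cls ` cauchy_seqs A"
  by (auto simp: completion_def quotient_def cls_def)

lemma zer_completion: "zer (completion A) = cls (\<lambda>_. zer A)"
  by (simp add: completion_def cls_def)

lemma cls_eqI:
  assumes "X \<in> cauchy_seqs A" "Y \<in> cauchy_seqs A" "(\<lambda>k. nrm A (dif A (X k) (Y k))) \<longlonglongrightarrow> 0"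
  shows "cls X = cls Y"
  unfolding cls_def by (rule equiv_class_eq[OF equiv_null_rel]) (simp add: null_rel_def assms)

lemma add_completion:
  assumes "X \<in> cauchy_seqs A" "Y \<in> cauchy_seqs A"
  shows "add (completion A) (cls X) (cls Y) = cls (\<lambda>k. add A (X k) (Y k))"
proof -
  have "congruent2 (null_rel A) (null_rel A) (\<lambda>X Y. cls (\<lambda>k. add A (X k) (Y k)))"
  proof (rule congruent2I', rule cls_eqI)
    fix X X' Y Y' assume a: "(X, X') \<in> null_rel A" "(Y, Y') \<in> null_rel A"
    show "(\<lambda>k. nrm A (dif A (add A (X k) (Y k)) (add A (X' k) (Y' k)))) \<longlonglongrightarrow> 0"
    proof (rule tendsto_sandwich[OF _ _ tendsto_const])
      show "(\<lambda>k. nrm A (dif A (X k) (X' k)) + nrm A (dif A (Y k) (Y' k))) \<longlonglongrightarrow> 0"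
        using a by (intro tendsto_add_zero) (simp_all add: null_rel_def)
    qed (use a in \<open>simp_all add: null_rel_def cauchy_seqs_car nrm_nonneg nrm_dif_add\<close>)
  qed (auto simp: null_rel_def cauchy_seqs_add)
  from UN_equiv_class2[OF equiv_null_rel equiv_null_rel this assms]
  show ?thesis by (simp add: completion_def cls_def)
qed

lemma mul_completion:
  assumes "X \<in> cauchy_seqs A" "Y \<in> cauchy_seqs A"
  shows "mul (completion A) (cls X) (cls Y) = cls (\<lambda>k. mul A (X k) (Y k))"
proof -
  have "congruent2 (null_rel A) (null_rel A) (\<lambda>X Y. cls (\<lambda>k. mul A (X k) (Y k)))"
  proof (rule congruent2I', rule cls_eqI)
    fix X X' Y Y' assume a: "(X, X') \<in> null_rel A" "(Y, Y') \<in> null_rel A"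
    then have c: "X k \<in> car A" "X' k \<in> car A" "Y k \<in> car A" "Y' k \<in> car A" for k
      by (simp_all add: null_rel_def cauchy_seqs_car)
    obtain B where B: "\<And>k. nrm A (X' k) \<le> B"
      using cauchy_seqs_bounded[of X'] a by (auto simp: null_rel_def)
    obtain C where C: "\<And>k. nrm A (Y k) \<le> C"
      using cauchy_seqs_bounded[of Y] a by (auto simp: null_rel_def)
    show "(\<lambda>k. nrm A (dif A (mul A (X k) (Y k)) (mul A (X' k) (Y' k)))) \<longlonglongrightarrow> 0"
    proof (rule tendsto_sandwich[OF _ _ tendsto_const])
      show "(\<lambda>k. nrm A (dif A (X k) (X' k)) * C + B * nrm A (dif A (Y k) (Y' k))) \<longlonglongrightarrow> 0"
        using a by (intro tendsto_add_zero tendsto_mult_left_zero tendsto_mult_right_zero)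
          (simp_all add: null_rel_def)
      have "nrm A (dif A (mul A (X k) (Y k)) (mul A (X' k) (Y' k)))
          \<le> nrm A (dif A (X k) (X' k)) * C + B * nrm A (dif A (Y k) (Y' k))" for k
        using B C c
        by (intro order_trans[OF nrm_dif_mul] add_mono mult_left_mono mult_right_mono)
           (simp_all add: nrm_nonneg)
      then show "\<forall>\<^sub>F k in sequentially. nrm A (dif A (mul A (X k) (Y k)) (mul A (X' k) (Y' k)))
          \<le> nrm A (dif A (X k) (X' k)) * C + B * nrm A (dif A (Y k) (Y' k))" by simp
    qed (simp add: c nrm_nonneg)
  qed (auto simp: null_rel_def cauchy_seqs_mul)
  from UN_equiv_class2[OF equiv_null_rel equiv_null_rel this assms]
  show ?thesis by (simp add: completion_def cls_def)
qed

lemma smul_completion: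
  assumes "X \<in> cauchy_seqs A"
  shows "smul (completion A) a (cls X) = cls (\<lambda>k. smul A a (X k))"
proof -
  have "congruent (null_rel A) (\<lambda>X. cls (\<lambda>k. smul A a (X k)))"
    by (rule congruentI, rule cls_eqI)
       (auto simp: null_rel_def cauchy_seqs_smul cauchy_seqs_car dif_smul nrm_smul tendsto_mult_right_zero)
  from UN_equiv_class[OF equiv_null_rel this assms]
  show ?thesis by (simp add: completion_def cls_def)
qed

lemma star_completion:
  assumes "X \<in> cauchy_seqs A"
  shows "star (completion A) (cls X) = cls (\<lambda>k. star A (X k))"
proof -
  have "congruent (null_rel A) (\<lambda>X. cls (\<lambda>k. star A (X k)))"
    by (rule congruentI, rule cls_eqI)
       (auto simp: null_rel_def cauchy_seqs_star cauchy_seqs_car dif_star nrm_star)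
  from UN_equiv_class[OF equiv_null_rel this assms]
  show ?thesis by (simp add: completion_def cls_def)
qed

lemma tendsto_nrm_completion:
  assumes X: "X \<in> cauchy_seqs A"
  shows "(\<lambda>k. nrm A (X k)) \<longlonglongrightarrow> nrm (completion A) (cls X)"
proof -
  obtain l where l: "(\<lambda>k. nrm A (X k)) \<longlonglongrightarrow> l"
    using cauchy_seqs_nrm_convergent[OF X] by (auto simp: convergent_def)
  have "lim (\<lambda>k. nrm A (Y k)) = l" if "Y \<in> cls X" for Y
  proof (rule limI)
    have a: "(X, Y) \<in> null_rel A" using that by (simp add: cls_def)
    have "(\<lambda>k. nrm A (Y k) - nrm A (X k)) \<longlonglongrightarrow> 0"
    proof (rule tendsto_0_le[where K = 1])
      show "(\<lambda>k. nrm A (dif A (X k) (Y k))) \<longlonglongrightarrow> 0" using a by (simp add: null_rel_def)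
      show "\<forall>\<^sub>F k in sequentially. norm (nrm A (Y k) - nrm A (X k)) \<le> norm (nrm A (dif A (X k) (Y k))) * 1"
        using a nrm_diff_le by (fastforce simp: null_rel_def cauchy_seqs_car nrm_nonneg abs_minus_commute)
    qed
    from tendsto_add[OF this l] show "(\<lambda>k. nrm A (Y k)) \<longlonglongrightarrow> l" by simp
  qed
  moreover have "X \<in> cls X"
    using X by (simp add: cls_def null_rel_def cauchy_seqs_car dif_self)
  ultimately have "(\<lambda>Y. lim (\<lambda>k. nrm A (Y k))) ` cls X = {l}" by force
  then have "nrm (completion A) (cls X) = l" by (simp add: completion_def)
  with l show ?thesis by simp
qed

lemma dif_completion:
  assumes "X \<in> cauchy_seqs A" "Y \<in> cauchy_seqs A"
  shows "dif (completion A) (cls X) (cls Y) = cls (\<lambda>k. dif A (X k) (Y k))"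
  using assms by (simp add: dif_def add_completion smul_completion cauchy_seqs_smul)

lemma cauchy_seqs_dif:
  assumes "X \<in> cauchy_seqs A" "Y \<in> cauchy_seqs A"
  shows "(\<lambda>k. dif A (X k) (Y k)) \<in> cauchy_seqs A"
  using assms by (simp add: dif_def cauchy_seqs_add cauchy_seqs_smul)

lemma star_algebra_completion: "star_algebra (completion A)"
  by (unfold_locales;
    clarsimp simp: car_completion zer_completion add_completion mul_completion smul_completion
      star_completion dif_completion cauchy_seqs_add cauchy_seqs_mul cauchy_seqs_smul
      cauchy_seqs_star cauchy_seqs_const cauchy_seqs_car add_assoc add_zer dif_self
      smul_one smul_smul smul_add_left smul_add_right mul_assoc mul_add_left mul_add_right
      mul_smul_left mul_smul_right star_star star_add star_smul star_mul)
   (rule arg_cong[where f = cls], rule ext, rule add_commute; simp add: cauchy_seqs_car)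

text \<open>Along representing sequences the norm of the completion is a limit of the given seminorm, so the
  inequalities and the C*-identity pass to it.\<close>

lemma cstar_seminormed_completion: "cstar_seminormed (completion A)"
proof -
  note lim = tendsto_nrm_completion
  note simps = car_completion add_completion mul_completion smul_completion star_completion
    cauchy_seqs_add cauchy_seqs_mul cauchy_seqs_smul cauchy_seqs_star cauchy_seqs_car
  interpret C: star_algebra "completion A" by (rule star_algebra_completion)
  show ?thesis
  proof (unfold_locales, auto simp only: simps)
    fix X Y a assume X: "X \<in> cauchy_seqs A"
    show "0 \<le> nrm (completion A) (cls X)"
      using lim[OF X] by (rule LIMSEQ_le_const) (simp add: X cauchy_seqs_car nrm_nonneg)
    show "nrm (completion A) (cls (\<lambda>k. smul A a (X k))) = cmod a * nrm (completion A) (cls X)"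
      using tendsto_mult_left[OF lim[OF X], of "cmod a"] lim[OF cauchy_seqs_smul[OF X], of a]
      by (simp add: nrm_smul cauchy_seqs_car X LIMSEQ_unique)
    show "nrm (completion A) (cls (\<lambda>k. mul A (star A (X k)) (X k))) = (nrm (completion A) (cls X))\<^sup>2"
      using tendsto_power[OF lim[OF X], of 2] lim[OF cauchy_seqs_mul[OF cauchy_seqs_star[OF X] X]]
      by (simp add: cstar_identity cauchy_seqs_car X LIMSEQ_unique)
    assume Y: "Y \<in> cauchy_seqs A"
    show "nrm (completion A) (cls (\<lambda>k. add A (X k) (Y k)))
        \<le> nrm (completion A) (cls X) + nrm (completion A) (cls Y)"
      using lim[OF cauchy_seqs_add[OF X Y]] tendsto_add[OF lim[OF X] lim[OF Y]]
      by (rule LIMSEQ_le) (auto simp: nrm_add cauchy_seqs_car X Y)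
    show "nrm (completion A) (cls (\<lambda>k. mul A (X k) (Y k)))
        \<le> nrm (completion A) (cls X) * nrm (completion A) (cls Y)"
      using lim[OF cauchy_seqs_mul[OF X Y]] tendsto_mult[OF lim[OF X] lim[OF Y]]
      by (rule LIMSEQ_le) (auto simp: nrm_mul cauchy_seqs_car X Y)
  qed
qed

lemma nrm_completion_const: "x \<in> car A \<Longrightarrow> nrm (completion A) (cls (\<lambda>_. x)) = nrm A x"
  by (rule LIMSEQ_unique[OF tendsto_nrm_completion[OF cauchy_seqs_const] tendsto_const])

lemma tendsto_const_completion:
  assumes X: "X \<in> cauchy_seqs A"
  shows "(\<lambda>j. nrm (completion A) (dif (completion A) (cls (\<lambda>_. X j)) (cls X))) \<longlonglongrightarrow> 0"
proof (rule LIMSEQ_I)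
  fix e :: real assume "0 < e"
  then obtain N where N: "\<And>j k. j \<ge> N \<Longrightarrow> k \<ge> N \<Longrightarrow> nrm A (dif A (X j) (X k)) < e / 2"
    using cauchy_seqsD[OF X, of "e / 2"] by auto
  interpret C: cstar_seminormed "completion A" by (rule cstar_seminormed_completion)
  have "norm (nrm (completion A) (dif (completion A) (cls (\<lambda>_. X j)) (cls X)) - 0) < e" if "j \<ge> N" for j
  proof -
    have c: "(\<lambda>k. dif A (X j) (X k)) \<in> cauchy_seqs A"
      using X by (intro cauchy_seqs_dif cauchy_seqs_const cauchy_seqs_car)
    have "nrm (completion A) (cls (\<lambda>k. dif A (X j) (X k))) \<le> e / 2"
      using tendsto_nrm_completion[OF c]
      by (rule LIMSEQ_le_const2) (use N[OF that] in \<open>auto intro: less_imp_le\<close>)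
    moreover have "0 \<le> nrm (completion A) (cls (\<lambda>k. dif A (X j) (X k)))"
      using c by (intro C.nrm_nonneg) (simp add: car_completion)
    ultimately show ?thesis using \<open>0 < e\<close> X
      by (simp add: dif_completion cauchy_seqs_const cauchy_seqs_car)
  qed
  then show "\<exists>N. \<forall>j\<ge>N. norm (nrm (completion A) (dif (completion A) (cls (\<lambda>_. X j)) (cls X)) - 0) < e"
    by blast
qed

text \<open>Completeness is a diagonal argument: each term of a Cauchy sequence of classes is replaced by
  a constant class close to it, and the constants so chosen form a Cauchy sequence of the original
  algebra, whose class is the limit.\<close>

lemma cstar_algebra_completion: "cstar_algebra (completion A)"
proof -
  let ?C = "completion A"
  interpret C: cstar_seminormed ?C by (rule cstar_seminormed_completion)
  show ?thesis
  proof (rule C.cstar_algebraI)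
    fix U assume "U \<in> car ?C" "nrm ?C U = 0"
    then obtain X where X: "X \<in> cauchy_seqs A" "U = cls X" and 0: "nrm ?C (cls X) = 0"
      by (auto simp: car_completion)
    have "cls X = cls (\<lambda>_. zer A)"
      using tendsto_nrm_completion[OF X(1)] 0 X(1)
      by (intro cls_eqI) (simp_all add: cauchy_seqs_const cauchy_seqs_car dif_zer)
    then show "U = zer ?C" by (simp add: X(2) zer_completion)
  next
    fix U assume U: "U \<in> cauchy_seqs ?C"
    then have Uc: "U k \<in> car ?C" for k by (rule C.cauchy_seqs_car)
    have "\<exists>y\<in>car A. nrm ?C (dif ?C (cls (\<lambda>_. y)) (U k)) < inverse (Suc k)" for k
    proof -
      obtain X where X: "X \<in> cauchy_seqs A" "U k = cls X" using Uc[of k] by (auto simp: car_completion)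
      have "\<forall>\<^sub>F j in sequentially. nrm ?C (dif ?C (cls (\<lambda>_. X j)) (cls X)) < inverse (Suc k)"
        using tendsto_const_completion[OF X(1)] by (rule order_tendstoD) simp
      then show ?thesis using X cauchy_seqs_car by (auto simp: eventually_sequentially)
    qed
    then obtain Y where Y: "\<And>k. Y k \<in> car A"
      and YU: "\<And>k. nrm ?C (dif ?C (cls (\<lambda>_. Y k)) (U k)) < inverse (Suc k)" by metis
    define i where "i y = cls (\<lambda>_. y)" for y
    have ic: "i (Y k) \<in> car ?C" for k using Y by (simp add: i_def car_completion cauchy_seqs_const)
    have dif_i: "nrm ?C (dif ?C (i (Y j)) (i (Y k))) = nrm A (dif A (Y j) (Y k))" for j k
      using Y by (simp add: i_def dif_completion cauchy_seqs_const nrm_completion_const)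
    have iU: "(\<lambda>k. nrm ?C (dif ?C (i (Y k)) (U k))) \<longlonglongrightarrow> 0"
      by (rule tendsto_sandwich[OF _ _ tendsto_const LIMSEQ_inverse_real_of_nat])
         (use YU ic Uc in \<open>auto simp: i_def C.nrm_nonneg intro!: always_eventually less_imp_le\<close>)
    have "Y \<in> cauchy_seqs A"
      unfolding cauchy_seqs_def
    proof (safe intro!: Y)
      fix e :: real assume "e > 0"
      then have "\<forall>\<^sub>F k in sequentially. nrm ?C (dif ?C (i (Y k)) (U k)) < e / 3"
        using iU by (intro order_tendstoD) auto
      then obtain N where N: "\<And>k. k \<ge> N \<Longrightarrow> nrm ?C (dif ?C (i (Y k)) (U k)) < e / 3"
        by (auto simp: eventually_sequentially)
      obtain M where M: "\<And>j k. j \<ge> M \<Longrightarrow> k \<ge> M \<Longrightarrow> nrm ?C (dif ?C (U j) (U k)) < e / 3"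
        using C.cauchy_seqsD[OF U, of "e / 3"] \<open>e > 0\<close> by auto
      have "nrm A (dif A (Y j) (Y k)) < e" if "j \<ge> max M N" "k \<ge> max M N" for j k
      proof -
        have "nrm ?C (dif ?C (i (Y j)) (i (Y k)))
            \<le> nrm ?C (dif ?C (i (Y j)) (U j)) + (nrm ?C (dif ?C (U j) (U k)) + nrm ?C (dif ?C (i (Y k)) (U k)))"
          using C.nrm_dif_triangle[OF ic[of j] Uc[of j] ic[of k]] C.nrm_dif_triangle[OF Uc[of j] Uc[of k] ic[of k]]
            C.nrm_dif_swap[OF ic[of k] Uc[of k]] by linarith
        with N[of j] N[of k] M[of j k] that show ?thesis by (simp add: dif_i)
      qed
      then show "\<exists>N. \<forall>j\<ge>N. \<forall>k\<ge>N. nrm A (dif A (Y j) (Y k)) < e" by blast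
    qed
    note Yc = this
    have cY: "cls Y \<in> car ?C" using Yc by (simp add: car_completion)
    have "(\<lambda>k. nrm ?C (dif ?C (U k) (cls Y))) \<longlonglongrightarrow> 0"
    proof (rule tendsto_sandwich[OF _ _ tendsto_const])
      show "(\<lambda>k. nrm ?C (dif ?C (i (Y k)) (U k)) + nrm ?C (dif ?C (i (Y k)) (cls Y))) \<longlonglongrightarrow> 0"
        using tendsto_const_completion[OF Yc] iU by (intro tendsto_add_zero) (simp_all add: i_def)
      have "nrm ?C (dif ?C (U k) (cls Y))
          \<le> nrm ?C (dif ?C (i (Y k)) (U k)) + nrm ?C (dif ?C (i (Y k)) (cls Y))" for k
        using C.nrm_dif_triangle[OF Uc[of k] ic[of k] cY] C.nrm_dif_swap[OF ic[of k] Uc[of k]] by linarith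
      then show "\<forall>\<^sub>F k in sequentially. nrm ?C (dif ?C (U k) (cls Y))
          \<le> nrm ?C (dif ?C (i (Y k)) (U k)) + nrm ?C (dif ?C (i (Y k)) (cls Y))" by simp
    qed (simp add: C.nrm_nonneg Uc cY)
    then show "\<exists>V\<in>car ?C. (\<lambda>k. nrm ?C (dif ?C (U k) V)) \<longlonglongrightarrow> 0" using cY by blast
  qed
qed

end


section \<open>Enveloping C*-algebras\<close>

text \<open>The supremum of all C*-seminorms is again a C*-seminorm, since every axiom passes to suprema;
  the enveloping algebra is the completion with respect to it.\<close>

lemma (in star_algebra) cstar_algebra_enveloping:
  assumes nn: "\<And>x. x \<in> car A \<Longrightarrow> 0 \<le> nrm A x"
  shows "cstar_algebra (enveloping_cstar A)"
proof -
  let ?S = "{p. cstar_seminorm A p}"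
  define q where "q x = (SUP p\<in>?S. p x)" for x
  have zero: "(\<lambda>_. 0) \<in> ?S" by (simp add: cstar_seminorm_def nn)
  have upper: "p x \<le> q x" if "cstar_seminorm A p" "x \<in> car A" for p x
    unfolding q_def
  proof (rule cSUP_upper)
    show "bdd_above ((\<lambda>p. p x) ` ?S)"
      using that(2) by (intro bdd_aboveI2[where M = "nrm A x"]) (simp add: cstar_seminorm_def)
  qed (use that in simp)
  have least: "q x \<le> M" if "\<And>p. cstar_seminorm A p \<Longrightarrow> p x \<le> M" for x M
    unfolding q_def by (rule cSUP_least) (use zero that in auto)
  have q0: "0 \<le> q x" if "x \<in> car A" for x
    using upper[of "\<lambda>_. 0" x] zero that by simp
  have smul_le: "q (smul A a x) \<le> cmod a * q x" if "x \<in> car A" for a x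
  proof (rule least)
    fix p assume "cstar_seminorm A p"
    with that show "p (smul A a x) \<le> cmod a * q x"
      using upper[of p x] by (auto simp: cstar_seminorm_def intro: mult_left_mono)
  qed
  let ?Q = "A\<lparr>nrm := q\<rparr>"
  have sel: "car ?Q = car A" "add ?Q = add A" "smul ?Q = smul A" "mul ?Q = mul A" "star ?Q = star A"
    "nrm ?Q = q" by simp_all
  interpret Q: star_algebra ?Q by (rule with_norm)
  interpret Q: cstar_seminormed ?Q
  proof (unfold_locales, unfold sel)
    fix x y a assume x: "x \<in> car A"
    then show "0 \<le> q x" by (rule q0)
    show "q (smul A a x) = cmod a * q x" by (rule homogeneousI[OF q0 smul_le x])
    show "q (mul A (star A x) x) = (q x)\<^sup>2"
    proof (rule antisym)
      show "q (mul A (star A x) x) \<le> (q x)\<^sup>2"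
        by (rule least) (use x upper in \<open>auto simp: cstar_seminorm_def intro!: power_mono\<close>)
      have "q x \<le> sqrt (q (mul A (star A x) x))"
      proof (rule least, rule real_le_rsqrt)
        fix p assume p: "cstar_seminorm A p"
        with x have "(p x)\<^sup>2 = p (mul A (star A x) x)" by (simp add: cstar_seminorm_def)
        also have "\<dots> \<le> q (mul A (star A x) x)" using x by (intro upper p) simp
        finally show "(p x)\<^sup>2 \<le> q (mul A (star A x) x)" .
      qed
      from power_mono[OF this q0[OF x], of 2] show "(q x)\<^sup>2 \<le> q (mul A (star A x) x)"
        using x q0 by simp
    qed
    assume y: "y \<in> car A"
    show "q (add A x y) \<le> q x + q y"
    proof (rule least)
      fix p assume p: "cstar_seminorm A p"
      with x y have "p (add A x y) \<le> p x + p y" by (simp add: cstar_seminorm_def)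
      with upper[OF p x] upper[OF p y] show "p (add A x y) \<le> q x + q y" by simp
    qed
    show "q (mul A x y) \<le> q x * q y"
    proof (rule least)
      fix p assume p: "cstar_seminorm A p"
      with x y have "p (mul A x y) \<le> p x * p y" by (simp add: cstar_seminorm_def)
      also have "\<dots> \<le> q x * q y"
        using p x y by (intro mult_mono upper q0) (auto simp: cstar_seminorm_def)
      finally show "p (mul A x y) \<le> q x * q y" .
    qed
  qed
  have "enveloping_cstar A = completion ?Q"
    by (simp add: enveloping_cstar_def q_def[abs_def])
  with Q.cstar_algebra_completion show ?thesis by simp
qed


section \<open>Subalgebras and quotients\<close>

lemma (in cstar_algebra) cstar_subalgebra:
  assumes S: "S \<subseteq> car A" and zer: "zer A \<in> S"
    and add: "\<And>x y. x \<in> S \<Longrightarrow> y \<in> S \<Longrightarrow> add A x y \<in> S"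
    and smul: "\<And>a x. x \<in> S \<Longrightarrow> smul A a x \<in> S"
    and mul: "\<And>x y. x \<in> S \<Longrightarrow> y \<in> S \<Longrightarrow> mul A x y \<in> S"
    and star: "\<And>x. x \<in> S \<Longrightarrow> star A x \<in> S"
    and lim: "\<And>X x. (\<And>k. X k \<in> S) \<Longrightarrow> x \<in> car A \<Longrightarrow> (\<lambda>k. nrm A (dif A (X k) x)) \<longlonglongrightarrow> 0 \<Longrightarrow> x \<in> S"
  shows "cstar_algebra (A\<lparr>car := S\<rparr>)"
proof -
  have dif [simp]: "dif (A\<lparr>car := S\<rparr>) = dif A" by (simp add: fun_eq_iff dif_def)
  have sel: "car (A\<lparr>car := S\<rparr>) = S" "zer (A\<lparr>car := S\<rparr>) = zer A" "add (A\<lparr>car := S\<rparr>) = add A"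
    "smul (A\<lparr>car := S\<rparr>) = smul A" "mul (A\<lparr>car := S\<rparr>) = mul A" "star (A\<lparr>car := S\<rparr>) = star A"
    "nrm (A\<lparr>car := S\<rparr>) = nrm A" by simp_all
  have c [intro]: "x \<in> S \<Longrightarrow> x \<in> car A" for x using S by auto
  show ?thesis
  proof (unfold_locales, unfold dif sel)
    fix X assume "X \<in> cauchy_seqs (A\<lparr>car := S\<rparr>)"
    then have X: "X \<in> cauchy_seqs A" and XS: "\<And>k. X k \<in> S" by (auto simp: cauchy_seqs_def)
    from complete[OF X] obtain x where "x \<in> car A" "(\<lambda>k. nrm A (dif A (X k) x)) \<longlonglongrightarrow> 0" by blast
    with lim[of X x] XS show "\<exists>x\<in>S. (\<lambda>k. nrm A (dif A (X k) x)) \<longlonglongrightarrow> 0" by blast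
  qed (rule zer add smul mul star add_assoc
      add_commute add_zer dif_self smul_one smul_smul smul_add_left smul_add_right mul_assoc
      mul_add_left mul_add_right mul_smul_left mul_smul_right star_star star_add star_smul star_mul
      nrm_nonneg nrm_eq_0 nrm_add nrm_smul nrm_mul cstar_identity; (assumption | erule c))+
qed

locale star_hom = A: star_algebra A + B: star_algebra B
  for A :: "'a star_alg" and B :: "'b star_alg" +
  fixes \<pi> :: "'a \<Rightarrow> 'b"
  assumes closed [simp]: "x \<in> car A \<Longrightarrow> \<pi> x \<in> car B"
    and add: "\<lbrakk>x \<in> car A; y \<in> car A\<rbrakk> \<Longrightarrow> \<pi> (add A x y) = add B (\<pi> x) (\<pi> y)"
    and smul: "x \<in> car A \<Longrightarrow> \<pi> (smul A a x) = smul B a (\<pi> x)"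
    and mul: "\<lbrakk>x \<in> car A; y \<in> car A\<rbrakk> \<Longrightarrow> \<pi> (mul A x y) = mul B (\<pi> x) (\<pi> y)"
    and star: "x \<in> car A \<Longrightarrow> \<pi> (star A x) = star B (\<pi> x)"
begin

definition kernel :: "'a set" where
  "kernel = {x \<in> car A. \<pi> x = zer B}"

lemma zer: "\<pi> (zer A) = zer B"
  using smul[of "zer A" 0] by (simp add: A.smul_zer B.smul_zero_left)

lemma dif: "\<lbrakk>x \<in> car A; y \<in> car A\<rbrakk> \<Longrightarrow> \<pi> (dif A x y) = dif B (\<pi> x) (\<pi> y)"
  by (simp add: dif_def add smul)

lemma closed_star_ideal_kernel:
  assumes "cstar_algebra B" and contractive: "\<And>x. x \<in> car A \<Longrightarrow> nrm B (\<pi> x) \<le> nrm A x"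
  shows "closed_star_ideal A kernel"
proof -
  interpret BC: cstar_algebra B by fact
  interpret B: cstar_seminormed B by (rule BC.cstar_seminormed)
  have "x \<in> kernel"
    if X: "\<And>k. X k \<in> kernel" and x: "x \<in> car A" and lim: "(\<lambda>k. nrm A (dif A (X k) x)) \<longlonglongrightarrow> 0" for X x
  proof -
    have "nrm B (\<pi> x) \<le> nrm A (dif A (X k) x)" for k
      using contractive[of "dif A (X k) x"] X[of k] x B.nrm_dif_swap[of "\<pi> x" "zer B"]
      by (simp add: kernel_def dif B.dif_zer)
    then have "nrm B (\<pi> x) \<le> 0" by (intro LIMSEQ_le_const[OF lim]) auto
    with B.nrm_nonneg[of "\<pi> x"] x have "nrm B (\<pi> x) = 0" by simp
    with x show ?thesis by (simp add: kernel_def BC.nrm_eq_0)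
  qed
  then show ?thesis
    by (auto simp: closed_star_ideal_def kernel_def zer add smul mul star B.add_zer B.smul_zer
        B.star_zer B.mul_zer_left B.mul_zer_right)
qed

lemma coset_kernel:
  assumes x: "x \<in> car A" shows "coset A kernel x = {y \<in> car A. \<pi> y = \<pi> x}"
proof (intro equalityI subsetI)
  fix y assume "y \<in> {y \<in> car A. \<pi> y = \<pi> x}"
  then have y: "y \<in> car A" "\<pi> y = \<pi> x" by auto
  with x have "dif A y x \<in> kernel" by (simp add: kernel_def dif B.dif_self)
  moreover have "y = add A x (dif A y x)" using x y by (simp add: A.add_dif_cancel)
  ultimately show "y \<in> coset A kernel x" unfolding coset_def by blast
qed (use x in \<open>auto simp: coset_def kernel_def add B.add_zer\<close>)

text \<open>The first isomorphism theorem. The last two hypotheses together say that the norm of \<open>B\<close> is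
  the quotient norm.\<close>

lemma quotient_kernel_isomorphic:
  assumes surj: "\<pi> ` car A = car B"
    and contractive: "\<And>x. x \<in> car A \<Longrightarrow> nrm B (\<pi> x) \<le> nrm A x"
    and lift: "\<And>x e. x \<in> car A \<Longrightarrow> 0 < e \<Longrightarrow> \<exists>y\<in>car A. \<pi> y = \<pi> x \<and> nrm A y \<le> nrm B (\<pi> x) + e"
  shows "cstar_isomorphic (quotient_alg A kernel) B"
proof -
  let ?Q = "quotient_alg A kernel"
  define F where "F x = {y \<in> car A. \<pi> y = \<pi> x}" for x
  define \<phi> where "\<phi> U = the_elem (\<pi> ` U)" for U
  have F: "coset A kernel x = F x" if "x \<in> car A" for x
    using that by (simp add: F_def coset_kernel)
  have mem: "y \<in> F x \<longleftrightarrow> y \<in> car A \<and> \<pi> y = \<pi> x" for x y by (simp add: F_def)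
  have \<phi>: "\<phi> (F x) = \<pi> x" if "x \<in> car A" for x
  proof -
    have "\<pi> ` F x = {\<pi> x}" using that by (auto simp: mem)
    then show ?thesis by (simp add: \<phi>_def)
  qed
  have F_eq: "F x = F y \<longleftrightarrow> \<pi> x = \<pi> y" if "x \<in> car A" "y \<in> car A" for x y
    using that by (metis F_def mem)
  have UN1: "(\<Union>x'\<in>F x. coset A kernel (f x')) = F (f x)"
    if "x \<in> car A" "\<And>x'. x' \<in> F x \<Longrightarrow> f x' \<in> car A \<and> \<pi> (f x') = \<pi> (f x)" for f x
  proof -
    have "coset A kernel (f x') = F (f x)" if "x' \<in> F x" for x'
      using \<open>x' \<in> F x \<Longrightarrow> f x' \<in> car A \<and> \<pi> (f x') = \<pi> (f x)\<close>[OF that] by (simp add: F) (simp add: F_def)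
    moreover have "x \<in> F x" using \<open>x \<in> car A\<close> by (simp add: mem)
    ultimately show ?thesis by auto
  qed
  have Q: "car ?Q = F ` car A"
    "smul ?Q a (F x) = F (smul A a x)"
    "star ?Q (F x) = F (star A x)"
    "nrm ?Q (F x) = nrm B (\<pi> x)" if "x \<in> car A" for a x
  proof -
    show "car ?Q = F ` car A" by (simp add: quotient_alg_def F)
    show "smul ?Q a (F x) = F (smul A a x)" "star ?Q (F x) = F (star A x)"
      using UN1[OF that, of "smul A a"] UN1[OF that, of "star A"] that
      by (simp_all add: quotient_alg_def mem smul star)
    have "(INF y\<in>F x. nrm A y) = nrm B (\<pi> x)"
    proof (rule antisym)
      have bdd: "bdd_below (nrm A ` F x)"
        by (rule bdd_belowI2[where m = "nrm B (\<pi> x)"]) (auto simp: mem dest: contractive)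
      show "(INF y\<in>F x. nrm A y) \<le> nrm B (\<pi> x)"
      proof (rule field_le_epsilon)
        fix e :: real assume "0 < e"
        with lift[OF that] obtain y where "y \<in> F x" "nrm A y \<le> nrm B (\<pi> x) + e"
          by (auto simp: mem)
        with bdd show "(INF y\<in>F x. nrm A y) \<le> nrm B (\<pi> x) + e" by (rule cINF_lower2)
      qed
      have "x \<in> F x" using that by (simp add: mem)
      then show "nrm B (\<pi> x) \<le> (INF y\<in>F x. nrm A y)"
        by (intro cINF_greatest) (auto simp: mem dest: contractive)
    qed
    then show "nrm ?Q (F x) = nrm B (\<pi> x)" by (simp add: quotient_alg_def)
  qed
  have UN2: "(\<Union>x'\<in>F x. \<Union>y'\<in>F y. coset A kernel (f x' y')) = F (f x y)"
    if "x \<in> car A" "y \<in> car A"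
      "\<And>x' y'. x' \<in> F x \<Longrightarrow> y' \<in> F y \<Longrightarrow> f x' y' \<in> car A \<and> \<pi> (f x' y') = \<pi> (f x y)" for f x y
  proof -
    have "coset A kernel (f x' y') = F (f x y)" if "x' \<in> F x" "y' \<in> F y" for x' y'
      using \<open>\<And>x' y'. x' \<in> F x \<Longrightarrow> y' \<in> F y \<Longrightarrow> f x' y' \<in> car A \<and> \<pi> (f x' y') = \<pi> (f x y)\<close>[OF that]
      by (simp add: F) (simp add: F_def)
    moreover have "x \<in> F x" "y \<in> F y" using \<open>x \<in> car A\<close> \<open>y \<in> car A\<close> by (simp_all add: mem)
    ultimately show ?thesis by auto
  qed
  have Q2: "add ?Q (F x) (F y) = F (add A x y)" "mul ?Q (F x) (F y) = F (mul A x y)"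
    if "x \<in> car A" "y \<in> car A" for x y
    using UN2[OF that, of "add A"] UN2[OF that, of "mul A"] that
    by (simp_all add: quotient_alg_def mem add mul)
  have Qc: "car ?Q = F ` car A" using Q(1)[of "zer A"] by simp
  show ?thesis
    unfolding cstar_isomorphic_def
  proof (intro exI[of _ \<phi>] conjI)
    show "bij_betw \<phi> (car ?Q) (car B)"
      unfolding bij_betw_def Qc
    proof
      show "inj_on \<phi> (F ` car A)" by (auto simp: inj_on_def \<phi> F_eq)
      show "\<phi> ` F ` car A = car B" using surj by (simp add: image_image \<phi> cong: image_cong_simp)
    qed
  qed (auto simp: Qc Q Q2 \<phi> add smul mul star)
qed

end


section \<open>Contractivity from an inequality of C*-type\<close>

text \<open>An elementary substitute for spectral radius arguments: iterating \<open>h \<mapsto> h\<^sup>* h\<close> a number \<open>k\<close> of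
  times gives \<open>N(h)\<close> to the power \<open>2\<^sup>k\<close> at most \<open>K\<close> times \<open>\<parallel>h\<parallel>\<close> to the same power, and the constant
  \<open>K\<close> disappears on taking roots.\<close>

lemma (in cstar_seminormed) bounded_imp_contractive:
  assumes N0: "\<And>h. h \<in> car A \<Longrightarrow> 0 \<le> N h"
    and bounded: "\<And>h. h \<in> car A \<Longrightarrow> N h \<le> K * nrm A h"
    and square: "\<And>h. h \<in> car A \<Longrightarrow> (N h)\<^sup>2 \<le> N (mul A (star A h) h)"
    and h: "h \<in> car A"
  shows "N h \<le> nrm A h"
proof (rule ccontr)
  have pow: "(N h) ^ (2 ^ k) \<le> K * (nrm A h) ^ (2 ^ k)" if "h \<in> car A" for h k
    using that
  proof (induction k arbitrary: h)
    case (Suc k)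
    have "(N h) ^ (2 ^ Suc k) = ((N h)\<^sup>2) ^ (2 ^ k)" by (simp add: power_mult)
    also have "\<dots> \<le> N (mul A (star A h) h) ^ (2 ^ k)"
      by (intro power_mono square Suc.prems) simp
    also have "\<dots> \<le> K * nrm A (mul A (star A h) h) ^ (2 ^ k)"
      using Suc.prems by (intro Suc.IH) simp
    also have "\<dots> = K * nrm A h ^ (2 ^ Suc k)"
      using Suc.prems by (simp add: cstar_identity power_mult)
    finally show ?case .
  qed (simp add: bounded)
  assume "\<not> N h \<le> nrm A h"
  then have less: "nrm A h < N h" by simp
  have pos: "0 < nrm A h"
  proof (rule ccontr)
    assume "\<not> 0 < nrm A h"
    with nrm_nonneg[OF h] have "nrm A h = 0" by simp
    with bounded[OF h] less show False by simp
  qed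
  let ?r = "N h / nrm A h"
  have "1 < ?r" using less pos by simp
  then obtain k where "K < ?r ^ k" using real_arch_pow by blast
  also have "\<dots> \<le> ?r ^ (2 ^ k)"
    using \<open>1 < ?r\<close> by (intro power_increasing) (simp_all add: less_imp_le)
  also have "\<dots> \<le> K" using pow[OF h, of k] pos by (simp add: power_divide divide_simps)
  finally show False by simp
qed


section \<open>The convolution algebra of integrable functions\<close>

lemma integral_translate:
  fixes x :: "'a::euclidean_space" and f :: "'a \<Rightarrow> complex"
  assumes "f \<in> borel_measurable borel"
  shows "(\<integral>y. f (y - x) \<partial>lborel) = (\<integral>y. f y \<partial>lborel)"
proof -
  have "(\<integral>y. f y \<partial>distr lborel borel (\<lambda>y. y - x)) = (\<integral>y. f (y - x) \<partial>lborel)"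
    using assms by (intro integral_distr) auto
  then show ?thesis by (simp add: lborel_distr_translate)
qed

lemma AE_integrable_convolution:
  fixes f g :: "'a::euclidean_space \<Rightarrow> complex"
  assumes f: "integrable lborel f" and g: "integrable lborel g"
  shows "AE x in lborel. integrable lborel (\<lambda>y. f y * g (x - y))"
proof -
  have [measurable]: "f \<in> borel_measurable borel" "g \<in> borel_measurable borel"
    using f g by auto
  have "integrable (lborel \<Otimes>\<^sub>M lborel) (\<lambda>(y, x). f y * g (x - y))"
  proof (rule lborel_pair.Fubini_integrable)
    show "(\<lambda>(y, x). f y * g (x - y)) \<in> borel_measurable (lborel \<Otimes>\<^sub>M lborel)"
      by measurable
    show "integrable lborel (\<lambda>y. \<integral>x. norm (case (y, x) of (y, x) \<Rightarrow> f y * g (x - y)) \<partial>lborel)"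
      using f by (simp add: norm_mult integral_norm_translate[OF g])
    show "AE y in lborel. integrable lborel (\<lambda>x. case (y, x) of (y, x) \<Rightarrow> f y * g (x - y))"
      using g by (simp add: integrable_lborel_translate)
  qed
  then show ?thesis by (rule lborel_pair.AE_integrable_snd)
qed

text \<open>Associativity is Fubini's theorem for \<open>f(z) g(y - z) h(x - y)\<close>. For almost every \<open>x\<close> this
  function of \<open>(z, y)\<close> is integrable, because integrating its modulus over \<open>y\<close> leaves the integrand
  of the convolution of \<open>\<bar>f\<bar>\<close> with \<open>\<bar>g\<bar> * \<bar>h\<bar>\<close>.\<close>

lemma AE_convolution_assoc:
  fixes f g h :: "'a::euclidean_space \<Rightarrow> complex"
  assumes f: "integrable lborel f" and g: "integrable lborel g" and h: "integrable lborel h"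
  shows "AE x in lborel. (\<integral>y. (\<integral>z. f z * g (y - z) \<partial>lborel) * h (x - y) \<partial>lborel)
    = (\<integral>z. f z * (\<integral>y. g y * h (x - z - y) \<partial>lborel) \<partial>lborel)"
proof -
  have [measurable]: "f \<in> borel_measurable borel" "g \<in> borel_measurable borel"
      "h \<in> borel_measurable borel"
    using f g h by auto
  define K where "K w = (\<integral>y. norm (g y) * norm (h (w - y)) \<partial>lborel)" for w
  have K: "complex_of_real (K w) = (\<integral>y. complex_of_real (norm (g y)) * complex_of_real (norm (h (w - y))) \<partial>lborel)" for w
    by (simp add: K_def flip: integral_complex_of_real)
  have "integrable lborel (\<lambda>w. complex_of_real (K w))"
    unfolding K by (rule integrable_convolution) (use g h in simp_all)
  then have "AE x in lborel. integrable lborel (\<lambda>z. complex_of_real (norm (f z)) * complex_of_real (K (x - z)))"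
    using f by (intro AE_integrable_convolution[where g = "\<lambda>w. complex_of_real (K w)"]) simp_all
  then have "AE x in lborel. integrable lborel (\<lambda>z. norm (f z) * K (x - z))"
    by (simp only: of_real_mult[symmetric] complex_of_real_integrable_eq)
  then show ?thesis
  proof eventually_elim
    case (elim x)
    have tr: "(\<integral>y. g (y - z) * h (x - y) \<partial>lborel) = (\<integral>y. g y * h (x - z - y) \<partial>lborel)" for z
      using integral_translate[of "\<lambda>y. g y * h (x - z - y)" z] by (simp add: algebra_simps)
    have tr_norm: "(\<integral>y. norm (f z * g (y - z) * h (x - y)) \<partial>lborel) = norm (f z) * K (x - z)" for z
    proof -
      have "complex_of_real (\<integral>y. norm (g (y - z)) * norm (h (x - y)) \<partial>lborel) = complex_of_real (K (x - z))"
        unfolding K using integral_translate[of "\<lambda>y. complex_of_real (norm (g y)) * complex_of_real (norm (h (x - z - y)))" z]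
        by (simp add: algebra_simps flip: integral_complex_of_real)
      then show ?thesis by (simp add: norm_mult mult.assoc)
    qed
    have "integrable (lborel \<Otimes>\<^sub>M lborel) (\<lambda>(z, y). f z * g (y - z) * h (x - y))"
    proof (rule lborel_pair.Fubini_integrable)
      show "(\<lambda>(z, y). f z * g (y - z) * h (x - y)) \<in> borel_measurable (lborel \<Otimes>\<^sub>M lborel)"
        by measurable
      show "integrable lborel (\<lambda>z. \<integral>y. norm (case (z, y) of (z, y) \<Rightarrow> f z * g (y - z) * h (x - y)) \<partial>lborel)"
        using elim by (simp add: tr_norm)
      have "AE z in lborel. integrable lborel (\<lambda>y. g y * h (x - z - y))"
        using AE_lborel_reflect[OF AE_integrable_convolution[OF g h]] .
      then show "AE z in lborel. integrable lborel (\<lambda>y. case (z, y) of (z, y) \<Rightarrow> f z * g (y - z) * h (x - y))"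
      proof eventually_elim
        case (elim z)
        from integrable_lborel_translate[OF this, of z]
        have "integrable lborel (\<lambda>y. g (y - z) * h (x - y))" by (simp add: algebra_simps)
        then have "integrable lborel (\<lambda>y. f z * (g (y - z) * h (x - y)))" by simp
        then show ?case by (simp add: mult.assoc)
      qed
    qed
    from lborel_pair.Fubini_integral[OF this]
    have "(\<integral>y. \<integral>z. f z * g (y - z) * h (x - y) \<partial>lborel \<partial>lborel)
        = (\<integral>z. \<integral>y. f z * (g (y - z) * h (x - y)) \<partial>lborel \<partial>lborel)"
      by (simp add: mult.assoc)
    then show ?case by (simp add: tr)
  qed
qed

lemma L1_conv_assoc: "L1_conv (L1_conv f g) h = L1_conv f (L1_conv g h)"
proof transfer
  fix f g h :: "'a \<Rightarrow> complex"
  assume "integrable lborel f \<and> integrable lborel f \<and> (AE x in lborel. f x = f x)"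
    "integrable lborel g \<and> integrable lborel g \<and> (AE x in lborel. g x = g x)"
    "integrable lborel h \<and> integrable lborel h \<and> (AE x in lborel. h x = h x)"
  then have i: "integrable lborel f" "integrable lborel g" "integrable lborel h" by auto
  show "integrable lborel (\<lambda>x. \<integral>y. (\<integral>z. f z * g (y - z) \<partial>lborel) * h (x - y) \<partial>lborel) \<and>
      integrable lborel (\<lambda>x. \<integral>y. f y * (\<integral>z. g z * h (x - y - z) \<partial>lborel) \<partial>lborel) \<and>
      (AE x in lborel. (\<integral>y. (\<integral>z. f z * g (y - z) \<partial>lborel) * h (x - y) \<partial>lborel)
      = (\<integral>y. f y * (\<integral>z. g z * h (x - y - z) \<partial>lborel) \<partial>lborel))"
    using AE_convolution_assoc[OF i] integrable_convolution[OF integrable_convolution[OF i(1,2)] i(3)]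
      integrable_convolution[OF i(1) integrable_convolution[OF i(2,3)]] by blast
qed

lemma L1_conv_add_left: "L1_conv (L1_add f g) h = L1_add (L1_conv f h) (L1_conv g h)"
proof transfer
  fix f g h :: "'a \<Rightarrow> complex"
  assume "integrable lborel f \<and> integrable lborel f \<and> (AE x in lborel. f x = f x)"
    "integrable lborel g \<and> integrable lborel g \<and> (AE x in lborel. g x = g x)"
    "integrable lborel h \<and> integrable lborel h \<and> (AE x in lborel. h x = h x)"
  then have i: "integrable lborel f" "integrable lborel g" "integrable lborel h" by auto
  have "AE x in lborel. (\<integral>y. (f y + g y) * h (x - y) \<partial>lborel)
      = (\<integral>y. f y * h (x - y) \<partial>lborel) + (\<integral>y. g y * h (x - y) \<partial>lborel)"
    using AE_integrable_convolution[OF i(1,3)] AE_integrable_convolution[OF i(2,3)]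
    by eventually_elim (simp add: distrib_right)
  with i integrable_convolution[of "\<lambda>x. f x + g x" h]
  show "integrable lborel (\<lambda>x. \<integral>y. (f y + g y) * h (x - y) \<partial>lborel) \<and>
      integrable lborel (\<lambda>x. (\<integral>y. f y * h (x - y) \<partial>lborel) + (\<integral>y. g y * h (x - y) \<partial>lborel)) \<and>
      (AE x in lborel. (\<integral>y. (f y + g y) * h (x - y) \<partial>lborel)
      = (\<integral>y. f y * h (x - y) \<partial>lborel) + (\<integral>y. g y * h (x - y) \<partial>lborel))"
    by (simp add: integrable_convolution)
qed

lemma L1_conv_add_right: "L1_conv f (L1_add g h) = L1_add (L1_conv f g) (L1_conv f h)"
proof transfer
  fix f g h :: "'a \<Rightarrow> complex"
  assume "integrable lborel f \<and> integrable lborel f \<and> (AE x in lborel. f x = f x)"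
    "integrable lborel g \<and> integrable lborel g \<and> (AE x in lborel. g x = g x)"
    "integrable lborel h \<and> integrable lborel h \<and> (AE x in lborel. h x = h x)"
  then have i: "integrable lborel f" "integrable lborel g" "integrable lborel h" by auto
  have "AE x in lborel. (\<integral>y. f y * (g (x - y) + h (x - y)) \<partial>lborel)
      = (\<integral>y. f y * g (x - y) \<partial>lborel) + (\<integral>y. f y * h (x - y) \<partial>lborel)"
    using AE_integrable_convolution[OF i(1,2)] AE_integrable_convolution[OF i(1,3)]
    by eventually_elim (simp add: distrib_left)
  with i integrable_convolution[of f "\<lambda>x. g x + h x"]
  show "integrable lborel (\<lambda>x. \<integral>y. f y * (g (x - y) + h (x - y)) \<partial>lborel) \<and>
      integrable lborel (\<lambda>x. (\<integral>y. f y * g (x - y) \<partial>lborel) + (\<integral>y. f y * h (x - y) \<partial>lborel)) \<and>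
      (AE x in lborel. (\<integral>y. f y * (g (x - y) + h (x - y)) \<partial>lborel)
      = (\<integral>y. f y * g (x - y) \<partial>lborel) + (\<integral>y. f y * h (x - y) \<partial>lborel))"
    by (simp add: integrable_convolution)
qed

lemma L1_star_conv: "L1_star (L1_conv f g) = L1_conv (L1_star g) (L1_star f)"
proof transfer
  fix f g :: "'a \<Rightarrow> complex"
  assume "integrable lborel f \<and> integrable lborel f \<and> (AE x in lborel. f x = f x)"
    "integrable lborel g \<and> integrable lborel g \<and> (AE x in lborel. g x = g x)"
  then have i: "integrable lborel f" "integrable lborel g" by auto
  then have [measurable]: "f \<in> borel_measurable borel" "g \<in> borel_measurable borel" by auto
  have [measurable]: "cnj \<in> borel_measurable borel"
    by (intro borel_measurable_continuous_onI continuous_intros)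
  have "cnj (\<integral>y. f y * g (- x - y) \<partial>lborel) = (\<integral>y. cnj (g (- y)) * cnj (f (- (x - y))) \<partial>lborel)" for x
    using integral_translate[of "\<lambda>y. cnj (f y * g (- x - y))" x]
    by (simp add: algebra_simps flip: Bochner_Integration.integral_cnj)
  moreover have "integrable lborel (\<lambda>x. \<integral>y. cnj (g (- y)) * cnj (f (- (x - y))) \<partial>lborel)"
    using integrable_convolution[of "\<lambda>y. cnj (g (- y))" "\<lambda>y. cnj (f (- y))"]
      integrable_lborel_reflect[OF i(1), of 0] integrable_lborel_reflect[OF i(2), of 0] by simp
  ultimately show "integrable lborel (\<lambda>x. cnj (\<integral>y. f y * g (- x - y) \<partial>lborel)) \<and>
      integrable lborel (\<lambda>x. \<integral>y. cnj (g (- y)) * cnj (f (- (x - y))) \<partial>lborel) \<and>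
      (AE x in lborel. cnj (\<integral>y. f y * g (- x - y) \<partial>lborel)
       = (\<integral>y. cnj (g (- y)) * cnj (f (- (x - y))) \<partial>lborel))"
    by simp
qed

lemma L1_add_assoc: "L1_add (L1_add f g) h = L1_add f (L1_add g h)"
  by transfer (simp add: add.assoc)

lemma L1_add_commute: "L1_add f g = L1_add g f"
  by transfer (simp add: add.commute)

lemma L1_add_zero: "L1_add f L1_zero = f"
  by transfer simp

lemma L1_add_neg: "L1_add f (L1_smul (- 1) f) = L1_zero"
  by transfer simp

lemma L1_smul_one: "L1_smul 1 f = f"
  by transfer simp

lemma L1_smul_smul: "L1_smul a (L1_smul b f) = L1_smul (a * b) f"
  by transfer (simp add: mult.assoc)

lemma L1_smul_add_left: "L1_smul (a + b) f = L1_add (L1_smul a f) (L1_smul b f)"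
  by transfer (simp add: distrib_right)

lemma L1_smul_add_right: "L1_smul a (L1_add f g) = L1_add (L1_smul a f) (L1_smul a g)"
  by transfer (simp add: distrib_left)

lemma L1_conv_smul_left: "L1_conv (L1_smul a f) g = L1_smul a (L1_conv f g)"
  by transfer (simp add: mult.assoc integrable_convolution)

lemma L1_conv_smul_right: "L1_conv f (L1_smul a g) = L1_smul a (L1_conv f g)"
  by transfer (simp add: mult.left_commute integrable_convolution)

lemma integrable_cnj_reflect:
  fixes f :: "'a::euclidean_space \<Rightarrow> complex"
  assumes "integrable lborel f" shows "integrable lborel (\<lambda>x. cnj (f (- x)))"
  using integrable_lborel_reflect[OF assms, of 0] by simp

lemma L1_star_star: "L1_star (L1_star f) = f"
  by transfer simp

lemma L1_star_add: "L1_star (L1_add f g) = L1_add (L1_star f) (L1_star g)"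
  by transfer (simp add: Bochner_Integration.integrable_add[OF integrable_cnj_reflect integrable_cnj_reflect])

lemma L1_star_smul: "L1_star (L1_smul a f) = L1_smul (cnj a) (L1_star f)"
  by transfer (simp add: integrable_mult_right[OF integrable_cnj_reflect])

lemma L1_norm_nonneg: "0 \<le> L1_norm f"
  by transfer simp

lemma star_algebra_L1: "star_algebra (L1_alg :: 'a::euclidean_space L1 star_alg)"
  by unfold_locales
    (simp_all add: L1_alg_def dif_def L1_add_assoc L1_add_zero L1_add_neg L1_smul_one L1_smul_smul
      L1_smul_add_left L1_smul_add_right L1_conv_assoc L1_conv_add_left L1_conv_add_right
      L1_conv_smul_left L1_conv_smul_right L1_star_star L1_star_add L1_star_smul L1_star_conv,
     rule L1_add_commute)

lemma cstar_algebra_group_cstar: "cstar_algebra (group_cstar :: (nat \<Rightarrow> 'a::euclidean_space L1) set star_alg)"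
  unfolding group_cstar_def
  by (rule star_algebra.cstar_algebra_enveloping[OF star_algebra_L1])
    (simp add: L1_alg_def L1_norm_nonneg)


section \<open>Completeness of the Hilbert space\<close>

lemma square_integrable_rep_L2: "square_integrable (rep_L2 F)"
  using Quotient_rep_reflp[OF Quotient_L2, of F] by simp

lemma abs_rep_L2: "abs_L2 (rep_L2 F) = F"
  using Quotient_abs_rep[OF Quotient_L2] .

lemma dist_abs_L2:
  assumes f: "square_integrable f" and g: "square_integrable g"
  shows "(dist (abs_L2 f) (abs_L2 g))\<^sup>2 = (\<integral>x. (cmod (f x - g x))\<^sup>2 \<partial>lborel)"
proof -
  let ?d = "\<lambda>x. f x + (- 1) * g x"
  have d: "square_integrable ?d" by (intro square_integrable_add square_integrable_smul f g)
  have "abs_L2 f - abs_L2 g = abs_L2 ?d"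
    using f g square_integrable_smul[OF g, of "-1"]
    by (simp add: minus_L2_def uminus_L2_def cscale.abs_eq plus_L2.abs_eq)
  then have "(dist (abs_L2 f) (abs_L2 g))\<^sup>2 = Re (cinner (abs_L2 ?d) (abs_L2 ?d))"
    by (simp add: dist_norm power2_norm_eq_inner inner_L2_def)
  also have "cinner (abs_L2 ?d) (abs_L2 ?d) = (\<integral>x. ?d x * cnj (?d x) \<partial>lborel)"
    using d by (simp add: cinner.abs_eq)
  also have "\<dots> = (\<integral>x. complex_of_real ((cmod (f x - g x))\<^sup>2) \<partial>lborel)"
    by (simp only: complex_norm_square) simp
  also have "\<dots> = complex_of_real (\<integral>x. (cmod (f x - g x))\<^sup>2 \<partial>lborel)"
    by (rule integral_complex_of_real)
  finally show ?thesis by simp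
qed

lemma nn_integral_dist_rep_L2:
  "(\<integral>\<^sup>+x. ennreal ((cmod (rep_L2 F x - rep_L2 G x))\<^sup>2) \<partial>lborel) = ennreal ((dist F G)\<^sup>2)"
proof -
  have "square_integrable (\<lambda>x. rep_L2 F x + (- 1) * rep_L2 G x)"
    by (intro square_integrable_add square_integrable_smul square_integrable_rep_L2)
  then have "integrable lborel (\<lambda>x. (cmod (rep_L2 F x - rep_L2 G x))\<^sup>2)"
    by (simp add: square_integrable_def)
  then show ?thesis
    using dist_abs_L2[OF square_integrable_rep_L2 square_integrable_rep_L2, of F G]
    by (simp add: nn_integral_eq_integral abs_rep_L2)
qed

text \<open>If \<open>\<parallel>d\<^sub>k\<parallel>\<^sup>2 \<le> 16\<^sup>-\<^sup>k\<close> then \<open>\<Sum>\<^sub>k 4\<^sup>k \<bar>d\<^sub>k\<bar>\<^sup>2\<close> has finite integral, so almost everywhere \<open>\<bar>d\<^sub>k\<bar>\<close>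
  is dominated by a multiple of \<open>2\<^sup>-\<^sup>k\<close>.\<close>

lemma AE_summable_if_fast:
  fixes d :: "nat \<Rightarrow> 'a::euclidean_space \<Rightarrow> complex"
  assumes meas: "\<And>k. d k \<in> borel_measurable borel"
    and fast: "\<And>k. (\<integral>\<^sup>+x. ennreal ((cmod (d k x))\<^sup>2) \<partial>lborel) \<le> ennreal ((1/16) ^ k)"
  shows "AE x in lborel. summable (\<lambda>k. d k x)"
proof -
  note meas [measurable]
  have "(\<integral>\<^sup>+x. (\<Sum>k. ennreal (4 ^ k * (cmod (d k x))\<^sup>2)) \<partial>lborel)
      = (\<Sum>k. ennreal (4 ^ k) * (\<integral>\<^sup>+x. ennreal ((cmod (d k x))\<^sup>2) \<partial>lborel))"
    by (subst nn_integral_suminf) (simp_all add: ennreal_mult nn_integral_cmult)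
  also have "\<dots> \<le> (\<Sum>k. ennreal ((1/4) ^ k))"
  proof (rule suminf_le)
    fix k
    have "ennreal (4 ^ k) * (\<integral>\<^sup>+x. ennreal ((cmod (d k x))\<^sup>2) \<partial>lborel) \<le> ennreal (4 ^ k) * ennreal ((1/16) ^ k)"
      by (intro mult_left_mono fast) simp
    also have "\<dots> = ennreal ((1/4) ^ k)"
      by (simp flip: ennreal_mult power_mult_distrib)
    finally show "ennreal (4 ^ k) * (\<integral>\<^sup>+x. ennreal ((cmod (d k x))\<^sup>2) \<partial>lborel) \<le> ennreal ((1/4) ^ k)" .
  qed simp_all
  also have "\<dots> = ennreal (\<Sum>k. (1/4) ^ k)"
    by (rule suminf_ennreal2) (simp_all add: summable_geometric)
  finally have "(\<integral>\<^sup>+x. (\<Sum>k. ennreal (4 ^ k * (cmod (d k x))\<^sup>2)) \<partial>lborel) \<noteq> \<infinity>"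
    by (metis ennreal_neq_top infinity_ennreal_def neq_top_trans)
  then have "AE x in lborel. (\<Sum>k. ennreal (4 ^ k * (cmod (d k x))\<^sup>2)) \<noteq> \<infinity>"
    by (intro nn_integral_PInf_AE) simp_all
  then show ?thesis
  proof eventually_elim
    case (elim x)
    define C where "C = enn2real (\<Sum>k. ennreal (4 ^ k * (cmod (d k x))\<^sup>2))"
    have C: "0 \<le> C" "(\<Sum>k. ennreal (4 ^ k * (cmod (d k x))\<^sup>2)) = ennreal C"
      using elim by (simp_all add: C_def less_top)
    have "cmod (d k x) \<le> sqrt C * (1/2) ^ k" for k
    proof -
      have "(\<Sum>k\<in>{k}. ennreal (4 ^ k * (cmod (d k x))\<^sup>2)) \<le> ennreal C"
        unfolding C(2)[symmetric] by (rule sum_le_suminf) simp_all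
      then have "4 ^ k * (cmod (d k x))\<^sup>2 \<le> C" using C(1) by simp
      moreover have "(2 ^ k)\<^sup>2 = (4 :: real) ^ k" by (simp add: power2_eq_square flip: power_mult_distrib)
      ultimately have "(2 ^ k * cmod (d k x))\<^sup>2 \<le> C" by (simp add: power_mult_distrib)
      then have "2 ^ k * cmod (d k x) \<le> sqrt C" by (rule real_le_rsqrt)
      then show ?thesis by (simp add: field_simps)
    qed
    then show ?case
      by (intro summable_comparison_test'[OF summable_mult[OF summable_geometric[of "1/2 :: real"]]]) auto
  qed
qed

text \<open>The Riesz--Fischer theorem. A subsequence with fast decreasing gaps converges almost
  everywhere, and by Fatou's lemma its pointwise limit is also the limit in mean square.\<close>

lemma Riesz_Fischer:
  fixes X :: "nat \<Rightarrow> 'a::euclidean_space L2"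
  assumes X: "Cauchy X" shows "convergent X"
proof -
  have "\<exists>N. \<forall>m\<ge>N. \<forall>n\<ge>N. dist (X m) (X n) < (1/4) ^ k" for k
    using X by (intro metric_CauchyD) simp_all
  then obtain N where N: "\<And>k m n. m \<ge> N k \<Longrightarrow> n \<ge> N k \<Longrightarrow> dist (X m) (X n) < (1/4) ^ k" by metis
  \<comment> \<open>the summand \<open>k\<close> makes the subsequence strictly increasing\<close>
  define r where "r k = (\<Sum>i\<le>k. N i) + k" for k
  have rN: "N k \<le> r k" for k
    using member_le_sum[of k "{..k}" N] by (simp add: r_def)
  have "strict_mono r" by (rule strict_mono_Suc_iff[THEN iffD2]) (simp add: r_def)
  then have rSuc: "r k \<le> r (Suc k)" for k by (simp add: strict_mono_less_eq)
  define f where "f k = rep_L2 (X (r k))" for k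
  have sq: "square_integrable (f k)" for k by (simp add: f_def square_integrable_rep_L2)
  have [measurable]: "f k \<in> borel_measurable borel" for k
    using sq[of k] by (simp add: square_integrable_def)
  have "AE x in lborel. summable (\<lambda>k. f (Suc k) x - f k x)"
  proof (rule AE_summable_if_fast)
    fix k
    have "(dist (X (r (Suc k))) (X (r k)))\<^sup>2 \<le> ((1/4) ^ k)\<^sup>2"
      using N[of k "r (Suc k)" "r k"] rN[of k] rSuc[of k] by (intro power_mono) auto
    also have "\<dots> = (1/16) ^ k" by (simp add: power2_eq_square flip: power_mult_distrib)
    finally show "(\<integral>\<^sup>+x. ennreal ((cmod (f (Suc k) x - f k x))\<^sup>2) \<partial>lborel) \<le> ennreal ((1/16) ^ k)"
      by (simp add: f_def nn_integral_dist_rep_L2 ennreal_leI)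
  qed simp
  then have conv: "AE x in lborel. convergent (\<lambda>k. f k x)"
  proof eventually_elim
    case (elim x)
    then have "convergent (\<lambda>n. f n x - f 0 x)"
      using sum_lessThan_telescope[of "\<lambda>k. f k x"] by (simp add: summable_iff_convergent)
    then show ?case by (simp add: convergent_diff_const_right_iff)
  qed
  define g where "g x = lim (\<lambda>k. f k x)" for x
  have [measurable]: "g \<in> borel_measurable borel" unfolding g_def by measurable
  have fatou: "(\<integral>\<^sup>+x. ennreal ((cmod (g x - rep_L2 (X n) x))\<^sup>2) \<partial>lborel) \<le> ennreal (e\<^sup>2)"
    if e: "\<And>k. k \<ge> M \<Longrightarrow> dist (X (r k)) (X n) \<le> e" for M n e
  proof -
    have [measurable]: "rep_L2 (X n) \<in> borel_measurable borel"
      using square_integrable_rep_L2[of "X n"] by (simp add: square_integrable_def)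
    have "AE x in lborel. ennreal ((cmod (g x - rep_L2 (X n) x))\<^sup>2)
        = liminf (\<lambda>k. ennreal ((cmod (f k x - rep_L2 (X n) x))\<^sup>2))"
      using conv
    proof eventually_elim
      case (elim x)
      then have "(\<lambda>k. f k x) \<longlonglongrightarrow> g x" by (simp add: g_def convergent_LIMSEQ_iff)
      then have "(\<lambda>k. ennreal ((cmod (f k x - rep_L2 (X n) x))\<^sup>2))
          \<longlonglongrightarrow> ennreal ((cmod (g x - rep_L2 (X n) x))\<^sup>2)"
        by (intro tendsto_intros)
      then show ?case by (rule lim_imp_Liminf[OF sequentially_bot, symmetric])
    qed
    then have "(\<integral>\<^sup>+x. ennreal ((cmod (g x - rep_L2 (X n) x))\<^sup>2) \<partial>lborel)
        = (\<integral>\<^sup>+x. liminf (\<lambda>k. ennreal ((cmod (f k x - rep_L2 (X n) x))\<^sup>2)) \<partial>lborel)"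
      by (rule nn_integral_cong_AE)
    also have "\<dots> \<le> liminf (\<lambda>k. \<integral>\<^sup>+x. ennreal ((cmod (f k x - rep_L2 (X n) x))\<^sup>2) \<partial>lborel)"
      by (rule nn_integral_liminf) simp
    also have "\<dots> = liminf (\<lambda>k. ennreal ((dist (X (r k)) (X n))\<^sup>2))"
      by (simp add: f_def nn_integral_dist_rep_L2)
    also have "\<dots> \<le> limsup (\<lambda>k. ennreal ((dist (X (r k)) (X n))\<^sup>2))"
      by (rule Liminf_le_Limsup) simp
    also have "\<dots> \<le> ennreal (e\<^sup>2)"
      by (rule Limsup_bounded) (use e in \<open>auto simp: eventually_sequentially intro!: exI[of _ M] ennreal_leI power_mono\<close>)
    finally show ?thesis .
  qed
  \<comment> \<open>the limit lies within distance 1 of the first term of the subsequence\<close>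
  have gsq: "square_integrable g"
  proof -
    let ?h = "\<lambda>x. g x - f 0 x"
    have "dist (X (r k)) (X (r 0)) \<le> 1" if "k \<ge> 0" for k
      using N[of 0 "r k" "r 0"] rN[of 0] strict_mono_less_eq[OF \<open>strict_mono r\<close>, of 0 k] by simp
    from fatou[OF this] have "(\<integral>\<^sup>+x. ennreal ((cmod (?h x))\<^sup>2) \<partial>lborel) \<le> ennreal (1\<^sup>2)"
      by (simp add: f_def)
    then have "(\<integral>\<^sup>+x. ennreal ((cmod (?h x))\<^sup>2) \<partial>lborel) < \<infinity>"
      by (simp add: order_le_less_trans)
    then have "square_integrable ?h"
      by (simp add: square_integrable_def integrable_iff_bounded)
    from square_integrable_add[OF this sq[of 0]] show ?thesis by simp
  qed
  have "X \<longlonglongrightarrow> abs_L2 g"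
  proof (rule metric_LIMSEQ_I)
    fix e :: real assume "0 < e"
    then obtain M where M: "\<And>m n. m \<ge> M \<Longrightarrow> n \<ge> M \<Longrightarrow> dist (X m) (X n) < e / 2"
      using metric_CauchyD[OF X, of "e / 2"] by auto
    have "dist (X n) (abs_L2 g) < e" if n: "n \<ge> M" for n
    proof -
      have rM: "r k \<ge> M" if "k \<ge> M" for k
        using that seq_suble[OF \<open>strict_mono r\<close>, of k] by simp
      have "(\<integral>\<^sup>+x. ennreal ((cmod (g x - rep_L2 (X n) x))\<^sup>2) \<partial>lborel) \<le> ennreal ((e/2)\<^sup>2)"
        by (rule fatou[of M]) (use M[OF rM n] in \<open>auto intro: less_imp_le\<close>)
      moreover have "integrable lborel (\<lambda>x. (cmod (g x - rep_L2 (X n) x))\<^sup>2)"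
        using square_integrable_add[OF gsq square_integrable_smul[OF square_integrable_rep_L2, of "-1" "X n"]]
        by (simp add: square_integrable_def)
      ultimately have "(dist (abs_L2 g) (X n))\<^sup>2 \<le> (e/2)\<^sup>2"
        using dist_abs_L2[OF gsq square_integrable_rep_L2, of "X n"]
        by (simp add: nn_integral_eq_integral abs_rep_L2)
      then have "dist (abs_L2 g) (X n) \<le> e / 2" by (rule power2_le_imp_le) (use \<open>0 < e\<close> in simp)
      with \<open>0 < e\<close> show ?thesis by (simp add: dist_commute)
    qed
    then show "\<exists>M. \<forall>n\<ge>M. dist (X n) (abs_L2 g) < e" by blast
  qed
  then show ?thesis by (rule convergentI)
qed

instance L2 :: (euclidean_space) complete_space
  by standard (rule Riesz_Fischer)

instance L2 :: (euclidean_space) banach ..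


section \<open>Adjoints in real Hilbert spaces\<close>

text \<open>The representing vector minimises \<open>\<parallel>x\<parallel>\<^sup>2 - 2 \<phi>(x)\<close>; a minimising sequence is Cauchy by the
  parallelogram law.\<close>

lemma Riesz_representation:
  fixes \<phi> :: "'a::{real_inner, complete_space} \<Rightarrow> real"
  assumes \<phi>: "bounded_linear \<phi>"
  shows "\<exists>v. \<forall>x. \<phi> x = x \<bullet> v"
proof -
  interpret \<phi>: bounded_linear \<phi> by fact
  obtain K where K: "\<And>x. \<bar>\<phi> x\<bar> \<le> norm x * K" using \<phi>.bounded by auto
  define J where "J x = x \<bullet> x - 2 * \<phi> x" for x
  have "- (K\<^sup>2) \<le> J x" for x
  proof -
    have "0 \<le> (norm x - K)\<^sup>2" by simp
    with K[of x] show ?thesis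
      by (simp add: J_def power2_diff power2_norm_eq_inner abs_le_iff)
  qed
  then have bdd: "bdd_below (range J)" by (intro bdd_belowI2)
  define m where "m = (INF x. J x)"
  have m: "m \<le> J x" for x unfolding m_def by (rule cINF_lower[OF bdd]) simp
  have "\<exists>x. J x < m + inverse (Suc k)" for k
    using cINF_less_iff[of UNIV J "m + inverse (Suc k)"] bdd by (simp add: m_def)
  then obtain X where X: "\<And>k. J (X k) < m + inverse (Suc k)" by metis
  have par: "(norm (x - y))\<^sup>2 \<le> 2 * J x + 2 * J y - 4 * m" for x y
  proof -
    have "m \<le> J ((1/2) *\<^sub>R (x + y))" by (rule m)
    also have "J ((1/2) *\<^sub>R (x + y)) = (x \<bullet> x + 2 * (x \<bullet> y) + y \<bullet> y) / 4 - (\<phi> x + \<phi> y)"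
      by (simp add: J_def \<phi>.scaleR \<phi>.add inner_add_left inner_add_right inner_commute[of y x] field_simps)
    finally have "4 * m \<le> x \<bullet> x + 2 * (x \<bullet> y) + y \<bullet> y - 4 * \<phi> x - 4 * \<phi> y"
      by (simp add: field_simps)
    moreover have "(norm (x - y))\<^sup>2 = x \<bullet> x - 2 * (x \<bullet> y) + y \<bullet> y"
      by (simp add: power2_norm_eq_inner inner_diff_left inner_diff_right inner_commute[of y x])
    ultimately show ?thesis by (simp add: J_def)
  qed
  have "Cauchy X"
  proof (rule metric_CauchyI)
    fix e :: real assume "0 < e"
    then obtain N where N: "inverse (real (Suc N)) < e\<^sup>2 / 4"
      using reals_Archimedean[of "e\<^sup>2 / 4"] by auto
    have "dist (X j) (X k) < e" if "j \<ge> N" "k \<ge> N" for j k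
    proof -
      have "inverse (real (Suc i)) \<le> inverse (real (Suc N))" if "i \<ge> N" for i
        using that by (intro le_imp_inverse_le) simp_all
      from this[OF that(1)] this[OF that(2)] N X[of j] X[of k] par[of "X j" "X k"]
      have "(norm (X j - X k))\<^sup>2 < e\<^sup>2" by linarith
      with \<open>0 < e\<close> show ?thesis by (simp add: dist_norm power2_less_imp_less)
    qed
    then show "\<exists>M. \<forall>j\<ge>M. \<forall>k\<ge>M. dist (X j) (X k) < e" by blast
  qed
  then obtain v where v: "X \<longlonglongrightarrow> v" by (auto simp: Cauchy_convergent_iff convergent_def)
  have "(\<lambda>k. J (X k)) \<longlonglongrightarrow> J v"
    unfolding J_def by (intro tendsto_intros v \<phi>.tendsto)
  moreover have "(\<lambda>k. m + inverse (real (Suc k))) \<longlonglongrightarrow> m"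
    using tendsto_add[OF tendsto_const LIMSEQ_inverse_real_of_nat] by simp
  ultimately have "J v \<le> m" by (rule LIMSEQ_le) (use X in \<open>auto intro: less_imp_le\<close>)
  then have min: "J v \<le> J x" for x using m[of x] by simp
  have "\<phi> x = x \<bullet> v" for x
  proof (cases "x = 0")
    case False
    let ?c = "\<phi> x - x \<bullet> v"
    \<comment> \<open>the step along \<open>x\<close> at which the quadratic function \<open>J\<close> would decrease most\<close>
    let ?t = "?c / (x \<bullet> x)"
    have "J (v + t *\<^sub>R x) = J v - 2 * t * ?c + t * t * (x \<bullet> x)" for t
      by (simp add: J_def \<phi>.scaleR \<phi>.add inner_add_left inner_add_right inner_commute[of v x] algebra_simps)
    then have "J (v + ?t *\<^sub>R x) = J v - 2 * ?t * ?c + ?t * ?t * (x \<bullet> x)" .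
    also have "\<dots> = J v - ?c\<^sup>2 / (x \<bullet> x)"
      using False by (simp add: field_simps power2_eq_square)
    finally have "?c\<^sup>2 / (x \<bullet> x) \<le> 0" using min[of "v + ?t *\<^sub>R x"] by simp
    then have "?c\<^sup>2 / (x \<bullet> x) * (x \<bullet> x) \<le> 0" by (rule mult_nonpos_nonneg) simp
    with False show ?thesis by simp
  qed (simp add: \<phi>.zero)
  then show ?thesis by blast
qed

text \<open>The adjoint sends \<open>y\<close> to the vector representing \<open>x \<mapsto> \<langle>T x, y\<rangle>\<close>.\<close>

lemma ex_adjoint_blinfun:
  fixes T :: "'a::{real_inner, complete_space} \<Rightarrow>\<^sub>L 'b::real_inner"
  shows "\<exists>S :: 'b \<Rightarrow>\<^sub>L 'a. \<forall>x y. T x \<bullet> y = x \<bullet> S y"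
proof -
  have "\<exists>v. \<forall>x. T x \<bullet> y = x \<bullet> v" for y
    by (rule Riesz_representation) (intro bounded_linear_intros)
  then obtain S where S: "\<And>x y. T x \<bullet> y = x \<bullet> S y" by metis
  have "bounded_linear S"
  proof (rule bounded_linear_intro)
    fix y z :: 'b and r :: real
    have "x \<bullet> S (y + z) = x \<bullet> (S y + S z)" for x by (simp add: inner_add_right flip: S)
    then show "S (y + z) = S y + S z" using vector_eq_ldot by blast
    have "x \<bullet> S (r *\<^sub>R y) = x \<bullet> (r *\<^sub>R S y)" for x by (simp flip: S)
    then show "S (r *\<^sub>R y) = r *\<^sub>R S y" using vector_eq_ldot by blast
    have "norm (S y) * norm (S y) = T (S y) \<bullet> y"
      by (simp add: S norm_eq_sqrt_inner)
    also have "\<dots> \<le> norm (T (S y)) * norm y" by (rule norm_cauchy_schwarz)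
    also have "\<dots> \<le> norm T * norm (S y) * norm y" by (intro mult_right_mono norm_blinfun) simp
    finally have "norm (S y) * norm (S y) \<le> norm (S y) * (norm y * norm T)" by (simp add: mult_ac)
    then show "norm (S y) \<le> norm y * norm T"
      by (cases "S y = 0") auto
  qed
  then show ?thesis using S by (intro exI[of _ "Blinfun S"]) (simp add: bounded_linear_Blinfun_apply)
qed


section \<open>Compact operators between real Hilbert spaces\<close>

lemma compact_closure_subset:
  fixes S :: "'a::t2_space set"
  assumes "S \<subseteq> K" "compact K" shows "compact (closure S)"
proof -
  have "closure S \<subseteq> K" using assms by (simp add: closure_minimal compact_imp_closed)
  then show ?thesis
    using compact_Int_closed[OF assms(2) closed_closure[of S]] by (simp add: Int_absorb1)
qed

text \<open>Total boundedness of an image, with the net taken among the images themselves; in this form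
  it passes easily between different maps on the same set.\<close>

lemma compact_closure_image_iff:
  fixes f :: "'a \<Rightarrow> 'b::complete_space"
  shows "compact (closure (f ` B)) \<longleftrightarrow> (\<forall>e>0. \<exists>F\<subseteq>B. finite F \<and> (\<forall>x\<in>B. \<exists>y\<in>F. dist (f y) (f x) < e))"
    (is "?L \<longleftrightarrow> ?R")
proof
  assume ?L
  show ?R
  proof (intro allI impI)
    fix e :: real assume "0 < e"
    then have "closure (f ` B) \<subseteq> (\<Union>y\<in>B. ball (f y) e)"
      by (auto simp: closure_approachable dist_commute)
    with compactE_image[OF \<open>?L\<close>, of B "\<lambda>y. ball (f y) e"]
    obtain F where "F \<subseteq> B" "finite F" "closure (f ` B) \<subseteq> (\<Union>y\<in>F. ball (f y) e)" by auto
    moreover have "f ` B \<subseteq> closure (f ` B)" by (rule closure_subset)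
    ultimately show "\<exists>F\<subseteq>B. finite F \<and> (\<forall>x\<in>B. \<exists>y\<in>F. dist (f y) (f x) < e)"
      by (intro exI[of _ F]) (auto simp: subset_iff)
  qed
next
  assume R: ?R
  show ?L
    unfolding compact_eq_totally_bounded complete_eq_closed
  proof (intro conjI allI impI)
    fix e :: real assume "0 < e"
    then have "0 < e / 2" by simp
    with R obtain F where F: "finite F" "\<forall>x\<in>B. \<exists>y\<in>F. dist (f y) (f x) < e / 2" by blast
    have "z \<in> (\<Union>y\<in>f ` F. ball y e)" if z: "z \<in> closure (f ` B)" for z
    proof -
      have "\<exists>y\<in>f ` B. dist y z < e / 2"
        using z \<open>0 < e / 2\<close> unfolding closure_approachable by blast
      then obtain x where x: "x \<in> B" "dist (f x) z < e / 2" by blast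
      with F(2) obtain y where y: "y \<in> F" "dist (f y) (f x) < e / 2" by blast
      have "dist (f y) z < e" using dist_triangle[of "f y" z "f x"] x y by simp
      with y show ?thesis by auto
    qed
    with F(1) show "\<exists>k. finite k \<and> closure (f ` B) \<subseteq> (\<Union>x\<in>k. ball x e)" by blast
  qed simp
qed

definition compact_blinfun :: "('a::real_normed_vector \<Rightarrow>\<^sub>L 'b::real_normed_vector) \<Rightarrow> bool" where
  "compact_blinfun T \<longleftrightarrow> compact (closure (blinfun_apply T ` cball 0 1))"

lemma compact_blinfun_zero: "compact_blinfun 0"
  unfolding compact_blinfun_def by (rule compact_closure_subset[of _ "{0}"]) auto

lemma compact_blinfun_add:
  assumes "compact_blinfun S" "compact_blinfun T" shows "compact_blinfun (S + T)"
proof -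
  let ?K = "{x + y |x y. x \<in> closure (S ` cball 0 1) \<and> y \<in> closure (T ` cball 0 1)}"
  have "compact ?K" using assms unfolding compact_blinfun_def by (rule compact_sums)
  moreover have "(S + T) ` cball 0 1 \<subseteq> ?K"
  proof safe
    fix x :: 'a assume x: "x \<in> cball 0 1"
    then have "S x \<in> closure (S ` cball 0 1)" "T x \<in> closure (T ` cball 0 1)"
      by (auto intro!: subsetD[OF closure_subset])
    then show "\<exists>y z. (S + T) x = y + z \<and> y \<in> closure (S ` cball 0 1) \<and> z \<in> closure (T ` cball 0 1)"
      unfolding plus_blinfun.rep_eq by blast
  qed
  ultimately show ?thesis unfolding compact_blinfun_def by (rule compact_closure_subset[rotated])
qed

lemma compact_blinfun_compose_left:
  assumes "compact_blinfun T" shows "compact_blinfun (S o\<^sub>L T)"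
proof -
  have "compact (S ` closure (T ` cball 0 1))"
    by (rule compact_continuous_image[OF linear_continuous_on[OF blinfun.bounded_linear_right]])
      (use assms in \<open>simp add: compact_blinfun_def\<close>)
  moreover have "(S o\<^sub>L T) ` cball 0 1 \<subseteq> S ` closure (T ` cball 0 1)"
    using closure_subset[of "T ` cball 0 1"] by auto
  ultimately show ?thesis unfolding compact_blinfun_def by (rule compact_closure_subset[rotated])
qed

lemma compact_blinfun_compose_right:
  assumes "compact_blinfun T" shows "compact_blinfun (T o\<^sub>L S)"
proof -
  \<comment> \<open>adding 1 keeps the scaling factor nonzero\<close>
  let ?c = "norm S + 1"
  have c: "0 < ?c" by (simp add: add_nonneg_pos)
  have "compact ((\<lambda>y. ?c *\<^sub>R y) ` closure (T ` cball 0 1))"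
    using assms by (intro compact_scaling) (simp add: compact_blinfun_def)
  moreover have "(T o\<^sub>L S) ` cball 0 1 \<subseteq> (\<lambda>y. ?c *\<^sub>R y) ` closure (T ` cball 0 1)"
  proof safe
    fix x :: 'c assume "x \<in> cball 0 1"
    then have "norm (S x) \<le> norm S"
      using norm_blinfun[of S x] mult_left_le[of "norm x" "norm S"] by simp
    then have "(1 / ?c) *\<^sub>R S x \<in> cball 0 1" using c by (simp add: divide_simps)
    then have "T ((1 / ?c) *\<^sub>R S x) \<in> closure (T ` cball 0 1)"
      by (intro subsetD[OF closure_subset] imageI)
    moreover have "(T o\<^sub>L S) x = ?c *\<^sub>R T ((1 / ?c) *\<^sub>R S x)"
      using c by (simp add: blinfun.scaleR_right)
    ultimately show "(T o\<^sub>L S) x \<in> (\<lambda>y. ?c *\<^sub>R y) ` closure (T ` cball 0 1)" by blast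
  qed
  ultimately show ?thesis unfolding compact_blinfun_def by (rule compact_closure_subset[rotated])
qed

text \<open>A finite net for a nearby compact operator is also one for \<open>T\<close>, up to the two
  approximation errors.\<close>

lemma compact_blinfun_limit:
  fixes T :: "'a::real_normed_vector \<Rightarrow>\<^sub>L 'b::banach"
  assumes "\<And>e. 0 < e \<Longrightarrow> \<exists>S. compact_blinfun S \<and> norm (T - S) < e"
  shows "compact_blinfun T"
  unfolding compact_blinfun_def compact_closure_image_iff
proof (intro allI impI)
  fix e :: real assume "0 < e"
  then have e3: "0 < e / 3" by simp
  then obtain S where S: "compact_blinfun S" "norm (T - S) < e / 3" using assms by blast
  have "\<exists>F\<subseteq>cball 0 1. finite F \<and> (\<forall>x\<in>cball 0 1. \<exists>y\<in>F. dist (S y) (S x) < e / 3)"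
    using S(1) e3 unfolding compact_blinfun_def compact_closure_image_iff by blast
  then obtain F where F: "F \<subseteq> cball 0 1" "finite F"
    and net: "\<And>x. x \<in> cball 0 1 \<Longrightarrow> \<exists>y\<in>F. dist (S y) (S x) < e / 3" by blast
  have near: "dist (T x) (S x) < e / 3" if "x \<in> cball 0 1" for x
  proof -
    have "norm ((T - S) x) \<le> norm (T - S)"
      using norm_blinfun[of "T - S" x] mult_left_le[of "norm x" "norm (T - S)"] that by simp
    with S(2) show ?thesis by (simp add: dist_norm blinfun.diff_left)
  qed
  have "\<exists>y\<in>F. dist (T y) (T x) < e" if x: "x \<in> cball 0 1" for x
  proof -
    obtain y where y: "y \<in> F" "dist (S y) (S x) < e / 3" using net[OF x] by blast
    have "dist (T y) (T x) \<le> dist (T y) (S y) + dist (S y) (S x) + dist (T x) (S x)"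
      using dist_triangle[of "T y" "T x" "S y"] dist_triangle[of "S y" "T x" "S x"]
      by (simp add: dist_commute)
    moreover have "y \<in> cball 0 1" using F(1) y by blast
    ultimately have "dist (T y) (T x) < e" using near[OF x] near[of y] y(2) by linarith
    with y show ?thesis by blast
  qed
  with F show "\<exists>F\<subseteq>cball 0 1. finite F \<and> (\<forall>x\<in>cball 0 1. \<exists>y\<in>F. dist (T y) (T x) < e)" by blast
qed

text \<open>Schauder's theorem for Hilbert spaces. As \<open>\<parallel>S y\<parallel>\<^sup>2 = \<langle>T S y, y\<rangle>\<close>, a net for the image of the ball
  under the compact operator \<open>T S\<close> is also one for its image under \<open>S\<close>.\<close>

lemma compact_blinfun_adjoint:
  fixes T :: "'a::{real_inner, complete_space} \<Rightarrow>\<^sub>L 'b::{real_inner, complete_space}"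
    and S :: "'b \<Rightarrow>\<^sub>L 'a"
  assumes T: "compact_blinfun T" and adj: "\<And>x y. T x \<bullet> y = x \<bullet> S y"
  shows "compact_blinfun S"
  unfolding compact_blinfun_def compact_closure_image_iff
proof (intro allI impI)
  fix e :: real assume "0 < e"
  then have "0 < e\<^sup>2 / 2" by simp
  then have "\<exists>F\<subseteq>cball 0 1. finite F \<and> (\<forall>x\<in>cball 0 1. \<exists>y\<in>F. dist ((T o\<^sub>L S) y) ((T o\<^sub>L S) x) < e\<^sup>2 / 2)"
    using compact_blinfun_compose_right[OF T, of S]
    unfolding compact_blinfun_def compact_closure_image_iff by blast
  then obtain F where F: "F \<subseteq> cball 0 1" "finite F"
    and net: "\<And>x. x \<in> cball 0 1 \<Longrightarrow> \<exists>y\<in>F. dist ((T o\<^sub>L S) y) ((T o\<^sub>L S) x) < e\<^sup>2 / 2" by blast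
  have "\<exists>y\<in>F. dist (S y) (S x) < e" if x: "x \<in> cball 0 1" for x
  proof -
    obtain y where y: "y \<in> F" and d: "dist ((T o\<^sub>L S) y) ((T o\<^sub>L S) x) < e\<^sup>2 / 2" using net[OF x] by blast
    have n: "norm (T (S (y - x))) < e\<^sup>2 / 2"
      using d by (simp add: dist_norm blinfun.diff_right)
    have "norm (y - x) \<le> 2"
    proof -
      have "y \<in> cball 0 1" using F(1) y by blast
      with x show ?thesis using norm_triangle_ineq4[of y x] by simp
    qed
    have "(norm (S (y - x)))\<^sup>2 = T (S (y - x)) \<bullet> (y - x)"
      by (simp add: adj power2_norm_eq_inner)
    also have "\<dots> \<le> norm (T (S (y - x))) * norm (y - x)" by (rule norm_cauchy_schwarz)
    also have "\<dots> \<le> norm (T (S (y - x))) * 2" using \<open>norm (y - x) \<le> 2\<close> by (intro mult_left_mono) simp_all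
    also have "\<dots> < e\<^sup>2" using n by simp
    finally have "norm (S (y - x)) < e" using \<open>0 < e\<close> by (simp add: power2_less_imp_less)
    with y show ?thesis by (auto simp: dist_norm blinfun.diff_right)
  qed
  with F show "\<exists>F\<subseteq>cball 0 1. finite F \<and> (\<forall>x\<in>cball 0 1. \<exists>y\<in>F. dist (S y) (S x) < e)" by blast
qed


section \<open>The C*-algebra structure of the compact operators\<close>

lemma cinner_add_left: "cinner (f + g) h = cinner f h + cinner g h"
  by transfer (simp add: square_integrable_mult distrib_right)

lemma cinner_cscale_left: "cinner (cscale a f) g = a * cinner f g"
  by transfer (simp add: mult.assoc)

lemma cinner_commute: "cinner g f = cnj (cinner f g)"
  by transfer (subst Bochner_Integration.integral_cnj[symmetric], simp add: mult.commute)

lemma cinner_add_right: "cinner f (g + h) = cinner f g + cinner f h"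
  by (metis cinner_add_left cinner_commute complex_cnj_add)

lemma cinner_zero_left: "cinner 0 g = 0"
  using cinner_add_left[of 0 0 g] by simp

lemma cinner_zero_right: "cinner f 0 = 0"
  using cinner_add_right[of f 0 0] by simp

lemma cinner_cscale_right: "cinner f (cscale a g) = cnj a * cinner f g"
  by (metis cinner_cscale_left cinner_commute complex_cnj_mult)

lemma Re_cinner: "Re (cinner f g) = f \<bullet> g"
  by (simp add: inner_L2_def)

lemma cscale_i_inner: "cscale \<i> f \<bullet> g = - Im (cinner f g)"
  by (simp add: cinner_cscale_left flip: Re_cinner)

lemma cinner_eqI:
  assumes "f \<bullet> g = f' \<bullet> g'" "cscale \<i> f \<bullet> g = cscale \<i> f' \<bullet> g'"
  shows "cinner f g = cinner f' g'"
  using assms by (simp add: complex_eq_iff cscale_i_inner Re_cinner)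

lemma norm_cscale: "norm (cscale a f) = cmod a * norm f"
proof (rule power2_eq_imp_eq)
  have "Im (cinner g g) = 0" for g :: "'a L2"
    using arg_cong[OF cinner_commute[of g g], of Im] by simp
  then have "complex_of_real ((norm (cscale a f))\<^sup>2) = cinner (cscale a f) (cscale a f)"
    by (simp add: complex_eq_iff power2_norm_eq_inner flip: Re_cinner)
  also have "\<dots> = (a * cnj a) * cinner f f" by (simp add: cinner_cscale_left cinner_cscale_right)
  finally have "(norm (cscale a f))\<^sup>2 = Re ((a * cnj a) * cinner f f)" by (metis Re_complex_of_real)
  also have "\<dots> = (cmod a)\<^sup>2 * (f \<bullet> f)"
    by (simp only: complex_norm_square[symmetric] Re_complex_of_real Re_cinner times_complex.sel
        Im_complex_of_real mult_zero_left diff_zero)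
  finally show "(norm (cscale a f))\<^sup>2 = (cmod a * norm f)\<^sup>2"
    by (simp add: power_mult_distrib power2_norm_eq_inner)
qed simp_all

lemma cscale_add_right: "cscale a (f + g) = cscale a f + cscale a g"
  by transfer (auto intro!: square_integrable_add square_integrable_smul simp: distrib_left)

lemma cscale_add_left: "cscale (a + b) f = cscale a f + cscale b f"
  by transfer (auto intro!: square_integrable_add square_integrable_smul simp: distrib_right)

lemma cscale_cscale: "cscale a (cscale b f) = cscale (a * b) f"
  by transfer (auto intro!: square_integrable_smul simp: mult.assoc)

lemma cscale_one: "cscale 1 f = f"
  by transfer auto

lemma cscale_minus_one: "cscale (- 1) f = - f"
  by (simp add: uminus_L2_def)

lemma scaleR_cscale: "r *\<^sub>R f = cscale (complex_of_real r) f"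
  by (rule scaleR_L2_def)

lemma bounded_linear_cscale: "bounded_linear (cscale a)"
  by (rule bounded_linear_intro[where K = "cmod a"])
    (simp_all add: cscale_add_right scaleR_cscale cscale_cscale mult.commute norm_cscale)

lemma op_smul_apply: "blinfun_apply (op_smul a T) x = cscale a (T x)"
  unfolding op_smul_def
  by (subst bounded_linear_Blinfun_apply)
    (simp_all add: bounded_linear_compose[OF bounded_linear_cscale blinfun.bounded_linear_right])

lemma op_smul_minus_one: "op_smul (- 1) T = - T"
  by (rule blinfun_eqI) (simp add: op_smul_apply cscale_minus_one uminus_blinfun.rep_eq)

definition clinear_op :: "'n::finite op \<Rightarrow> bool" where
  "clinear_op T \<longleftrightarrow> (\<forall>a x. T (cscale a x) = cscale a (T x))"

lemma compact_ops_iff: "T \<in> compact_ops \<longleftrightarrow> clinear_op T \<and> compact_blinfun T"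
  by (simp add: compact_ops_def clinear_op_def compact_blinfun_def)

lemma compact_ops_clinear: "T \<in> compact_ops \<Longrightarrow> clinear_op T"
  by (simp add: compact_ops_iff)

lemma op_adj_eqI:
  assumes "\<And>x y. cinner (blinfun_apply T x) y = cinner x (blinfun_apply S y)"
  shows "op_adj T = S"
  unfolding op_adj_def
proof (rule the_equality)
  fix S' assume "\<forall>x y. cinner (blinfun_apply T x) y = cinner x (blinfun_apply S' y)"
  with assms have "x \<bullet> S' y = x \<bullet> S y" for x y by (simp flip: Re_cinner)
  then show "S' = S" using vector_eq_ldot by (intro blinfun_eqI) blast
qed (use assms in blast)

text \<open>For complex-linear operators the adjoint for the real inner product is the adjoint for the
  complex one, since \<open>Im \<langle>f, g\<rangle> = - Re \<langle>i f, g\<rangle>\<close>.\<close>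

lemma cinner_op_adj:
  assumes T: "clinear_op T"
  shows "cinner (blinfun_apply T x) y = cinner x (blinfun_apply (op_adj T) y)"
proof -
  obtain S where S: "\<And>x y. T x \<bullet> y = x \<bullet> blinfun_apply S y"
    using ex_adjoint_blinfun[of T] by blast
  have "cinner (T x) y = cinner x (S y)" for x y
    by (rule cinner_eqI) (use T S[of "cscale \<i> x" y] in \<open>simp_all add: S clinear_op_def\<close>)
  moreover from this have "op_adj T = S" by (rule op_adj_eqI)
  ultimately show ?thesis by simp
qed

lemma inner_op_adj: "clinear_op T \<Longrightarrow> blinfun_apply T x \<bullet> y = x \<bullet> blinfun_apply (op_adj T) y"
  by (simp add: cinner_op_adj flip: Re_cinner)

lemma clinear_op_zero: "clinear_op 0"
  by (simp add: clinear_op_def linear_0[OF bounded_linear.linear[OF bounded_linear_cscale]])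

lemma clinear_op_add: "clinear_op S \<Longrightarrow> clinear_op T \<Longrightarrow> clinear_op (S + T)"
  by (simp add: clinear_op_def plus_blinfun.rep_eq cscale_add_right)

lemma clinear_op_smul: "clinear_op T \<Longrightarrow> clinear_op (op_smul a T)"
  by (simp add: clinear_op_def op_smul_apply cscale_cscale mult.commute)

lemma clinear_op_compose: "clinear_op S \<Longrightarrow> clinear_op T \<Longrightarrow> clinear_op (S o\<^sub>L T)"
  by (simp add: clinear_op_def)

lemma clinear_op_diff: "clinear_op S \<Longrightarrow> clinear_op T \<Longrightarrow> clinear_op (S - T)"
  using clinear_op_add[of S "op_smul (- 1) T"] clinear_op_smul[of T "- 1"]
  by (simp add: op_smul_minus_one)

lemma clinear_op_adj:
  assumes T: "clinear_op T" shows "clinear_op (op_adj T)"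
  unfolding clinear_op_def
proof (intro allI)
  fix a y
  have "cinner x (op_adj T (cscale a y)) = cinner x (cscale a (op_adj T y))" for x
    using T by (simp add: cinner_cscale_right flip: cinner_op_adj)
  then have "x \<bullet> op_adj T (cscale a y) = x \<bullet> cscale a (op_adj T y)" for x by (simp flip: Re_cinner)
  then show "op_adj T (cscale a y) = cscale a (op_adj T y)" using vector_eq_ldot by blast
qed

lemma clinear_op_limit:
  assumes "\<And>e. 0 < e \<Longrightarrow> \<exists>S. clinear_op S \<and> norm (T - S) < e"
  shows "clinear_op T"
  unfolding clinear_op_def
proof (intro allI, rule ccontr)
  fix a x assume ne: "T (cscale a x) \<noteq> cscale a (T x)"
  let ?d = "norm (T (cscale a x) - cscale a (T x))" and ?m = "2 * cmod a * norm x + 1"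
  have m: "0 < ?m" by (simp add: add_nonneg_pos)
  then have "0 < ?d / ?m" using ne by simp
  then obtain S where S: "clinear_op S" "norm (T - S) < ?d / ?m" using assms by blast
  have "T (cscale a x) - cscale a (T x) = (T - S) (cscale a x) - cscale a ((T - S) x)"
    using S(1) by (simp add: clinear_op_def blinfun.diff_left
        linear_diff[OF bounded_linear.linear[OF bounded_linear_cscale]])
  then have "?d \<le> norm ((T - S) (cscale a x)) + norm (cscale a ((T - S) x))"
    by (simp add: norm_triangle_ineq4)
  also have "\<dots> \<le> norm (T - S) * (cmod a * norm x) + cmod a * (norm (T - S) * norm x)"
    using norm_blinfun[of "T - S" "cscale a x"] norm_blinfun[of "T - S" x]
    by (intro add_mono) (simp_all add: norm_cscale mult_left_mono)
  also have "\<dots> \<le> norm (T - S) * ?m" by (simp add: algebra_simps)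
  also have "\<dots> < ?d" using S(2) m by (simp add: field_simps)
  finally show False by simp
qed

lemma compact_ops_zero: "0 \<in> compact_ops"
  by (simp add: compact_ops_iff clinear_op_zero compact_blinfun_zero)

lemma compact_ops_add: "\<lbrakk>S \<in> compact_ops; T \<in> compact_ops\<rbrakk> \<Longrightarrow> S + T \<in> compact_ops"
  by (simp add: compact_ops_iff clinear_op_add compact_blinfun_add)

lemma compact_ops_smul:
  assumes "T \<in> compact_ops" shows "op_smul a T \<in> compact_ops"
proof -
  have "op_smul a T = Blinfun (cscale a) o\<^sub>L T"
    by (rule blinfun_eqI) (simp add: op_smul_apply bounded_linear_Blinfun_apply bounded_linear_cscale)
  then have "compact_blinfun (op_smul a T)"
    using assms by (simp add: compact_ops_iff compact_blinfun_compose_left)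
  with assms show ?thesis by (simp add: compact_ops_iff clinear_op_smul)
qed

lemma compact_ops_compose: "\<lbrakk>S \<in> compact_ops; T \<in> compact_ops\<rbrakk> \<Longrightarrow> S o\<^sub>L T \<in> compact_ops"
  by (simp add: compact_ops_iff clinear_op_compose compact_blinfun_compose_left)

lemma compact_ops_adj: "T \<in> compact_ops \<Longrightarrow> op_adj T \<in> compact_ops"
  by (auto simp: compact_ops_iff clinear_op_adj intro: compact_blinfun_adjoint inner_op_adj)

lemma compact_ops_limit:
  assumes "\<And>e. 0 < e \<Longrightarrow> \<exists>S\<in>compact_ops. norm (T - S) < e"
  shows "T \<in> compact_ops"
  unfolding compact_ops_iff
proof
  show "clinear_op T" by (rule clinear_op_limit) (use assms in \<open>auto simp: compact_ops_iff Bex_def\<close>)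
  show "compact_blinfun T"
    by (rule compact_blinfun_limit) (use assms in \<open>auto simp: compact_ops_iff Bex_def\<close>)
qed

lemma blinfun_compose_assoc: "(R o\<^sub>L S) o\<^sub>L T = R o\<^sub>L (S o\<^sub>L T)"
  by (rule blinfun_eqI) simp

lemma op_smul_one: "op_smul 1 T = T"
  by (rule blinfun_eqI) (simp add: op_smul_apply cscale_one)

lemma op_smul_smul: "op_smul a (op_smul b T) = op_smul (a * b) T"
  by (rule blinfun_eqI) (simp add: op_smul_apply cscale_cscale)

lemma op_smul_add_left: "op_smul (a + b) T = op_smul a T + op_smul b T"
  by (rule blinfun_eqI) (simp add: op_smul_apply cscale_add_left plus_blinfun.rep_eq)

lemma op_smul_add_right: "op_smul a (S + T) = op_smul a S + op_smul a T"
  by (rule blinfun_eqI) (simp add: op_smul_apply cscale_add_right plus_blinfun.rep_eq)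

lemma op_smul_of_real: "op_smul (complex_of_real r) T = r *\<^sub>R T"
  by (rule blinfun_eqI) (simp add: op_smul_apply scaleR_cscale scaleR_blinfun.rep_eq)

lemma op_smul_zero_left: "op_smul 0 T = 0"
  using op_smul_of_real[of 0 T] by simp

lemma op_smul_zero_right: "op_smul a 0 = 0"
  using op_smul_add_right[of a 0 0] by simp

lemma op_smul_compose_left: "op_smul a S o\<^sub>L T = op_smul a (S o\<^sub>L T)"
  by (rule blinfun_eqI) (simp add: op_smul_apply)

lemma op_smul_compose_right: "clinear_op S \<Longrightarrow> S o\<^sub>L op_smul a T = op_smul a (S o\<^sub>L T)"
  by (rule blinfun_eqI) (simp add: op_smul_apply clinear_op_def)

lemma norm_op_smul: "norm (op_smul a T) = cmod a * norm T"
proof -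
  have le: "norm (op_smul a T) \<le> cmod a * norm T" for a T
    by (rule norm_blinfun_bound)
      (simp_all add: op_smul_apply norm_cscale mult.assoc mult_left_mono norm_blinfun)
  show ?thesis
  proof (cases "a = 0")
    case False
    have "norm T = norm (op_smul (inverse a) (op_smul a T))"
      using False by (simp add: op_smul_smul op_smul_one)
    also have "\<dots> \<le> inverse (cmod a) * norm (op_smul a T)"
      using le[of "inverse a" "op_smul a T"] by (simp add: norm_inverse)
    finally have "cmod a * norm T \<le> norm (op_smul a T)" using False by (simp add: field_simps)
    with le[of a T] show ?thesis by simp
  qed (simp add: op_smul_zero_left)
qed

lemma op_adj_zero: "op_adj 0 = 0"
  by (intro op_adj_eqI) (simp add: cinner_zero_left cinner_zero_right)

lemma op_adj_adj: "clinear_op T \<Longrightarrow> op_adj (op_adj T) = T"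
  by (rule op_adj_eqI) (metis cinner_commute cinner_op_adj)

lemma op_adj_add: "clinear_op S \<Longrightarrow> clinear_op T \<Longrightarrow> op_adj (S + T) = op_adj S + op_adj T"
  by (rule op_adj_eqI)
    (simp add: plus_blinfun.rep_eq cinner_add_left cinner_add_right cinner_op_adj)

lemma op_adj_smul: "clinear_op T \<Longrightarrow> op_adj (op_smul a T) = op_smul (cnj a) (op_adj T)"
  by (rule op_adj_eqI)
    (simp add: op_smul_apply cinner_cscale_left cinner_cscale_right cinner_op_adj)

lemma op_adj_compose: "clinear_op S \<Longrightarrow> clinear_op T \<Longrightarrow> op_adj (S o\<^sub>L T) = op_adj T o\<^sub>L op_adj S"
  by (rule op_adj_eqI) (simp add: cinner_op_adj)

lemma op_adj_diff: "clinear_op S \<Longrightarrow> clinear_op T \<Longrightarrow> op_adj (S - T) = op_adj S - op_adj T"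
  using op_adj_add[of S "op_smul (- 1) T"] op_adj_smul[of T "- 1"] clinear_op_smul[of T "- 1"]
  by (simp add: op_smul_minus_one)

text \<open>\<open>\<parallel>T x\<parallel>\<^sup>2 = \<langle>x, T\<^sup>* T x\<rangle>\<close> gives one inequality; it also yields \<open>\<parallel>T\<parallel> \<le> \<parallel>T\<^sup>*\<parallel>\<close>, hence equality of
  these norms by symmetry, and with it the other inequality.\<close>

lemma norm_adj_compose:
  assumes T: "clinear_op T" shows "norm (op_adj T o\<^sub>L T) = (norm T)\<^sup>2"
proof -
  have sq: "(norm T)\<^sup>2 \<le> norm (op_adj T o\<^sub>L T)" if T: "clinear_op T" for T :: "'n::finite op"
  proof -
    have "norm T \<le> sqrt (norm (op_adj T o\<^sub>L T))"
    proof (rule norm_blinfun_bound)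
      fix x
      have "(norm (T x))\<^sup>2 = x \<bullet> (op_adj T o\<^sub>L T) x"
        by (simp add: power2_norm_eq_inner inner_op_adj[OF T])
      also have "\<dots> \<le> norm x * norm ((op_adj T o\<^sub>L T) x)" by (rule norm_cauchy_schwarz)
      also have "\<dots> \<le> norm x * (norm (op_adj T o\<^sub>L T) * norm x)"
        by (rule mult_left_mono[OF norm_blinfun norm_ge_zero])
      also have "\<dots> = (sqrt (norm (op_adj T o\<^sub>L T)) * norm x)\<^sup>2"
        by (simp only: power_mult_distrib real_sqrt_pow2 norm_ge_zero)
          (simp only: power2_eq_square mult.left_commute)
      finally show "norm (T x) \<le> sqrt (norm (op_adj T o\<^sub>L T)) * norm x"
        by (rule power2_le_imp_le) simp
    qed simp
    then have "(norm T)\<^sup>2 \<le> (sqrt (norm (op_adj T o\<^sub>L T)))\<^sup>2" by (intro power_mono) simp_all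
    then show ?thesis by simp
  qed
  have le: "norm T \<le> norm (op_adj T)" if T: "clinear_op T" for T :: "'n::finite op"
  proof (cases "norm T = 0")
    case False
    have "norm T * norm T \<le> norm (op_adj T) * norm T"
      using sq[OF T] norm_blinfun_compose[of "op_adj T" T] by (simp add: power2_eq_square)
    then show ?thesis by (rule mult_right_le_imp_le) (use False in simp)
  qed simp
  have "norm (op_adj T o\<^sub>L T) \<le> norm T * norm T"
    using norm_blinfun_compose[of "op_adj T" T] le[OF clinear_op_adj[OF T]]
    mult_right_mono[of "norm (op_adj T)" "norm T" "norm T"]
    by (simp add: op_adj_adj[OF T])
  with sq[OF T] show ?thesis by (simp add: power2_eq_square)
qed

lemma norm_op_adj:
  assumes T: "clinear_op T" shows "norm (op_adj T) = norm T"
proof -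
  have le: "norm T \<le> norm (op_adj T)" if T: "clinear_op T" for T :: "'n::finite op"
  proof (cases "norm T = 0")
    case False
    have "norm T * norm T \<le> norm (op_adj T) * norm T"
      using norm_adj_compose[OF T] norm_blinfun_compose[of "op_adj T" T] by (simp add: power2_eq_square)
    then show ?thesis by (rule mult_right_le_imp_le) (use False in simp)
  qed simp
  from le[OF T] le[OF clinear_op_adj[OF T]] show ?thesis by (simp add: op_adj_adj[OF T])
qed


section \<open>The C*-algebra of operator fields\<close>

interpretation GC: cstar_algebra "group_cstar :: (nat \<Rightarrow> 'a::euclidean_space L1) set star_alg"
  by (rule cstar_algebra_group_cstar)

interpretation G: cstar_seminormed "group_cstar :: (nat \<Rightarrow> 'a::euclidean_space L1) set star_alg"
  by (rule GC.cstar_seminormed)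

text \<open>The dummy value at \<open>\<lambda> = 0\<close> is a compact operator of norm 0, so the conditions may be imposed at all
  \<open>\<lambda>\<close>.\<close>

lemma car_field_alg_iff:
  "F \<in> car field_alg \<longleftrightarrow> off_zero F 0 = 0 \<and> (\<forall>l. off_zero F l \<in> compact_ops) \<and>
     at_zero F \<in> car group_cstar \<and> continuous_on (- {0}) (off_zero F) \<and>
     (off_zero F \<longlongrightarrow> 0) at_infinity \<and> (\<exists>M. \<forall>l. norm (off_zero F l) \<le> M)"
    (is "?L \<longleftrightarrow> ?R")
proof
  assume F: ?L
  then obtain M where M: "\<And>l. l \<noteq> 0 \<Longrightarrow> norm (off_zero F l) \<le> M"
    by (auto simp: field_alg_def bdd_above_def)
  have "off_zero F l \<in> compact_ops \<and> norm (off_zero F l) \<le> max M 0" for l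
    using F M[of l] by (cases "l = 0") (auto simp: field_alg_def compact_ops_zero)
  with F show ?R by (auto simp: field_alg_def tendsto_norm_zero_iff)
next
  assume ?R then show ?L by (auto simp: field_alg_def tendsto_norm_zero_iff bdd_above_def)
qed

lemma field_alg_simps [simp]:
  "off_zero (zer field_alg) = (\<lambda>l. 0)" "at_zero (zer field_alg) = zer group_cstar"
  "off_zero (add field_alg F H) = (\<lambda>l. off_zero F l + off_zero H l)"
  "at_zero (add field_alg F H) = add group_cstar (at_zero F) (at_zero H)"
  "off_zero (smul field_alg a F) = (\<lambda>l. op_smul a (off_zero F l))"
  "at_zero (smul field_alg a F) = smul group_cstar a (at_zero F)"
  "off_zero (mul field_alg F H) = (\<lambda>l. off_zero F l o\<^sub>L off_zero H l)"
  "at_zero (mul field_alg F H) = mul group_cstar (at_zero F) (at_zero H)"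
  "off_zero (star field_alg F) = (\<lambda>l. op_adj (off_zero F l))"
  "at_zero (star field_alg F) = star group_cstar (at_zero F)"
  "off_zero (dif field_alg F H) = (\<lambda>l. off_zero F l - off_zero H l)"
  "at_zero (dif field_alg F H) = dif group_cstar (at_zero F) (at_zero H)"
  by (simp_all add: field_alg_def dif_def op_smul_minus_one)

lemma op_field_eqI: "(\<And>l. off_zero F l = off_zero H l) \<Longrightarrow> at_zero F = at_zero H \<Longrightarrow> F = H"
  by (simp add: prod_eq_iff fun_eq_iff)

lemma field_clinear [simp]: "F \<in> car field_alg \<Longrightarrow> clinear_op (off_zero F l)"
  by (simp add: car_field_alg_iff compact_ops_clinear)

lemma field_at_zero [simp]: "F \<in> car field_alg \<Longrightarrow> at_zero F \<in> car group_cstar"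
  by (simp add: car_field_alg_iff)

lemma bounded_linear_op_smul: "bounded_linear (op_smul a)"
proof (rule bounded_linear_intro[where K = "cmod a"])
  fix r :: real and T :: "'n::finite op"
  show "op_smul a (r *\<^sub>R T) = r *\<^sub>R op_smul a T"
    by (simp add: op_smul_smul mult.commute flip: op_smul_of_real)
qed (simp_all add: op_smul_add_right norm_op_smul)

lemma star_algebra_field_alg: "star_algebra (field_alg :: 'n::finite op_field star_alg)"
proof (unfold_locales, goal_cases)
  case 1
  show ?case by (auto simp: car_field_alg_iff compact_ops_zero)
next
  case (2 F H)
  then obtain M N where M: "\<And>l. norm (off_zero F l) \<le> M" and N: "\<And>l. norm (off_zero H l) \<le> N"
    by (metis car_field_alg_iff)
  have "norm (off_zero F l + off_zero H l) \<le> M + N" for l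
    using norm_triangle_ineq[of "off_zero F l" "off_zero H l"] M[of l] N[of l] by simp
  then have "\<exists>M. \<forall>l. norm (off_zero F l + off_zero H l) \<le> M" by blast
  with 2 show ?case unfolding car_field_alg_iff field_alg_simps
    by (simp add: compact_ops_add continuous_on_add tendsto_add_zero)
next
  case (3 F a)
  then obtain M where M: "\<And>l. norm (off_zero F l) \<le> M" by (metis car_field_alg_iff)
  have "\<exists>M. \<forall>l. norm (op_smul a (off_zero F l)) \<le> M"
    by (intro exI[of _ "cmod a * M"]) (simp add: norm_op_smul M mult_left_mono)
  moreover have "continuous_on (- {0}) (\<lambda>l. op_smul a (off_zero F l))"
    using 3 by (intro bounded_linear.continuous_on[OF bounded_linear_op_smul]) (simp add: car_field_alg_iff)
  moreover have "((\<lambda>l. op_smul a (off_zero F l)) \<longlongrightarrow> 0) at_infinity"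
    using 3 bounded_linear.tendsto[OF bounded_linear_op_smul, of "off_zero F" 0 at_infinity a]
    by (simp add: car_field_alg_iff op_smul_zero_right)
  ultimately show ?case using 3 unfolding car_field_alg_iff field_alg_simps
    by (simp add: compact_ops_smul op_smul_zero_right)
next
  case (4 F H)
  then obtain M N where M: "\<And>l. norm (off_zero F l) \<le> M" and N: "\<And>l. norm (off_zero H l) \<le> N"
    by (metis car_field_alg_iff)
  have "norm (off_zero F l o\<^sub>L off_zero H l) \<le> M * N" for l
    using norm_blinfun_compose[of "off_zero F l" "off_zero H l"]
      mult_mono[OF M[of l] N[of l] order_trans[OF norm_ge_zero M[of l]] norm_ge_zero] by simp
  then have "\<exists>M. \<forall>l. norm (off_zero F l o\<^sub>L off_zero H l) \<le> M" by blast
  with 4 show ?case unfolding car_field_alg_iff field_alg_simps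
    by (simp add: compact_ops_compose bounded_bilinear.continuous_on[OF bounded_bilinear_blinfun_compose]
        bounded_bilinear.tendsto_zero[OF bounded_bilinear_blinfun_compose])
next
  case (5 F)
  then have c: "clinear_op (off_zero F l)" for l by simp
  have "continuous_on (- {0}) (off_zero F)" using 5 by (simp add: car_field_alg_iff)
  then have "continuous_on (- {0}) (\<lambda>l. op_adj (off_zero F l))"
    by (simp add: continuous_on_iff dist_norm norm_op_adj c clinear_op_diff flip: op_adj_diff)
  moreover have "((\<lambda>l. op_adj (off_zero F l)) \<longlongrightarrow> 0) at_infinity"
    using 5 by (simp add: car_field_alg_iff norm_op_adj c flip: tendsto_norm_zero_iff[of "\<lambda>l. op_adj (off_zero F l)"])
      (simp add: tendsto_norm_zero_iff)
  ultimately show ?case using 5 c unfolding car_field_alg_iff field_alg_simps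
    by (simp add: compact_ops_adj op_adj_zero norm_op_adj)
qed (intro op_field_eqI; simp add: G.add_assoc G.add_commute G.add_zer G.zer_add G.dif_self G.smul_one G.smul_smul G.smul_add_left
      G.smul_add_right G.mul_assoc G.mul_add_left G.mul_add_right G.mul_smul_left G.mul_smul_right G.star_star
      G.star_add G.star_smul G.star_mul
      G.add_left_commute add_ac op_smul_one op_smul_smul op_smul_add_left op_smul_add_right
      blinfun_compose_assoc bounded_bilinear.add_left[OF bounded_bilinear_blinfun_compose] bounded_bilinear.add_right[OF bounded_bilinear_blinfun_compose]
      op_smul_compose_left op_smul_compose_right op_adj_adj op_adj_add op_adj_smul op_adj_compose)+

text \<open>The norm of a field is the least common bound of its values; all norm axioms are derived in this
  form.\<close>

lemma nrm_field_alg_le_iff: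
  assumes F: "F \<in> car field_alg"
  shows "nrm field_alg F \<le> c \<longleftrightarrow> (\<forall>l. norm (off_zero F l) \<le> c) \<and> nrm group_cstar (at_zero F) \<le> c"
proof -
  have bdd: "bdd_above ((\<lambda>l. norm (off_zero F l)) ` (- {0}))"
  proof -
    obtain M where "\<forall>l. norm (off_zero F l) \<le> M" using F unfolding car_field_alg_iff by blast
    then show ?thesis by (intro bdd_aboveI2[where M = M]) simp
  qed
  have "1 \<in> - {0 :: real}" by simp
  then have ne: "- {0} \<noteq> ({} :: real set)" by blast
  have "nrm field_alg F \<le> c \<longleftrightarrow> (\<forall>l\<in>- {0}. norm (off_zero F l) \<le> c) \<and> nrm group_cstar (at_zero F) \<le> c"
  proof -
    have "nrm field_alg F = max (SUP l\<in>- {0}. norm (off_zero F l)) (nrm group_cstar (at_zero F))"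
      unfolding field_alg_def by (simp only: star_alg.simps)
    then show ?thesis by (simp only: max.bounded_iff cSUP_le_iff[OF ne bdd])
  qed
  moreover have "norm (off_zero F 0) \<le> c" if "nrm group_cstar (at_zero F) \<le> c"
  proof -
    have "off_zero F 0 = 0" using F by (simp add: car_field_alg_iff)
    moreover have "0 \<le> nrm group_cstar (at_zero F)" using F by (intro G.nrm_nonneg) simp
    ultimately show ?thesis using that by simp
  qed
  moreover have "(\<forall>l. norm (off_zero F l) \<le> c) \<longleftrightarrow>
      (\<forall>l\<in>- {0}. norm (off_zero F l) \<le> c) \<and> norm (off_zero F 0) \<le> c"
    by (metis ComplI singletonD)
  ultimately show ?thesis by (simp only:) argo
qed

lemma norm_off_zero_le: "F \<in> car field_alg \<Longrightarrow> norm (off_zero F l) \<le> nrm field_alg F"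
  using iffD1[OF nrm_field_alg_le_iff order_refl] by blast

lemma nrm_at_zero_le: "F \<in> car field_alg \<Longrightarrow> nrm group_cstar (at_zero F) \<le> nrm field_alg F"
  using iffD1[OF nrm_field_alg_le_iff order_refl] by blast

lemma cstar_seminormed_field_alg: "cstar_seminormed (field_alg :: 'n::finite op_field star_alg)"
proof -
  interpret F: star_algebra "field_alg :: 'n op_field star_alg" by (rule star_algebra_field_alg)
  have nn: "0 \<le> nrm field_alg F" if "F \<in> car field_alg" for F :: "'n op_field"
    by (rule order_trans[OF norm_ge_zero norm_off_zero_le[OF that, of 0]])
  show ?thesis
  proof (unfold_locales, goal_cases)
    case (1 F) then show ?case by (rule nn)
  next
    case (2 F H)
    have "norm (off_zero F l + off_zero H l) \<le> nrm field_alg F + nrm field_alg H" for l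
      using norm_triangle_ineq[of "off_zero F l" "off_zero H l"]
        norm_off_zero_le[OF 2(1), of l] norm_off_zero_le[OF 2(2), of l] by simp
    moreover have "nrm group_cstar (add group_cstar (at_zero F) (at_zero H)) \<le> nrm field_alg F + nrm field_alg H"
      using G.nrm_add[of "at_zero F" "at_zero H"] nrm_at_zero_le[OF 2(1)] nrm_at_zero_le[OF 2(2)] 2 by simp
    ultimately show ?case by (subst nrm_field_alg_le_iff) (simp_all add: 2)
  next
    case (3 F a)
    show ?case
    proof (rule F.homogeneousI[OF nn _ 3])
      fix a and F :: "'n op_field" assume F: "F \<in> car field_alg"
      then show "nrm field_alg (smul field_alg a F) \<le> cmod a * nrm field_alg F"
        by (subst nrm_field_alg_le_iff)
          (simp_all add: norm_op_smul G.nrm_smul mult_left_mono norm_off_zero_le nrm_at_zero_le)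
    qed
  next
    case (4 F H)
    have "norm (off_zero F l o\<^sub>L off_zero H l) \<le> nrm field_alg F * nrm field_alg H" for l
      by (rule order_trans[OF norm_blinfun_compose mult_mono[OF norm_off_zero_le norm_off_zero_le]])
        (simp_all add: 4 nn)
    moreover have "nrm group_cstar (mul group_cstar (at_zero F) (at_zero H)) \<le> nrm field_alg F * nrm field_alg H"
      by (rule order_trans[OF G.nrm_mul mult_mono[OF nrm_at_zero_le nrm_at_zero_le]])
        (simp_all add: 4 nn G.nrm_nonneg)
    ultimately show ?case by (subst nrm_field_alg_le_iff) (simp_all add: 4)
  next
    case (5 F)
    let ?H = "mul field_alg (star field_alg F) F"
    have H: "?H \<in> car field_alg" using 5 by simp
    have o: "norm (off_zero ?H l) = (norm (off_zero F l))\<^sup>2" for l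
      using 5 by (simp add: norm_adj_compose)
    have z: "nrm group_cstar (at_zero ?H) = (nrm group_cstar (at_zero F))\<^sup>2"
      using 5 by (simp add: G.cstar_identity)
    show ?case
    proof (rule antisym)
      show "nrm field_alg ?H \<le> (nrm field_alg F)\<^sup>2"
        unfolding nrm_field_alg_le_iff[OF H] o z
        using 5 by (simp add: power_mono norm_off_zero_le nrm_at_zero_le G.nrm_nonneg)
      have "nrm field_alg F \<le> sqrt (nrm field_alg ?H)"
        unfolding nrm_field_alg_le_iff[OF 5]
        using norm_off_zero_le[OF H, unfolded o] nrm_at_zero_le[OF H, unfolded z]
        by (auto intro: real_le_rsqrt)
      from power_mono[OF this nn[OF 5], of 2] show "(nrm field_alg F)\<^sup>2 \<le> nrm field_alg ?H"
        using nn[OF H] by simp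
    qed
  qed
qed

text \<open>A Cauchy sequence of fields converges uniformly in \<open>\<lambda>\<close>, and each defining condition survives
  uniform limits.\<close>

lemma cstar_algebra_field_alg: "cstar_algebra (field_alg :: 'n::finite op_field star_alg)"
proof -
  interpret F: cstar_seminormed "field_alg :: 'n op_field star_alg" by (rule cstar_seminormed_field_alg)
  show ?thesis
  proof (rule F.cstar_algebraI)
    fix F :: "'n op_field" assume F: "F \<in> car field_alg" "nrm field_alg F = 0"
    then have "off_zero F l = 0" for l using norm_off_zero_le[OF F(1), of l] by simp
    moreover have "nrm group_cstar (at_zero F) = 0"
      using nrm_at_zero_le[OF F(1)] G.nrm_nonneg[of "at_zero F"] F by simp
    ultimately show "F = zer field_alg"
      using F(1) by (intro op_field_eqI) (simp_all add: GC.nrm_eq_0)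
  next
    fix X :: "nat \<Rightarrow> 'n op_field" assume X: "X \<in> cauchy_seqs field_alg"
    note Xc = F.cauchy_seqs_car[OF X]
    have cauchy: "\<exists>N. \<forall>j\<ge>N. \<forall>k\<ge>N. (\<forall>l. norm (off_zero (X j) l - off_zero (X k) l) < e) \<and>
        nrm group_cstar (dif group_cstar (at_zero (X j)) (at_zero (X k))) < e" if "0 < e" for e
    proof -
      from F.cauchy_seqsD[OF X that] obtain N
        where N: "\<forall>j\<ge>N. \<forall>k\<ge>N. nrm field_alg (dif field_alg (X j) (X k)) < e" by blast
      show ?thesis
      proof (intro exI[of _ N] allI impI conjI)
        fix j k l assume "N \<le> j" "N \<le> k"
        with N have lt: "nrm field_alg (dif field_alg (X j) (X k)) < e" by blast
        have D: "dif field_alg (X j) (X k) \<in> car field_alg" using Xc by simp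
        show "norm (off_zero (X j) l - off_zero (X k) l) < e"
          using norm_off_zero_le[OF D, of l] lt by simp
        show "nrm group_cstar (dif group_cstar (at_zero (X j)) (at_zero (X k))) < e"
          using nrm_at_zero_le[OF D] lt by simp
      qed
    qed
    have "uniformly_Cauchy_on UNIV (\<lambda>k l. off_zero (X k) l)"
      unfolding uniformly_Cauchy_on_def dist_norm
    proof (intro allI impI)
      fix e :: real assume "0 < e"
      from cauchy[OF this] obtain N
        where "\<forall>j\<ge>N. \<forall>k\<ge>N. \<forall>l. norm (off_zero (X j) l - off_zero (X k) l) < e" by blast
      then show "\<exists>M. \<forall>x\<in>UNIV. \<forall>m\<ge>M. \<forall>n\<ge>M. norm (off_zero (X m) x - off_zero (X n) x) < e" by blast
    qed
    then obtain f where f: "uniform_limit UNIV (\<lambda>k. off_zero (X k)) f sequentially"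
      using Cauchy_uniformly_convergent unfolding uniformly_convergent_on_def by blast
    have "(\<lambda>k. at_zero (X k)) \<in> cauchy_seqs group_cstar"
      unfolding cauchy_seqs_def
    proof (intro CollectI conjI allI impI)
      fix e :: real assume "0 < e"
      from cauchy[OF this] show "\<exists>N. \<forall>j\<ge>N. \<forall>k\<ge>N.
          nrm group_cstar (dif group_cstar (at_zero (X j)) (at_zero (X k))) < e" by blast
    qed (simp add: Xc)
    from GC.complete[OF this] obtain g where g: "g \<in> car group_cstar"
      and gl: "(\<lambda>k. nrm group_cstar (dif group_cstar (at_zero (X k)) g)) \<longlonglongrightarrow> 0" by blast
    have near: "\<exists>N. \<forall>k\<ge>N. \<forall>l. norm (f l - off_zero (X k) l) < e" if "0 < e" for e
      using uniform_limitD[OF f that] by (auto simp: eventually_sequentially dist_norm norm_minus_commute)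
    have "(f, g) \<in> car field_alg"
      unfolding car_field_alg_iff fst_conv snd_conv
    proof (intro conjI allI g)
      have "(\<lambda>k. off_zero (X k) 0) \<longlonglongrightarrow> f 0" using tendsto_uniform_limitI[OF f] by simp
      moreover have "off_zero (X k) 0 = 0" for k using Xc[of k] by (simp add: car_field_alg_iff)
      ultimately show "f 0 = 0" by (simp add: LIMSEQ_const_iff)
    next
      fix l
      show "f l \<in> compact_ops"
      proof (rule compact_ops_limit)
        fix e :: real assume "0 < e"
        from near[OF this] obtain N where "norm (f l - off_zero (X N) l) < e" by blast
        moreover have "off_zero (X N) l \<in> compact_ops" using Xc[of N] by (simp add: car_field_alg_iff)
        ultimately show "\<exists>S\<in>compact_ops. norm (f l - S) < e" by blast
      qed
    next
      have "uniform_limit (- {0}) (\<lambda>k. off_zero (X k)) f sequentially"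
        using f by (rule uniform_limit_on_subset) simp
      then show "continuous_on (- {0}) f"
        by (rule uniform_limit_theorem[rotated])
          (use Xc in \<open>simp_all add: car_field_alg_iff\<close>)
    next
      show "(f \<longlongrightarrow> 0) at_infinity"
      proof (rule tendstoI)
        fix e :: real assume "0 < e"
        then have "0 < e / 2" by simp
        from near[OF this] obtain N where N: "\<And>l. norm (f l - off_zero (X N) l) < e / 2" by blast
        have "(off_zero (X N) \<longlongrightarrow> 0) at_infinity" using Xc[of N] by (simp add: car_field_alg_iff)
        then have "\<forall>\<^sub>F l in at_infinity. dist (off_zero (X N) l) 0 < e / 2" using \<open>0 < e / 2\<close> by (rule tendstoD)
        then show "\<forall>\<^sub>F l in at_infinity. dist (f l) 0 < e"
        proof eventually_elim
          case (elim l)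
          with N[of l] norm_triangle_sub[of "f l" "off_zero (X N) l"] show ?case by simp
        qed
      qed
    next
      from near[of 1] obtain N where N: "\<And>l. norm (f l - off_zero (X N) l) < 1" by auto
      obtain M where M: "\<And>l. norm (off_zero (X N) l) \<le> M" using Xc[of N] by (auto simp: car_field_alg_iff)
      have "norm (f l) \<le> M + 1" for l
        using N[of l] M[of l] norm_triangle_sub[of "f l" "off_zero (X N) l"] by linarith
      then show "\<exists>M. \<forall>l. norm (f l) \<le> M" by blast
    qed
    note fg = this
    have "(\<lambda>k. nrm field_alg (dif field_alg (X k) (f, g))) \<longlonglongrightarrow> 0"
    proof (rule LIMSEQ_I)
      fix e :: real assume "0 < e"
      then have "0 < e / 2" by simp
      from near[OF this] obtain N where N: "\<forall>k\<ge>N. \<forall>l. norm (f l - off_zero (X k) l) < e / 2" by blast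
      from LIMSEQ_D[OF gl \<open>0 < e / 2\<close>] obtain M where
        M: "\<forall>k\<ge>M. norm (nrm group_cstar (dif group_cstar (at_zero (X k)) g) - 0) < e / 2" by blast
      have "norm (nrm field_alg (dif field_alg (X k) (f, g)) - 0) < e" if k: "k \<ge> max M N" for k
      proof -
        have D: "dif field_alg (X k) (f, g) \<in> car field_alg" using Xc fg by simp
        have "norm (off_zero (X k) l - f l) \<le> e / 2" for l
          using N k by (simp add: norm_minus_commute[of _ "f l"] less_imp_le)
        moreover have "nrm group_cstar (dif group_cstar (at_zero (X k)) g) \<le> e / 2"
          using M[rule_format, of k] k by simp
        ultimately have "nrm field_alg (dif field_alg (X k) (f, g)) \<le> e / 2"
          unfolding nrm_field_alg_le_iff[OF D] field_alg_simps fst_conv snd_conv by blast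
        with F.nrm_nonneg[OF D] \<open>0 < e\<close> show ?thesis by simp
      qed
      then show "\<exists>N. \<forall>k\<ge>N. norm (nrm field_alg (dif field_alg (X k) (f, g)) - 0) < e" by blast
    qed
    with fg show "\<exists>F\<in>car field_alg. (\<lambda>k. nrm field_alg (dif field_alg (X k) F)) \<longlonglongrightarrow> 0" by blast
  qed
qed


section \<open>The extension defined by an almost homomorphism\<close>

lemma tendsto_compose_left_zero:
  fixes S :: "'c \<Rightarrow> 'a::real_normed_vector \<Rightarrow>\<^sub>L 'b::real_normed_vector"
    and R :: "'c \<Rightarrow> 'd::real_normed_vector \<Rightarrow>\<^sub>L 'a"
  assumes "(S \<longlongrightarrow> 0) F" "\<And>l. norm (R l) \<le> M"
  shows "((\<lambda>l. S l o\<^sub>L R l) \<longlongrightarrow> 0) F"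
proof (rule tendsto_0_le[OF assms(1)])
  have "norm (S l o\<^sub>L R l) \<le> norm (S l) * M" for l
    by (rule order_trans[OF norm_blinfun_compose mult_left_mono[OF assms(2) norm_ge_zero]])
  then show "\<forall>\<^sub>F l in F. norm (S l o\<^sub>L R l) \<le> norm (S l) * M" by simp
qed

lemma tendsto_compose_right_zero:
  fixes S :: "'c \<Rightarrow> 'a::real_normed_vector \<Rightarrow>\<^sub>L 'b::real_normed_vector"
    and R :: "'c \<Rightarrow> 'd::real_normed_vector \<Rightarrow>\<^sub>L 'a"
  assumes "(R \<longlongrightarrow> 0) F" "\<And>l. norm (S l) \<le> M"
  shows "((\<lambda>l. S l o\<^sub>L R l) \<longlongrightarrow> 0) F"
proof (rule tendsto_0_le[OF assms(1)])
  have "norm (S l o\<^sub>L R l) \<le> M * norm (R l)" for l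
    by (rule order_trans[OF norm_blinfun_compose mult_right_mono[OF assms(2) norm_ge_zero]])
  then show "\<forall>\<^sub>F l in F. norm (S l o\<^sub>L R l) \<le> norm (R l) * M" by (simp add: mult.commute)
qed

locale almost_hom_section =
  fixes \<tau> :: "'n::finite gcs \<Rightarrow> 'n op_field"
  assumes almost: "almost_homomorphism \<tau>"
    and section_map: "f \<in> car group_cstar \<Longrightarrow> at_zero (\<tau> f) = f"
begin

interpretation FC: cstar_algebra "field_alg :: 'n op_field star_alg"
  by (rule cstar_algebra_field_alg)

interpretation F: cstar_seminormed "field_alg :: 'n op_field star_alg"
  by (rule cstar_seminormed_field_alg)

abbreviation T :: "'n gcs \<Rightarrow> real \<Rightarrow> 'n op" where
  "T h \<equiv> off_zero (\<tau> h)"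

lemma tau_field: "h \<in> car group_cstar \<Longrightarrow> \<tau> h \<in> car field_alg"
  using almost by (simp add: almost_homomorphism_def)

lemma T_clinear: "h \<in> car group_cstar \<Longrightarrow> clinear_op (T h l)"
  by (simp add: tau_field)

lemma T_bounded: "\<exists>K\<ge>0. \<forall>h\<in>car group_cstar. \<forall>l. norm (T h l) \<le> K * nrm group_cstar h"
proof -
  obtain K where K: "\<forall>h\<in>car group_cstar. nrm field_alg (\<tau> h) \<le> K * nrm group_cstar h"
    using almost unfolding almost_homomorphism_def by blast
  have "norm (T h l) \<le> max K 0 * nrm group_cstar h" if h: "h \<in> car group_cstar" for h l
  proof -
    have "norm (T h l) \<le> nrm field_alg (\<tau> h)" by (rule norm_off_zero_le[OF tau_field[OF h]])
    also have "\<dots> \<le> K * nrm group_cstar h" using K h by blast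
    also have "\<dots> \<le> max K 0 * nrm group_cstar h" by (intro mult_right_mono G.nrm_nonneg h) simp
    finally show ?thesis .
  qed
  then show ?thesis by (intro exI[of _ "max K 0"]) simp
qed

lemma T_zero: "T (zer group_cstar) l = 0"
proof -
  obtain K where "\<forall>h\<in>car group_cstar. \<forall>l. norm (T h l) \<le> K * nrm group_cstar h"
    using T_bounded by blast
  then have "norm (T (zer group_cstar) l) \<le> K * nrm group_cstar (zer (group_cstar :: 'n gcs star_alg))" by blast
  then show ?thesis by simp
qed

lemma T_linear:
  assumes "h \<in> car group_cstar" "f \<in> car group_cstar"
  shows "((\<lambda>l. T (add group_cstar (smul group_cstar a h) (smul group_cstar b f)) l
    - op_smul a (T h l) - op_smul b (T f l)) \<longlongrightarrow> 0) (at 0)"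
proof (rule tendsto_norm_zero_cancel)
  show "((\<lambda>l. norm (T (add group_cstar (smul group_cstar a h) (smul group_cstar b f)) l
      - op_smul a (T h l) - op_smul b (T f l))) \<longlongrightarrow> 0) (at 0)"
    using almost assms unfolding almost_homomorphism_def by blast
qed

lemma T_add:
  assumes "h \<in> car group_cstar" "f \<in> car group_cstar"
  shows "((\<lambda>l. T (add group_cstar h f) l - T h l - T f l) \<longlongrightarrow> 0) (at 0)"
  using T_linear[OF assms, of 1 1] assms by (simp add: G.smul_one op_smul_one)

lemma T_smul:
  assumes "h \<in> car group_cstar"
  shows "((\<lambda>l. T (smul group_cstar a h) l - op_smul a (T h l)) \<longlongrightarrow> 0) (at 0)"
  using T_linear[OF assms assms, of a 0] assms by (simp add: G.smul_zero_left G.add_zer op_smul_zero_left)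

lemma T_mul:
  assumes "h \<in> car group_cstar" "f \<in> car group_cstar"
  shows "((\<lambda>l. T (mul group_cstar h f) l - (T h l o\<^sub>L T f l)) \<longlongrightarrow> 0) (at 0)"
proof (rule tendsto_norm_zero_cancel)
  show "((\<lambda>l. norm (T (mul group_cstar h f) l - (T h l o\<^sub>L T f l))) \<longlongrightarrow> 0) (at 0)"
    using almost assms unfolding almost_homomorphism_def by blast
qed

lemma T_star:
  assumes "h \<in> car group_cstar"
  shows "((\<lambda>l. T (star group_cstar h) l - op_adj (T h l)) \<longlongrightarrow> 0) (at 0)"
proof (rule tendsto_norm_zero_cancel)
  show "((\<lambda>l. norm (T (star group_cstar h) l - op_adj (T h l))) \<longlongrightarrow> 0) (at 0)"
    using almost assms unfolding almost_homomorphism_def by blast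
qed

lemma D_iff:
  "F \<in> car (D_alg \<tau>) \<longleftrightarrow> F \<in> car field_alg \<and> ((\<lambda>l. off_zero F l - T (at_zero F) l) \<longlongrightarrow> 0) (at 0)"
  by (simp add: D_alg_def tendsto_norm_zero_iff)

lemma D_field: "F \<in> car (D_alg \<tau>) \<Longrightarrow> F \<in> car field_alg"
  by (simp add: D_iff)

text \<open>With \<open>h = F\<^sub>k(0) - F(0)\<close>, the difference \<open>F(\<lambda>) - \<tau>\<^sub>\<lambda>(F(0))\<close> splits into \<open>F(\<lambda>) - F\<^sub>k(\<lambda>)\<close>, the
  corresponding difference for \<open>F\<^sub>k\<close>, the defect of additivity of \<open>\<tau>\<^sub>\<lambda>\<close> at \<open>F(0)\<close> and \<open>h\<close>, and
  \<open>\<tau>\<^sub>\<lambda>(h)\<close>. The first and the last are uniformly small for large \<open>k\<close>, the other two tend to \<open>0\<close> for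
  fixed \<open>k\<close>.\<close>

lemma D_limit_closed:
  assumes X: "\<And>k. X k \<in> car (D_alg \<tau>)" and x: "x \<in> car field_alg"
    and lim: "(\<lambda>k. nrm field_alg (dif field_alg (X k) x)) \<longlonglongrightarrow> 0"
  shows "x \<in> car (D_alg \<tau>)"
  unfolding D_iff
proof (intro conjI x tendstoI)
  fix e :: real assume e: "0 < e"
  obtain K where K0: "0 \<le> K" and K: "\<And>h l. h \<in> car group_cstar \<Longrightarrow> norm (T h l) \<le> K * nrm group_cstar h"
    using T_bounded by blast
  let ?e = "e / (4 * (K + 1))"
  have e': "0 < ?e" using e K0 by simp
  have Ke: "K * ?e \<le> e / 4" "?e \<le> e / 4" using e K0 by (simp_all add: field_simps)
  have "\<forall>\<^sub>F k in sequentially. nrm field_alg (dif field_alg (X k) x) < ?e"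
    by (rule order_tendstoD(2)[OF lim e'])
  then obtain k where k: "nrm field_alg (dif field_alg (X k) x) < ?e"
    by (auto simp: eventually_sequentially)
  have Xk: "X k \<in> car field_alg" by (rule D_field[OF X])
  have d: "dif field_alg (X k) x \<in> car field_alg" using Xk x by simp
  define h where "h = dif group_cstar (at_zero (X k)) (at_zero x)"
  have h: "h \<in> car group_cstar" unfolding h_def using Xk x by simp
  have hk: "at_zero (X k) = add group_cstar (at_zero x) h"
    using Xk x by (simp add: h_def G.add_dif_cancel)
  have "nrm group_cstar h \<le> ?e" using nrm_at_zero_le[OF d] k by (simp add: h_def)
  then have "K * nrm group_cstar h \<le> K * ?e" using K0 by (rule mult_left_mono)
  then have Th: "norm (T h l) \<le> e / 4" for l using K[OF h, of l] Ke(1) by linarith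
  have Xx: "norm (off_zero (X k) l - off_zero x l) \<le> e / 4" for l
  proof -
    have "norm (off_zero (X k) l - off_zero x l) \<le> nrm field_alg (dif field_alg (X k) x)"
      using norm_off_zero_le[OF d, of l] by simp
    with k Ke(2) show ?thesis by linarith
  qed
  have "((\<lambda>l. off_zero (X k) l - T (at_zero (X k)) l) \<longlongrightarrow> 0) (at 0)" using X[of k] by (simp add: D_iff)
  then have "\<forall>\<^sub>F l in at 0. dist (off_zero (X k) l - T (at_zero (X k)) l) 0 < e / 4"
    by (rule tendstoD) (use e in simp)
  moreover have "\<forall>\<^sub>F l in at 0. dist (T (at_zero (X k)) l - T (at_zero x) l - T h l) 0 < e / 4"
    unfolding hk by (rule tendstoD[OF T_add]) (use e x h in simp_all)
  ultimately show "\<forall>\<^sub>F l in at 0. dist (off_zero x l - T (at_zero x) l) 0 < e"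
  proof eventually_elim
    case (elim l)
    have "off_zero x l - T (at_zero x) l = - (off_zero (X k) l - off_zero x l)
        + (off_zero (X k) l - T (at_zero (X k)) l)
        + (T (at_zero (X k)) l - T (at_zero x) l - T h l) + T h l" by simp
    also have "norm \<dots> \<le> norm (off_zero (X k) l - off_zero x l)
        + norm (off_zero (X k) l - T (at_zero (X k)) l)
        + norm (T (at_zero (X k)) l - T (at_zero x) l - T h l) + norm (T h l)"
      by (intro norm_triangle_mono order_refl) (simp only: norm_minus_cancel order_refl)
    finally show ?case using elim Th[of l] Xx[of l] by (simp add: dist_norm)
  qed
qed

text \<open>For sums, products, scalar multiples and adjoints, the condition at \<open>\<lambda> \<rightarrow> 0\<close> is the sum of the
  conditions for the operands and the corresponding asymptotic identity for \<open>\<tau>\<close>. Products also use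
  that fields are bounded.\<close>

lemma cstar_algebra_D: "cstar_algebra (D_alg \<tau>)"
proof -
  let ?S = "car (D_alg \<tau>)"
  have D_def: "D_alg \<tau> = field_alg\<lparr>car := ?S\<rparr>" by (simp add: D_alg_def)
  have "cstar_algebra (field_alg\<lparr>car := ?S\<rparr>)"
  proof (rule FC.cstar_subalgebra)
    show "?S \<subseteq> car field_alg" using D_field by blast
    show "zer field_alg \<in> ?S" by (simp add: D_iff T_zero)
  next
    fix F H assume a: "F \<in> ?S" "H \<in> ?S"
    then have FH: "F \<in> car field_alg" "H \<in> car field_alg" by (simp_all add: D_field)
    let ?f = "at_zero F" and ?h = "at_zero H"
    have fh: "?f \<in> car group_cstar" "?h \<in> car group_cstar" using FH by simp_all
    have lF: "((\<lambda>l. off_zero F l - T ?f l) \<longlongrightarrow> 0) (at 0)" and lH: "((\<lambda>l. off_zero H l - T ?h l) \<longlongrightarrow> 0) (at 0)"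
      using a by (simp_all add: D_iff)
    have "((\<lambda>l. (off_zero F l - T ?f l) + (off_zero H l - T ?h l)
        - (T (add group_cstar ?f ?h) l - T ?f l - T ?h l)) \<longlongrightarrow> 0 + 0 - 0) (at 0)"
      by (intro tendsto_diff tendsto_add lF lH T_add fh)
    then show "add field_alg F H \<in> ?S" using FH by (simp add: D_iff algebra_simps)
    obtain M where M: "\<And>l. norm (off_zero H l) \<le> M" using FH(2) unfolding car_field_alg_iff by blast
    obtain N where N: "\<And>l. norm (T ?f l) \<le> N" using tau_field[OF fh(1)] unfolding car_field_alg_iff by blast
    have "((\<lambda>l. ((off_zero F l - T ?f l) o\<^sub>L off_zero H l) + (T ?f l o\<^sub>L (off_zero H l - T ?h l))
        - (T (mul group_cstar ?f ?h) l - (T ?f l o\<^sub>L T ?h l))) \<longlongrightarrow> 0 + 0 - 0) (at 0)"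
      by (intro tendsto_diff tendsto_add tendsto_compose_left_zero[OF lF M]
          tendsto_compose_right_zero[OF lH N] T_mul fh)
    then show "mul field_alg F H \<in> ?S"
      using FH by (simp add: D_iff bounded_bilinear.diff_left[OF bounded_bilinear_blinfun_compose]
          bounded_bilinear.diff_right[OF bounded_bilinear_blinfun_compose])
  next
    fix F a assume a: "F \<in> ?S"
    then have F: "F \<in> car field_alg" by (rule D_field)
    let ?f = "at_zero F"
    have f: "?f \<in> car group_cstar" using F by simp
    have lF: "((\<lambda>l. off_zero F l - T ?f l) \<longlongrightarrow> 0) (at 0)" using a by (simp add: D_iff)
    have "((\<lambda>l. op_smul a (off_zero F l - T ?f l) - (T (smul group_cstar a ?f) l - op_smul a (T ?f l)))
        \<longlongrightarrow> op_smul a 0 - 0) (at 0)"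
      by (intro tendsto_diff bounded_linear.tendsto[OF bounded_linear_op_smul] lF T_smul f)
    then show "smul field_alg a F \<in> ?S"
      using F by (simp add: D_iff op_smul_zero_right linear_diff[OF bounded_linear.linear[OF bounded_linear_op_smul]])
  next
    fix F assume a: "F \<in> ?S"
    then have F: "F \<in> car field_alg" by (rule D_field)
    let ?f = "at_zero F"
    have f: "?f \<in> car group_cstar" using F by simp
    have lF: "((\<lambda>l. norm (off_zero F l - T ?f l)) \<longlongrightarrow> 0) (at 0)"
      using a by (simp add: D_iff tendsto_norm_zero_iff)
    have "((\<lambda>l. op_adj (off_zero F l) - op_adj (T ?f l)) \<longlongrightarrow> 0) (at 0)"
    proof (rule tendsto_norm_zero_cancel)
      have "norm (op_adj (off_zero F l) - op_adj (T ?f l)) = norm (off_zero F l - T ?f l)" for l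
        using F f by (simp add: norm_op_adj clinear_op_diff T_clinear flip: op_adj_diff)
      with lF show "((\<lambda>l. norm (op_adj (off_zero F l) - op_adj (T ?f l))) \<longlongrightarrow> 0) (at 0)" by simp
    qed
    from tendsto_diff[OF this T_star[OF f]]
    show "star field_alg F \<in> ?S" using F by (simp add: D_iff)
  next
    fix X x assume "\<And>k. X k \<in> ?S" "x \<in> car field_alg" "(\<lambda>k. nrm field_alg (dif field_alg (X k) x)) \<longlonglongrightarrow> 0"
    then show "x \<in> ?S" by (rule D_limit_closed)
  qed
  with D_def show ?thesis by simp
qed

text \<open>The limit superior \<open>N(h)\<close> of \<open>\<parallel>\<tau>\<^sub>\<lambda>(h)\<parallel>\<close>, taken as the infimum of all eventual bounds, satisfies
  \<open>N(h)\<^sup>2 \<le> N(h\<^sup>* h)\<close> by the C*-identity of operators, since \<open>\<tau>\<^sub>\<lambda>(h)\<^sup>* \<tau>\<^sub>\<lambda>(h)\<close> and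
  \<open>\<tau>\<^sub>\<lambda>(h\<^sup>* h)\<close> are asymptotically equal.\<close>

lemma limsup_T_le:
  assumes h: "h \<in> car group_cstar" and e: "0 < e"
  shows "\<forall>\<^sub>F l in at 0. norm (T h l) \<le> nrm group_cstar h + e"
proof -
  define S where "S h = {m. 0 \<le> m \<and> (\<forall>\<^sub>F l in at 0. norm (T h l) \<le> m)}" for h
  define N where "N h = Inf (S h)" for h
  obtain K where K0: "0 \<le> K" and K: "\<And>h l. h \<in> car group_cstar \<Longrightarrow> norm (T h l) \<le> K * nrm group_cstar h"
    using T_bounded by blast
  have KS: "K * nrm group_cstar h \<in> S h" if "h \<in> car group_cstar" for h
    using K[OF that] K0 G.nrm_nonneg[OF that] by (simp add: S_def)
  have bdd: "bdd_below (S h)" for h by (rule bdd_belowI[of _ 0]) (simp add: S_def)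
  have lower: "N h \<le> m" if "m \<in> S h" for h m unfolding N_def by (rule cInf_lower[OF that bdd])
  have N0: "0 \<le> N h" if "h \<in> car group_cstar" for h
    unfolding N_def by (rule cInf_greatest) (use KS[OF that] in \<open>auto simp: S_def\<close>)
  have "N h \<le> nrm group_cstar h"
  proof (rule G.bounded_imp_contractive[OF N0 _ _ h, where K = K])
    fix h :: "'n gcs" assume h: "h \<in> car group_cstar"
    then show "N h \<le> K * nrm group_cstar h" by (intro lower KS)
    let ?h = "mul group_cstar (star group_cstar h) h"
    have hc: "star group_cstar h \<in> car group_cstar" "?h \<in> car group_cstar" using h by simp_all
    obtain M where M: "\<And>l. norm (T h l) \<le> M" using tau_field[OF h] unfolding car_field_alg_iff by blast
    have "((\<lambda>l. ((T (star group_cstar h) l - op_adj (T h l)) o\<^sub>L T h l)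
        + (T ?h l - (T (star group_cstar h) l o\<^sub>L T h l))) \<longlongrightarrow> 0 + 0) (at 0)"
      by (intro tendsto_add tendsto_compose_left_zero[OF T_star[OF h] M] T_mul h hc)
    then have lim: "((\<lambda>l. T ?h l - (op_adj (T h l) o\<^sub>L T h l)) \<longlongrightarrow> 0) (at 0)"
      by (simp add: bounded_bilinear.diff_left[OF bounded_bilinear_blinfun_compose])
    have "(N h)\<^sup>2 \<le> m" if m: "m \<in> S ?h" for m
    proof (rule field_le_epsilon)
      fix e :: real assume e: "0 < e"
      have "\<forall>\<^sub>F l in at 0. norm (T ?h l) \<le> m" using m by (simp add: S_def)
      moreover have "\<forall>\<^sub>F l in at 0. dist (T ?h l - (op_adj (T h l) o\<^sub>L T h l)) 0 < e"
        by (rule tendstoD[OF lim e])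
      ultimately have "\<forall>\<^sub>F l in at 0. norm (T h l) \<le> sqrt (m + e)"
      proof eventually_elim
        case (elim l)
        have "(norm (T h l))\<^sup>2 = norm (op_adj (T h l) o\<^sub>L T h l)"
          by (simp add: norm_adj_compose T_clinear h)
        also have "\<dots> \<le> norm (T ?h l) + norm (T ?h l - (op_adj (T h l) o\<^sub>L T h l))"
          using norm_triangle_sub[of "op_adj (T h l) o\<^sub>L T h l" "T ?h l"] by (simp add: norm_minus_commute)
        also have "\<dots> \<le> m + e" using elim by (simp add: dist_norm)
        finally show ?case by (rule real_le_rsqrt)
      qed
      moreover have "0 \<le> m" using m by (simp add: S_def)
      ultimately have "N h \<le> sqrt (m + e)" using e by (intro lower) (simp add: S_def)
      then have "(N h)\<^sup>2 \<le> (sqrt (m + e))\<^sup>2" by (rule power_mono[OF _ N0[OF h]])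
      with \<open>0 \<le> m\<close> e show "(N h)\<^sup>2 \<le> m + e" by simp
    qed
    then show "(N h)\<^sup>2 \<le> N ?h" unfolding N_def[of ?h]
      by (intro cInf_greatest) (use KS[OF hc(2)] in auto)
  qed
  then have "Inf (S h) < nrm group_cstar h + e" using e by (simp add: N_def)
  then obtain m where "m \<in> S h" "m < nrm group_cstar h + e"
    using KS[OF h] cInf_lessD[of "S h"] by blast
  then have m: "\<forall>\<^sub>F l in at 0. norm (T h l) \<le> m" "m \<le> nrm group_cstar h + e" by (simp_all add: S_def)
  show ?thesis by (rule eventually_mono[OF m(1)]) (rule order_trans[OF _ m(2)])
qed

text \<open>The cutoff \<open>c\<close> is 1 at \<open>0\<close> and vanishes outside the interval on which the norm of the field is
  already small. Multiplication by \<open>c\<close> does not affect the behaviour at \<open>\<lambda> \<rightarrow> 0\<close>, because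
  \<open>c(\<lambda>) \<rightarrow> 1\<close> and the field is bounded.\<close>

lemma D_lift:
  assumes F: "F \<in> car (D_alg \<tau>)" and e: "0 < e"
  shows "\<exists>H\<in>car (D_alg \<tau>). at_zero H = at_zero F \<and> nrm field_alg H \<le> nrm group_cstar (at_zero F) + e"
proof -
  let ?f = "at_zero F"
  have Ff: "F \<in> car field_alg" by (rule D_field[OF F])
  have f: "?f \<in> car group_cstar" using Ff by simp
  have lF: "((\<lambda>l. off_zero F l - T ?f l) \<longlongrightarrow> 0) (at 0)" using F by (simp add: D_iff)
  have "\<forall>\<^sub>F l in at 0. dist (off_zero F l - T ?f l) 0 < e / 2" by (rule tendstoD[OF lF]) (use e in simp)
  moreover have "\<forall>\<^sub>F l in at 0. norm (T ?f l) \<le> nrm group_cstar ?f + e / 2"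
    by (rule limsup_T_le[OF f]) (use e in simp)
  ultimately have "\<forall>\<^sub>F l in at 0. norm (off_zero F l) \<le> nrm group_cstar ?f + e"
  proof eventually_elim
    case (elim l)
    then show ?case using norm_triangle_sub[of "off_zero F l" "T ?f l"] by (simp add: dist_norm)
  qed
  then obtain d where d: "0 < d" and small: "\<And>l. l \<noteq> 0 \<Longrightarrow> \<bar>l\<bar> < d \<Longrightarrow> norm (off_zero F l) \<le> nrm group_cstar ?f + e"
    by (auto simp: eventually_at dist_real_def)
  obtain M where M: "\<And>l. norm (off_zero F l) \<le> M" using Ff unfolding car_field_alg_iff by blast
  define c where "c l = max 0 (1 - \<bar>l\<bar> / d)" for l :: real
  have c01: "0 \<le> c l" "c l \<le> 1" for l using d by (simp_all add: c_def)
  have c_cont: "continuous_on A c" for A unfolding c_def by (intro continuous_intros) (use d in simp)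
  have c_le: "norm (c l *\<^sub>R off_zero F l) \<le> norm (off_zero F l)" for l
    using mult_right_mono[OF c01(2)[of l] norm_ge_zero[of "off_zero F l"]] c01(1)[of l] by simp
  define H where "H = ((\<lambda>l. c l *\<^sub>R off_zero F l), ?f)"
  have "H \<in> car field_alg"
    unfolding car_field_alg_iff H_def fst_conv snd_conv
  proof (intro conjI allI f)
    show "c 0 *\<^sub>R off_zero F 0 = 0" using Ff by (simp add: car_field_alg_iff)
    fix l show "c l *\<^sub>R off_zero F l \<in> compact_ops"
      using Ff by (simp add: car_field_alg_iff compact_ops_smul flip: op_smul_of_real)
  next
    show "continuous_on (- {0}) (\<lambda>l. c l *\<^sub>R off_zero F l)"
      using Ff by (intro continuous_intros c_cont) (simp add: car_field_alg_iff)
    have "(off_zero F \<longlongrightarrow> 0) at_infinity" using Ff by (simp add: car_field_alg_iff)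
    then show "((\<lambda>l. c l *\<^sub>R off_zero F l) \<longlongrightarrow> 0) at_infinity"
      by (rule tendsto_0_le[where K = 1]) (use c_le in simp)
    show "\<exists>M. \<forall>l. norm (c l *\<^sub>R off_zero F l) \<le> M"
      using order_trans[OF c_le M] by blast
  qed
  note Hf = this
  have "isCont c 0" using c_cont[of UNIV] by (simp add: continuous_on_eq_continuous_at)
  then have "(c \<longlongrightarrow> c 0) (at 0)" by (simp add: isCont_def)
  then have "((\<lambda>l. c l - 1) \<longlongrightarrow> c 0 - 1) (at 0)" by (intro tendsto_diff tendsto_const)
  then have c1: "((\<lambda>l. c l - 1) \<longlongrightarrow> 0) (at 0)" by (simp add: c_def)
  have "((\<lambda>l. (c l - 1) *\<^sub>R off_zero F l) \<longlongrightarrow> 0) (at 0)"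
    by (rule tendsto_0_le[OF c1, where K = M]) (simp add: mult_left_mono M)
  from tendsto_add[OF this lF] have "((\<lambda>l. c l *\<^sub>R off_zero F l - T ?f l) \<longlongrightarrow> 0) (at 0)"
    by (simp add: algebra_simps)
  then have "H \<in> car (D_alg \<tau>)" using Hf by (simp add: D_iff H_def)
  moreover have "nrm field_alg H \<le> nrm group_cstar ?f + e"
    unfolding nrm_field_alg_le_iff[OF Hf]
  proof (intro conjI allI)
    have f0: "0 \<le> nrm group_cstar ?f" by (rule G.nrm_nonneg[OF f])
    show "nrm group_cstar (at_zero H) \<le> nrm group_cstar ?f + e" using e by (simp add: H_def)
    fix l
    consider "l = 0" | "l \<noteq> 0" "\<bar>l\<bar> < d" | "d \<le> \<bar>l\<bar>" by linarith
    then show "norm (off_zero H l) \<le> nrm group_cstar ?f + e"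
    proof cases
      case 1
      then show ?thesis using Hf f0 e by (simp add: car_field_alg_iff)
    next
      case 2
      from order_trans[OF c_le small[OF 2]] show ?thesis by (simp add: H_def)
    next
      case 3
      then have "c l = 0" using d by (simp add: c_def)
      then show ?thesis using f0 e by (simp add: H_def)
    qed
  qed
  ultimately show ?thesis by (intro bexI[of _ H] conjI) (simp_all add: H_def)
qed

lemma star_hom_at_zero: "star_hom (D_alg \<tau>) (group_cstar :: 'n gcs star_alg) at_zero"
proof -
  interpret D: cstar_algebra "D_alg \<tau>" by (rule cstar_algebra_D)
  interpret D: cstar_seminormed "D_alg \<tau>" by (rule D.cstar_seminormed)
  have ops: "add (D_alg \<tau>) = add field_alg" "smul (D_alg \<tau>) = smul field_alg"
    "mul (D_alg \<tau>) = mul field_alg" "star (D_alg \<tau>) = star field_alg"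
    by (simp_all add: D_alg_def)
  show ?thesis by unfold_locales (simp_all add: ops D_field)
qed

text \<open>Membership of a \<open>C\<^sub>0\<close> field in the field algebra requires boundedness: with value \<open>0\<close> at \<open>0\<close> it is
  continuous on the whole line, hence bounded on compact intervals, and it vanishes at infinity.\<close>

lemma kernel_at_zero: "star_hom.kernel (D_alg \<tau>) (group_cstar :: 'n gcs star_alg) at_zero = C0_compact"
proof -
  interpret P: star_hom "D_alg \<tau>" "group_cstar :: 'n gcs star_alg" at_zero by (rule star_hom_at_zero)
  show ?thesis
  proof (intro equalityI subsetI)
    fix F assume "F \<in> P.kernel"
    then have F: "F \<in> car (D_alg \<tau>)" and 0: "at_zero F = zer group_cstar" by (simp_all add: P.kernel_def)
    then show "F \<in> C0_compact" using D_field[OF F]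
      by (simp add: C0_compact_def D_iff T_zero car_field_alg_iff tendsto_norm_zero_iff)
  next
    fix F :: "'n op_field" assume F: "F \<in> C0_compact"
    have c: "off_zero F l \<in> compact_ops" for l
      using F by (cases "l = 0") (simp_all add: C0_compact_def compact_ops_zero)
    have cont: "continuous_on (- {0}) (off_zero F)" and lim0: "(off_zero F \<longlongrightarrow> 0) (at 0)"
      and liminf: "(off_zero F \<longlongrightarrow> 0) at_infinity" and F0: "off_zero F 0 = 0"
      using F by (simp_all add: C0_compact_def tendsto_norm_zero_iff)
    have "continuous_on UNIV (off_zero F)"
      unfolding continuous_on_eq_continuous_at[OF open_UNIV]
    proof
      fix l :: real
      show "isCont (off_zero F) l"
      proof (cases "l = 0")
        case True
        with lim0 F0 show ?thesis by (simp add: isCont_def)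
      next
        case False
        have "open (- {0 :: real})" by (rule open_Compl) (rule closed_singleton)
        with cont False show ?thesis by (simp add: continuous_on_eq_continuous_at)
      qed
    qed
    obtain B where B: "\<And>l. B \<le> norm l \<Longrightarrow> norm (off_zero F l) < 1"
      using tendstoD[OF liminf, of 1] by (auto simp: eventually_at_infinity)
    have "compact (off_zero F ` cball 0 B)"
      by (intro compact_continuous_image continuous_on_subset[OF \<open>continuous_on UNIV (off_zero F)\<close>]) simp_all
    then have "bounded (off_zero F ` cball 0 B)" by (rule compact_imp_bounded)
    then obtain M where "\<forall>T\<in>off_zero F ` cball 0 B. norm T \<le> M" unfolding bounded_iff by blast
    then have M: "norm (off_zero F l) \<le> M" if "l \<in> cball 0 B" for l using that by simp
    have "norm (off_zero F l) \<le> max M 1" for l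
    proof (cases "B \<le> norm l")
      case True
      from less_imp_le[OF B[OF this]] show ?thesis by simp
    next
      case False
      then have "l \<in> cball 0 B" by simp
      from M[OF this] show ?thesis by simp
    qed
    then have bounded: "\<exists>M. \<forall>l. norm (off_zero F l) \<le> M" by blast
    have z: "at_zero F = zer group_cstar" using F by (simp add: C0_compact_def)
    have "F \<in> car field_alg"
      unfolding car_field_alg_iff z by (intro conjI allI F0 c G.zer_closed cont liminf bounded)
    with z lim0 show "F \<in> P.kernel"
      by (simp add: P.kernel_def D_iff T_zero)
  qed
qed

lemma extension:
  "closed_star_ideal (D_alg \<tau>) C0_compact"
  "cstar_isomorphic (quotient_alg (D_alg \<tau>) C0_compact) (group_cstar :: 'n gcs star_alg)"
proof -
  interpret P: star_hom "D_alg \<tau>" "group_cstar :: 'n gcs star_alg" at_zero by (rule star_hom_at_zero)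
  have nrm: "nrm (D_alg \<tau>) = nrm field_alg" by (simp add: D_alg_def)
  have contractive: "nrm group_cstar (at_zero F) \<le> nrm (D_alg \<tau>) F" if "F \<in> car (D_alg \<tau>)" for F
    unfolding nrm by (rule nrm_at_zero_le[OF D_field[OF that]])
  show "closed_star_ideal (D_alg \<tau>) C0_compact"
    using P.closed_star_ideal_kernel[OF GC.cstar_algebra_axioms contractive] by (simp add: kernel_at_zero)
  have "at_zero ` car (D_alg \<tau>) = car group_cstar"
  proof (intro equalityI subsetI)
    fix f :: "'n gcs" assume f: "f \<in> car group_cstar"
    then have "\<tau> f \<in> car (D_alg \<tau>)" by (simp add: D_iff tau_field section_map)
    moreover have "f = at_zero (\<tau> f)" using f by (simp add: section_map)
    ultimately show "f \<in> at_zero ` car (D_alg \<tau>)" by (rule rev_image_eqI)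
  next
    fix f assume "f \<in> at_zero ` car (D_alg \<tau>)"
    then show "f \<in> car group_cstar" using P.closed by blast
  qed
  from P.quotient_kernel_isomorphic[OF this contractive] D_lift
  show "cstar_isomorphic (quotient_alg (D_alg \<tau>) C0_compact) (group_cstar :: 'n gcs star_alg)"
    by (simp add: kernel_at_zero nrm)
qed

end

theorem proposition2p19:
  fixes \<tau> :: "'n::finite gcs \<Rightarrow> 'n op_field"
  assumes "almost_homomorphism \<tau>"
    and "\<forall>f\<in>car group_cstar. at_zero (\<tau> f) = f"
  shows "cstar_algebra (D_alg \<tau>) \<and>
    closed_star_ideal (D_alg \<tau>) C0_compact \<and>
    cstar_isomorphic (quotient_alg (D_alg \<tau>) C0_compact) (group_cstar :: 'n gcs star_alg)"
proof -
  interpret almost_hom_section \<tau> by unfold_locales (use assms in auto)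
  show ?thesis using cstar_algebra_D extension by blast
qed

end
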